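(* Let $(H,\mu,\nu,\Delta,\varepsilon)$ be a bialgebra in the category $\mathbf{vect}_\Bbbk$ of finite-dimensional vector spaces over a field $\Bbbk$, and let $(M,\ \rho\colon M\otimes H\to M,\ \lambda\colon H\otimes M\to M,\ \delta\colon M\to M\otimes H,\ \gamma\colon M\to H\otimes M)$ be a Hopf bimodule over $H$ in $\mathbf{vect}_\Bbbk$. Then the bar complex $(M\otimes T(H),d_{bar})$ for $H$ with coefficients in $M$ is a complex in the category ${}_H^H\mathbf{Mod}_H^H$ of Hopf bimodules over $H$. In other words, the differentials $(d_{bar})_n\colon M\otimes H^{\otimes n}\to M\otimes H^{\otimes(n-1)}$ are Hopf bimodule morphisms, with the following Hopf bimodule structure on $M\otimes H^{\otimes n}$: $$\rho_{bar}=\mu^{n+1},\qquad\lambda_{bar}=\lambda^1\qquad\text{(peripheral actions)},$$ $$\delta_{bar}=(\mu^{n+2})^{(n)}\,\omega_{2(n+1)}^{-1}\,(\delta\otimes\Delta^{\otimes n}),\qquad \gamma_{bar}=(\mu^{1})^{(n)}\,\omega_{2(n+1)}^{-1}\,(\gamma\otimes\Delta^{\otimes n})\qquad\text{(diagonal coactions)}.$$ (For $n=0$, $\rho_{bar}=\rho$.)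
   Context: $\varphi^p$ denotes $\varphi$ applied to consecutive tensor factors starting at position $p$, with identities elsewhere; $(\mu^p)^{(k)}$ denotes $\mu^p$ iterated $k$ times; juxtaposition is composition. The permutation $\omega_{2k}\in S_{2k}$ is given by $\omega_{2k}(j)=2j-1$ and $\omega_{2k}(k+j)=2j$ for $1\le j\le k$; permutations act on tensor products by permuting factors (the factor at position $p$ moves to position $\theta(p)$ under $\theta$), so $\omega_{2k}^{-1}$ moves the odd-position factors, in order, to the first $k$ positions and the even-position factors, in order, to the last $k$ positions. Thus, in Sweedler notation, $\delta_{bar}(m\otimes h_1\ldots h_n)=m_{(0)}\otimes h_{1(1)}\ldots h_{n(1)}\otimes m_{(1)}h_{1(2)}\cdots h_{n(2)}$ and $\gamma_{bar}(m\otimes h_1\ldots h_n)=m_{(-1)}h_{1(1)}\cdots h_{n(1)}\otimes m_{(0)}\otimes h_{1(2)}\ldots h_{n(2)}$. The bar differential is $(d_{bar})_n=\rho^1+\sum_{i=1}^{n-1}(-1)^i\mu^{i+1}$ on $M\otimes H^{\otimes n}$, i.e. $m\otimes h_1\ldots h_n\mapsto \rho(m\otimes h_1)\otimes h_2\ldots h_n+\sum_{i=1}^{n-1}(-1)^i m\otimes h_1\ldots(h_ih_{i+1})\ldots h_n$. A Hopf bimodule over $H$ is an object $M$ with an $H$-bimodule structure $(\rho,\lambda)$ and an $H$-bicomodule structure $(\delta,\gamma)$ such that, with $\tau$ the flip, $\delta\rho=(\rho\otimes\mu)(\mathrm{Id}_M\otimes\tau\otimes\mathrm{Id}_H)(\delta\otimes\Delta)$,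 $\delta\lambda=(\lambda\otimes\mu)(\mathrm{Id}_H\otimes\tau\otimes\mathrm{Id}_H)(\Delta\otimes\delta)$, $\gamma\rho=(\mu\otimes\rho)(\mathrm{Id}_H\otimes\tau\otimes\mathrm{Id}_H)(\gamma\otimes\Delta)$, $\gamma\lambda=(\mu\otimes\lambda)(\mathrm{Id}_H\otimes\tau\otimes\mathrm{Id}_M)(\Delta\otimes\gamma)$. Morphisms respect all four structures. *)

theory Defs
  imports Complex_Main "HOL-Library.Function_Algebras"
begin

text \<open>
  Tensor products of copies of two \<open>k\<close>-vector spaces \<open>M\<close> and \<open>H\<close> are indexed by words in the two
  letters \<open>FM\<close> and \<open>FH\<close>; e.g. \<open>[FM, FH, FH]\<close> stands for \<open>M \<otimes> H \<otimes> H\<close>, and the empty word stands for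
  the unit object \<open>k\<close>. Concatenation of words is the (strict) monoidal product. A tuple
  \<open>(v\<^sub>1, ..., v\<^sub>l)\<close> of vectors is a list over the disjoint sum of the two carrier types.
\<close>

datatype factor = FM | FH

fun factor_of :: "'m + 'h \<Rightarrow> factor" where
  "factor_of (Inl _) = FM"
| "factor_of (Inr _) = FH"

type_synonym ('k, 'm, 'h) tensor = "(('m + 'h) list \<Rightarrow> 'k) \<Rightarrow> 'k"

text \<open>Scalar multiplication of tensors; the additive structure is the pointwise one.\<close>

definition tscale :: "'k::field \<Rightarrow> ('a \<Rightarrow> 'k) \<Rightarrow> 'a \<Rightarrow> 'k" where
  "tscale c t = (\<lambda>\<phi>. c * t \<phi>)"

text \<open>
  The permutation \<open>\<omega>\<^sub>2\<^sub>k\<close> of the positions \<open>1, ..., 2 k\<close>, extended by the identity.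
\<close>

definition omega :: "nat \<Rightarrow> nat \<Rightarrow> nat" where
  "omega k p = (if 1 \<le> p \<and> p \<le> k then 2 * p - 1
                else if k < p \<and> p \<le> 2 * k then 2 * (p - k) else p)"

text \<open>Positions are counted from 1; the entry at position \<open>p\<close> moves to position \<open>\<theta> p\<close>.\<close>

definition move :: "(nat \<Rightarrow> nat) \<Rightarrow> 'a list \<Rightarrow> 'a list" where
  "move \<theta> xs = map (\<lambda>q. xs ! (inv \<theta> q - 1)) [1..<Suc (length xs)]"

text \<open>The words of \<open>M \<otimes> H\<^sup>\<otimes>\<^sup>n\<close>.\<close>

definition bar_word :: "nat \<Rightarrow> factor list" where
  "bar_word n = FM # replicate n FH"

locale tensor_words = vM: vector_space sM + vH: vector_space sH
  for sM :: "'k::field \<Rightarrow> 'm::ab_group_add \<Rightarrow> 'm"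
  and sH :: "'k \<Rightarrow> 'h::ab_group_add \<Rightarrow> 'h"
begin

definition multilinear ::
    "('k \<Rightarrow> 'w::ab_group_add \<Rightarrow> 'w) \<Rightarrow> factor list \<Rightarrow> (('m + 'h) list \<Rightarrow> 'w) \<Rightarrow> bool" where
  "multilinear s w F \<longleftrightarrow> (\<forall>xs ys.
     (map factor_of xs @ FM # map factor_of ys = w \<longrightarrow>
        Vector_Spaces.linear sM s (\<lambda>a. F (xs @ Inl a # ys))) \<and>
     (map factor_of xs @ FH # map factor_of ys = w \<longrightarrow>
        Vector_Spaces.linear sH s (\<lambda>a. F (xs @ Inr a # ys))))"

text \<open>
  The elementary tensor \<open>v\<^sub>1 \<otimes> ... \<otimes> v\<^sub>l\<close> is realised as evaluation of multilinear forms at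
  \<open>(v\<^sub>1, ..., v\<^sub>l)\<close>, and the tensor product as the span of the elementary tensors inside the dual of
  the space of multilinear forms. The clause \<open>else 0\<close> makes tensors depend on multilinear forms
  only. That this is the tensor product is \<open>tensor_space_universal\<close> below.
\<close>

definition etensor :: "('m + 'h) list \<Rightarrow> ('k, 'm, 'h) tensor" where
  "etensor xs = (\<lambda>\<phi>. if multilinear (*) (map factor_of xs) \<phi> then \<phi> xs else 0)"

definition tensor_space :: "factor list \<Rightarrow> ('k, 'm, 'h) tensor set" where
  "tensor_space w = module.span tscale (etensor ` {xs. map factor_of xs = w})"

lemma vector_space_tscale: "vector_space (tscale :: 'k \<Rightarrow> ('a \<Rightarrow> 'k) \<Rightarrow> 'a \<Rightarrow> 'k)"
  by unfold_locales (auto simp: tscale_def fun_eq_iff algebra_simps)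

interpretation vT: vector_space "tscale :: 'k \<Rightarrow> ('k, 'm, 'h) tensor \<Rightarrow> ('k, 'm, 'h) tensor"
  by (rule vector_space_tscale)

lemma etensor_in_tensor_space: "map factor_of xs = w \<Longrightarrow> etensor xs \<in> tensor_space w"
  unfolding tensor_space_def by (intro vT.span_base) auto

lemma multilinear_etensor: "multilinear tscale w etensor"
  using vM.vector_space_axioms vH.vector_space_axioms vT.vector_space_axioms
  unfolding multilinear_def[of tscale] Vector_Spaces.linear_iff
  by (auto simp: etensor_def fun_eq_iff tscale_def multilinear_def Vector_Spaces.linear_iff)

lemma multilinear_compose:
  assumes "multilinear s w F" "Vector_Spaces.linear s s' g"
  shows "multilinear s' w (\<lambda>xs. g (F xs))"
  using assms unfolding multilinear_def Vector_Spaces.linear_iff by simp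

lemma tensor_space_universal:
  fixes s :: "'k \<Rightarrow> 'w::ab_group_add \<Rightarrow> 'w"
  assumes s: "vector_space s" and F: "multilinear s w F"
  defines "extends \<equiv> \<lambda>L.
    (\<forall>t \<in> tensor_space w. \<forall>t' \<in> tensor_space w. L (t + t') = L t + L t') \<and>
    (\<forall>c. \<forall>t \<in> tensor_space w. L (tscale c t) = s c (L t)) \<and>
    (\<forall>xs. map factor_of xs = w \<longrightarrow> L (etensor xs) = F xs)"
  shows "\<exists>L. extends L \<and> (\<forall>L'. extends L' \<longrightarrow> (\<forall>t \<in> tensor_space w. L' t = L t))"
proof -
  interpret W: vector_space s by (rule s)
  interpret K: vector_space "(*) :: 'k \<Rightarrow> 'k \<Rightarrow> 'k" by unfold_locales (auto simp: algebra_simps)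
  interpret WK: vector_space_pair s "(*) :: 'k \<Rightarrow> 'k \<Rightarrow> 'k" ..
  define R where "R t y \<longleftrightarrow> (\<forall>l. Vector_Spaces.linear s (*) l \<longrightarrow> l y = t (\<lambda>xs. l (F xs)))" for t y
  have sep: "y = y'" if "\<And>l. Vector_Spaces.linear s (*) l \<Longrightarrow> l y = l y'" for y y'
  proof (rule ccontr)
    assume "y \<noteq> y'"
    then have "W.independent {y - y'}" by simp
    from WK.linear_independent_extend[OF this, of "\<lambda>_. 1"] obtain l
      where l: "Vector_Spaces.linear s (*) l" "l (y - y') = 1" by auto
    have "l (y - y') = l y - l y'" using l(1) by (rule WK.linear_diff)
    with that[OF l(1)] l(2) show False by simp
  qed
  have R_unique: "y = y'" if "R t y" "R t y'" for t y y'
    using that unfolding R_def by (intro sep) metis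
  have R_etensor: "R (etensor xs) (F xs)" if "map factor_of xs = w" for xs
    using multilinear_compose[OF F] that by (auto simp: R_def etensor_def)
  have R_add: "R (t + t') (y + y')" if "R t y" "R t' y'" for t t' y y'
    using that by (auto simp: R_def WK.linear_add)
  have R_scale: "R (tscale c t) (s c y)" if "R t y" for c t y
    using that by (auto simp: R_def WK.linear_scale tscale_def)
  have R_zero: "R 0 0"
    by (auto simp: R_def WK.linear_0)
  have R_ex: "\<exists>y. R t y" if "t \<in> tensor_space w" for t
    using that unfolding tensor_space_def
  proof (induction rule: vT.span_induct_alt)
    case base
    then show ?case using R_zero by blast
  next
    case (step c x y)
    then show ?case using R_etensor R_add R_scale by blast
  qed
  define L where "L t = (THE y. R t y)" for t
  have L_eq: "L t = y" if "R t y" for t y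
    unfolding L_def using that R_unique by blast
  have RL: "R t (L t)" if "t \<in> tensor_space w" for t
    using R_ex[OF that] L_eq by auto
  have "extends L"
    unfolding extends_def using RL R_add R_scale R_etensor by (auto intro!: L_eq)
  moreover have "L' t = L t" if L': "extends L'" and t: "t \<in> tensor_space w" for L' t
  proof -
    have zero: "L1 0 = 0" if "extends L1" for L1
    proof -
      have "L1 (tscale 0 0) = s 0 (L1 0)"
        using that vT.span_zero unfolding extends_def tensor_space_def by blast
      then show ?thesis by simp
    qed
    have "t \<in> tensor_space w \<and> L' t = L t"
      using t unfolding tensor_space_def
    proof (induction rule: vT.span_induct_alt)
      case base
      then show ?case using zero[OF L'] zero[OF \<open>extends L\<close>] vT.span_zero by metis
    next
      case (step c x y)
      then have y: "y \<in> tensor_space w" by (simp add: tensor_space_def)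
      from step(1) obtain xs where xs: "x = etensor xs" "map factor_of xs = w" by auto
      then have x: "x \<in> tensor_space w" by (simp add: etensor_in_tensor_space)
      have cx: "tscale c x \<in> tensor_space w"
        using x unfolding tensor_space_def by (rule vT.span_scale)
      have "L1 (tscale c x + y) = s c (F xs) + L1 y" if "extends L1" for L1
        using that x y cx xs unfolding extends_def by simp
      then show ?case
        using L' \<open>extends L\<close> step(2) cx y vT.span_add unfolding tensor_space_def by metis
    qed
    then show ?thesis ..
  qed
  ultimately show ?thesis by blast
qed

text \<open>
  Linear maps between tensor spaces. A map is represented by a function whose values outside its
  domain are irrelevant, so equality of maps is equality on the domain.
\<close>

definition tensor_hom ::
    "factor list \<Rightarrow> factor list \<Rightarrow> (('k, 'm, 'h) tensor \<Rightarrow> ('k, 'm, 'h) tensor) set" where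
  "tensor_hom u v = {f. (\<forall>t \<in> tensor_space u. f t \<in> tensor_space v) \<and>
     (\<forall>s \<in> tensor_space u. \<forall>t \<in> tensor_space u. f (s + t) = f s + f t) \<and>
     (\<forall>c. \<forall>t \<in> tensor_space u. f (tscale c t) = tscale c (f t))}"

definition map_eq ::
    "(('k, 'm, 'h) tensor \<Rightarrow> ('k, 'm, 'h) tensor) \<Rightarrow> factor list \<Rightarrow>
     (('k, 'm, 'h) tensor \<Rightarrow> ('k, 'm, 'h) tensor) \<Rightarrow> bool"
    (\<open>(_ \<doteq>\<^bsub>_\<^esub>/ _)\<close> [51, 0, 51] 50) where
  "(f \<doteq>\<^bsub>w\<^esub> g) \<longleftrightarrow> (\<forall>t \<in> tensor_space w. f t = g t)"

text \<open>
  The linear extension of a multilinear, tensor-valued \<open>F\<close>: it maps \<open>etensor xs\<close> to \<open>F xs\<close>, see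
  \<open>extend_etensor\<close>.
\<close>

definition extend ::
    "(('m + 'h) list \<Rightarrow> ('k, 'm, 'h) tensor) \<Rightarrow> ('k, 'm, 'h) tensor \<Rightarrow> ('k, 'm, 'h) tensor" where
  "extend F t = (\<lambda>\<phi>. t (\<lambda>xs. F xs \<phi>))"

lemma extend_etensor:
  assumes "multilinear tscale w F" and "map factor_of xs = w"
  shows "extend F (etensor xs) = F xs"
proof
  fix \<phi>
  have "Vector_Spaces.linear tscale (*) (\<lambda>t :: ('k, 'm, 'h) tensor. t \<phi>)"
    unfolding Vector_Spaces.linear_iff using vT.vector_space_axioms
    by (auto simp: tscale_def vector_space_def algebra_simps)
  from multilinear_compose[OF assms(1) this] assms(2)
  show "extend F (etensor xs) \<phi> = F xs \<phi>" by (simp add: extend_def etensor_def)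
qed

text \<open>The canonical bilinear map of the spaces of two words to that of the concatenated word.\<close>

definition juxt :: "('k, 'm, 'h) tensor \<Rightarrow> ('k, 'm, 'h) tensor \<Rightarrow> ('k, 'm, 'h) tensor" where
  "juxt s t = extend (\<lambda>xs. extend (\<lambda>ys. etensor (xs @ ys)) t) s"

text \<open>
  The tensor product \<open>f \<otimes> g\<close> of linear maps. The index \<open>a\<close> is the number of tensor factors in the
  domain of \<open>f\<close>.
\<close>

definition tensor_map ::
    "(('k, 'm, 'h) tensor \<Rightarrow> ('k, 'm, 'h) tensor) \<Rightarrow> nat \<Rightarrow>
     (('k, 'm, 'h) tensor \<Rightarrow> ('k, 'm, 'h) tensor) \<Rightarrow> ('k, 'm, 'h) tensor \<Rightarrow> ('k, 'm, 'h) tensor"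
    (\<open>(_ \<otimes>\<^bsub>_\<^esub>/ _)\<close> [71, 0, 70] 70) where
  "f \<otimes>\<^bsub>a\<^esub> g = extend (\<lambda>xs. juxt (f (etensor (take a xs))) (g (etensor (drop a xs))))"

lemma multilinear_append:
  "multilinear tscale w (\<lambda>ys. etensor (xs @ ys))" "multilinear tscale w (\<lambda>xs. etensor (xs @ ys))"
proof -
  show "multilinear tscale w (\<lambda>ys. etensor (xs @ ys))"
    unfolding multilinear_def
  proof (intro allI conjI impI)
    fix us vs :: "('m + 'h) list" assume "map factor_of us @ FM # map factor_of vs = w"
    then show "Vector_Spaces.linear sM tscale (\<lambda>a. etensor (xs @ us @ Inl a # vs))"
      using multilinear_etensor[of "map factor_of xs @ w", unfolded multilinear_def,
        rule_format, of "xs @ us" vs] by auto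
  next
    fix us vs :: "('m + 'h) list" assume "map factor_of us @ FH # map factor_of vs = w"
    then show "Vector_Spaces.linear sH tscale (\<lambda>a. etensor (xs @ us @ Inr a # vs))"
      using multilinear_etensor[of "map factor_of xs @ w", unfolded multilinear_def,
        rule_format, of "xs @ us" vs] by auto
  qed
  show "multilinear tscale w (\<lambda>xs. etensor (xs @ ys))"
    unfolding multilinear_def
  proof (intro allI conjI impI)
    fix us vs :: "('m + 'h) list" assume "map factor_of us @ FM # map factor_of vs = w"
    then show "Vector_Spaces.linear sM tscale (\<lambda>a. etensor ((us @ Inl a # vs) @ ys))"
      using multilinear_etensor[of "w @ map factor_of ys", unfolded multilinear_def,
        rule_format, of us "vs @ ys"] by auto
  next
    fix us vs :: "('m + 'h) list" assume "map factor_of us @ FH # map factor_of vs = w"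
    then show "Vector_Spaces.linear sH tscale (\<lambda>a. etensor ((us @ Inr a # vs) @ ys))"
      using multilinear_etensor[of "w @ map factor_of ys", unfolded multilinear_def,
        rule_format, of us "vs @ ys"] by auto
  qed
qed

lemma multilinear_lincomb:
  assumes "multilinear tscale w F" "multilinear tscale w G"
  shows "multilinear tscale w (\<lambda>xs. tscale c (F xs) + G xs :: ('k, 'm, 'h) tensor)"
proof -
  have *: "Vector_Spaces.linear sV tscale (\<lambda>a. tscale c (f a) + g a)"
    if "Vector_Spaces.linear sV tscale f" "Vector_Spaces.linear sV tscale g"
    for sV :: "'k \<Rightarrow> 'c::ab_group_add \<Rightarrow> 'c" and f g :: "'c \<Rightarrow> ('k, 'm, 'h) tensor"
  proof -
    interpret vector_space_pair sV "tscale :: 'k \<Rightarrow> ('k, 'm, 'h) tensor \<Rightarrow> ('k, 'm, 'h) tensor"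
      using that(1) unfolding vector_space_pair_def Vector_Spaces.linear_iff by simp
    show ?thesis
      by (intro linear_compose_add linear_compose_scale_right that)
  qed
  show ?thesis
    unfolding multilinear_def
  proof (intro allI conjI impI)
    fix xs ys :: "('m + 'h) list" assume "map factor_of xs @ FM # map factor_of ys = w"
    then show "Vector_Spaces.linear sM tscale (\<lambda>a. tscale c (F (xs @ Inl a # ys)) + G (xs @ Inl a # ys))"
      using assms by (intro *) (auto simp only: multilinear_def)
  next
    fix xs ys :: "('m + 'h) list" assume "map factor_of xs @ FH # map factor_of ys = w"
    then show "Vector_Spaces.linear sH tscale (\<lambda>a. tscale c (F (xs @ Inr a # ys)) + G (xs @ Inr a # ys))"
      using assms by (intro *) (auto simp only: multilinear_def)
  qed
qed

lemma multilinear_extend_append: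
  assumes "t \<in> tensor_space v"
  shows "multilinear tscale u (\<lambda>xs. extend (\<lambda>ys. etensor (xs @ ys)) t)"
  using assms unfolding tensor_space_def
proof (induction rule: vT.span_induct_alt)
  case base
  have "extend F 0 = 0" for F :: "('m + 'h) list \<Rightarrow> ('k, 'm, 'h) tensor"
    by (simp add: extend_def zero_fun_def)
  then show ?case
    using multilinear_lincomb[OF multilinear_etensor multilinear_etensor, of u "- 1"]
    by (simp only: vT.scale_minus_left vT.scale_one left_minus)
next
  case (step c x y)
  from step(1) obtain vs where x: "x = etensor vs" by auto
  have *: "extend (\<lambda>ys. etensor (xs @ ys)) (tscale c x + y) =
      tscale c (etensor (xs @ vs)) + extend (\<lambda>ys. etensor (xs @ ys)) y" for xs
    using extend_etensor[OF multilinear_append(1) refl, of xs vs]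
    by (simp add: x extend_def tscale_def fun_eq_iff)
  show ?case
    unfolding * by (rule multilinear_lincomb[OF multilinear_append(2) step(2)])
qed

lemma juxt_etensor_left:
  "t \<in> tensor_space v \<Longrightarrow> juxt (etensor xs) t = extend (\<lambda>ys. etensor (xs @ ys)) t"
  unfolding juxt_def by (rule extend_etensor[OF multilinear_extend_append refl])

lemma juxt_etensor: "juxt (etensor xs) (etensor ys) = etensor (xs @ ys)"
  using juxt_etensor_left[OF etensor_in_tensor_space[OF refl]]
    extend_etensor[OF multilinear_append(1) refl] by simp

lemma juxt_add_left: "juxt (s + s') t = juxt s t + juxt s' t"
  by (simp add: juxt_def extend_def fun_eq_iff)

lemma juxt_scale_left: "juxt (tscale c s) t = tscale c (juxt s t)"
  by (simp add: juxt_def extend_def tscale_def)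

lemma juxt_linear_right:
  assumes "s \<in> tensor_space u" and t: "t \<in> tensor_space v" "t' \<in> tensor_space v"
  shows "juxt s (tscale c t + t') = tscale c (juxt s t) + juxt s t'"
  using assms(1) unfolding tensor_space_def
proof (induction rule: vT.span_induct_alt)
  case base
  then show ?case by (simp add: juxt_def extend_def fun_eq_iff tscale_def)
next
  case (step b x y)
  from step(1) obtain xs where x: "x = etensor xs" by auto
  have tt: "tscale c t + t' \<in> tensor_space v"
    using t unfolding tensor_space_def by (intro vT.span_add vT.span_scale)
  have "juxt x (tscale c t + t') = tscale c (juxt x t) + juxt x t'"
    unfolding x juxt_etensor_left[OF tt] juxt_etensor_left[OF t(1)] juxt_etensor_left[OF t(2)]
    by (simp add: extend_def tscale_def fun_eq_iff)
  then show ?case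
    unfolding juxt_add_left juxt_scale_left step(2)
    by (simp only: vT.scale_right_distrib vT.scale_left_commute[of b c] add_ac)
qed

lemma multilinear_on:
  assumes G: "multilinear tscale w G" "\<And>xs. map factor_of xs = w \<Longrightarrow> G xs \<in> tensor_space v"
    and K: "\<And>t t'. t \<in> tensor_space v \<Longrightarrow> t' \<in> tensor_space v \<Longrightarrow> K (t + t') = K t + K t'"
      "\<And>c t. t \<in> tensor_space v \<Longrightarrow> K (tscale c t) = tscale c (K t)"
  shows "multilinear tscale w (\<lambda>xs. K (G xs))"
proof -
  have *: "Vector_Spaces.linear sV tscale (\<lambda>a. K (g a))"
    if "Vector_Spaces.linear sV tscale g" "\<And>a. g a \<in> tensor_space v"
    for sV :: "'k \<Rightarrow> 'c::ab_group_add \<Rightarrow> 'c" and g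
    using that(1) K(1)[OF that(2) that(2)] K(2)[OF that(2)]
    unfolding Vector_Spaces.linear_iff by (simp add: vector_space_tscale)
  show ?thesis
    unfolding multilinear_def
  proof (intro allI conjI impI)
    fix xs ys :: "('m + 'h) list" assume "map factor_of xs @ FM # map factor_of ys = w"
    then show "Vector_Spaces.linear sM tscale (\<lambda>a. K (G (xs @ Inl a # ys)))"
      using G(1) by (intro * G(2)) (auto simp only: multilinear_def list.map map_append factor_of.simps)
  next
    fix xs ys :: "('m + 'h) list" assume "map factor_of xs @ FH # map factor_of ys = w"
    then show "Vector_Spaces.linear sH tscale (\<lambda>a. K (G (xs @ Inr a # ys)))"
      using G(1) by (intro * G(2)) (auto simp only: multilinear_def list.map map_append factor_of.simps)
  qed
qed

lemma multilinear_take_drop: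
  assumes "\<And>ys. map factor_of ys = v \<Longrightarrow> multilinear s u (\<lambda>xs. B xs ys)"
    and "\<And>xs. map factor_of xs = u \<Longrightarrow> multilinear s v (\<lambda>ys. B xs ys)"
  shows "multilinear s (u @ v) (\<lambda>zs. B (take (length u) zs) (drop (length u) zs))"
proof -
  have "Vector_Spaces.linear sV s
      (\<lambda>a. B (take (length u) (xs @ i a # ys)) (drop (length u) (xs @ i a # ys)))"
    if w: "map factor_of xs @ x # map factor_of ys = u @ v"
      and lu: "\<And>xs' ys' vs. map factor_of xs' @ x # map factor_of ys' = u \<Longrightarrow> map factor_of vs = v
          \<Longrightarrow> Vector_Spaces.linear sV s (\<lambda>a. B (xs' @ i a # ys') vs)"
      and lv: "\<And>xs' ys' us. map factor_of xs' @ x # map factor_of ys' = v \<Longrightarrow> map factor_of us = u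
          \<Longrightarrow> Vector_Spaces.linear sV s (\<lambda>a. B us (xs' @ i a # ys'))"
    for xs ys x and sV :: "'k \<Rightarrow> 'c::ab_group_add \<Rightarrow> 'c" and i
  proof (cases "length xs < length u")
    case True
    define k where "k = length u - Suc (length xs)"
    have k: "length u - length xs = Suc k" using True by (simp add: k_def)
    have 1: "map factor_of xs @ x # map factor_of (take k ys) = u"
      using arg_cong[OF w, of "take (length u)"] True k by (simp add: take_map)
    have 2: "map factor_of (drop k ys) = v"
      using arg_cong[OF w, of "drop (length u)"] True k by (simp add: drop_map)
    have "take (length u) (xs @ i a # ys) = xs @ i a # take k ys"
      "drop (length u) (xs @ i a # ys) = drop k ys" for a
      using True k by simp_all
    then show ?thesis using lu[OF 1 2] by (simp only:)
  next
    case False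
    have 1: "map factor_of (drop (length u) xs) @ x # map factor_of ys = v"
      using arg_cong[OF w, of "drop (length u)"] False by (simp add: drop_map)
    have 2: "map factor_of (take (length u) xs) = u"
      using arg_cong[OF w, of "take (length u)"] False by (simp add: take_map)
    have "take (length u) (xs @ i a # ys) = take (length u) xs"
      "drop (length u) (xs @ i a # ys) = drop (length u) xs @ i a # ys" for a
      using False by simp_all
    then show ?thesis using lv[OF 1 2] by (simp only:)
  qed
  note * = this
  show ?thesis
    unfolding multilinear_def
  proof (intro allI conjI impI)
    fix xs ys :: "('m + 'h) list" assume "map factor_of xs @ FM # map factor_of ys = u @ v"
    then show "Vector_Spaces.linear sM s (\<lambda>a. B (take (length u) (xs @ Inl a # ys))
        (drop (length u) (xs @ Inl a # ys)))"
      by (rule *) (use assms in \<open>unfold multilinear_def, blast\<close>)+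
  next
    fix xs ys :: "('m + 'h) list" assume "map factor_of xs @ FH # map factor_of ys = u @ v"
    then show "Vector_Spaces.linear sH s (\<lambda>a. B (take (length u) (xs @ Inr a # ys))
        (drop (length u) (xs @ Inr a # ys)))"
      by (rule *) (use assms in \<open>unfold multilinear_def, blast\<close>)+
  qed
qed

lemma tensor_map_etensor:
  assumes f: "f \<in> tensor_hom u u'" and g: "g \<in> tensor_hom v v'"
    and xs: "map factor_of xs = u" and ys: "map factor_of ys = v"
  shows "(f \<otimes>\<^bsub>length u\<^esub> g) (etensor (xs @ ys)) = juxt (f (etensor xs)) (g (etensor ys))"
proof -
  have F: "multilinear tscale u (\<lambda>xs. f (etensor xs))" "multilinear tscale v (\<lambda>xs. g (etensor xs))"
    by (rule multilinear_on[OF multilinear_etensor etensor_in_tensor_space];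
        use f g in \<open>unfold tensor_hom_def, blast\<close>)+
  have mem: "map factor_of xs = u \<Longrightarrow> f (etensor xs) \<in> tensor_space u'"
    "map factor_of xs = v \<Longrightarrow> g (etensor xs) \<in> tensor_space v'" for xs
    using f g etensor_in_tensor_space unfolding tensor_hom_def by auto
  have right: "juxt s (t + t') = juxt s t + juxt s t'"
    if "s \<in> tensor_space u'" "t \<in> tensor_space v'" "t' \<in> tensor_space v'" for s t t'
    using juxt_linear_right[OF that, of 1] by simp
  have right0: "juxt s (tscale c t) = tscale c (juxt s t)"
    if "s \<in> tensor_space u'" "t \<in> tensor_space v'" for s t c
  proof -
    have 0: "0 \<in> tensor_space v'" unfolding tensor_space_def by (rule vT.span_zero)
    have "juxt s 0 = 0" using right[OF that(1) 0 0] by (metis add.right_neutral add_left_cancel)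
    with juxt_linear_right[OF that 0, of c] show ?thesis by (metis add.right_neutral)
  qed
  have A: "multilinear tscale (u @ v) (\<lambda>zs. juxt (f (etensor (take (length u) zs))) (g (etensor (drop (length u) zs))))"
    by (rule multilinear_take_drop[where B = "\<lambda>xs ys. juxt (f (etensor xs)) (g (etensor ys))"],
        rule multilinear_on[OF F(1) mem(1)],
        assumption, rule juxt_add_left, rule juxt_scale_left,
        rule multilinear_on[OF F(2) mem(2)],
        assumption, rule right[OF mem(1)], assumption+, rule right0[OF mem(1)], assumption+)
  have td: "take (length u) (xs @ ys) = xs" "drop (length u) (xs @ ys) = ys"
    and B: "map factor_of (xs @ ys) = u @ v"
    using xs ys by auto
  show ?thesis
    unfolding tensor_map_def extend_etensor[OF A B] td ..
qed

text \<open>One-letter words recover the spaces \<open>M\<close> and \<open>H\<close> themselves; the empty word gives \<open>k\<close>.\<close>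

lemma factor_of_eq: "factor_of z = FM \<longleftrightarrow> (\<exists>m. z = Inl m)" "factor_of z = FH \<longleftrightarrow> (\<exists>h. z = Inr h)"
  by (cases z; simp)+

lemma multilinear_empty: "multilinear s [] F"
  by (simp add: multilinear_def)

lemma multilinear_single:
  "multilinear s [FM] F \<longleftrightarrow> Vector_Spaces.linear sM s (\<lambda>m. F [Inl m])"
  "multilinear s [FH] F \<longleftrightarrow> Vector_Spaces.linear sH s (\<lambda>h. F [Inr h])"
  by (auto simp: multilinear_def append_eq_Cons_conv Cons_eq_append_conv)

lemma bij_betw_linear_generators:
  assumes s: "vector_space s" and lin: "Vector_Spaces.linear s tscale E"
    and span: "tensor_space w = module.span tscale (range E)"
    and inv: "\<And>a. L (E a) = a"
  shows "bij_betw E UNIV (tensor_space w)"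
proof -
  interpret vector_space_pair s "tscale :: 'k \<Rightarrow> ('k, 'm, 'h) tensor \<Rightarrow> ('k, 'm, 'h) tensor"
    using s vector_space_tscale by (simp add: vector_space_pair_def)
  have "vT.span (range E) = range E"
    using linear_subspace_image[OF lin vs1.subspace_UNIV] vT.span_eq_iff by blast
  moreover have "inj E"
    using inv by (metis injI)
  ultimately show ?thesis
    unfolding bij_betw_def span by metis
qed

lemma bij_betw_etensor_M: "bij_betw (\<lambda>m. etensor [Inl m]) UNIV (tensor_space [FM])"
proof -
  define E :: "'m \<Rightarrow> ('k, 'm, 'h) tensor" where "E m = etensor [Inl m]" for m
  have lin: "Vector_Spaces.linear sM tscale E"
    using multilinear_etensor[of "[FM]"] unfolding multilinear_single E_def[abs_def] .
  have "multilinear sM [FM] (\<lambda>xs. case xs of [Inl m] \<Rightarrow> m | _ \<Rightarrow> 0)"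
    using vM.vector_space_axioms by (simp add: multilinear_single Vector_Spaces.linear_iff)
  from tensor_space_universal[OF vM.vector_space_axioms this] obtain L where
    "\<And>xs. map factor_of xs = [FM] \<Longrightarrow> L (etensor xs) = (case xs of [Inl m] \<Rightarrow> m | _ \<Rightarrow> 0)"
    by blast
  from this[of "[Inl _]"] have inv: "L (E m) = m" for m by (simp add: E_def)
  have "{xs :: ('m + 'h) list. map factor_of xs = [FM]} = range (\<lambda>m. [Inl m])"
    by (auto simp: map_eq_Cons_conv factor_of_eq)
  then have "tensor_space [FM] = module.span tscale (range E)"
    by (simp add: tensor_space_def E_def[abs_def] image_image)
  from bij_betw_linear_generators[where E = E and L = L, OF vM.vector_space_axioms lin this inv]
  show ?thesis by (simp add: E_def[abs_def])
qed

lemma bij_betw_etensor_H: "bij_betw (\<lambda>h. etensor [Inr h]) UNIV (tensor_space [FH])"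
proof -
  define E :: "'h \<Rightarrow> ('k, 'm, 'h) tensor" where "E h = etensor [Inr h]" for h
  have lin: "Vector_Spaces.linear sH tscale E"
    using multilinear_etensor[of "[FH]"] unfolding multilinear_single E_def[abs_def] .
  have "multilinear sH [FH] (\<lambda>xs. case xs of [Inr h] \<Rightarrow> h | _ \<Rightarrow> 0)"
    using vH.vector_space_axioms by (simp add: multilinear_single Vector_Spaces.linear_iff)
  from tensor_space_universal[OF vH.vector_space_axioms this] obtain L where
    "\<And>xs. map factor_of xs = [FH] \<Longrightarrow> L (etensor xs) = (case xs of [Inr h] \<Rightarrow> h | _ \<Rightarrow> 0)"
    by blast
  from this[of "[Inr _]"] have inv: "L (E h) = h" for h by (simp add: E_def)
  have "{xs :: ('m + 'h) list. map factor_of xs = [FH]} = range (\<lambda>h. [Inr h])"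
    by (auto simp: map_eq_Cons_conv factor_of_eq)
  then have "tensor_space [FH] = module.span tscale (range E)"
    by (simp add: tensor_space_def E_def[abs_def] image_image)
  from bij_betw_linear_generators[where E = E and L = L, OF vH.vector_space_axioms lin this inv]
  show ?thesis by (simp add: E_def[abs_def])
qed

lemma bij_betw_etensor_unit: "bij_betw (\<lambda>c. tscale c (etensor [])) UNIV (tensor_space [])"
proof -
  have "inj (\<lambda>c. tscale c (etensor []))"
  proof (rule injI)
    fix c d assume "tscale c (etensor []) = tscale d (etensor [])"
    then have "tscale c (etensor []) (\<lambda>_. 1) = tscale d (etensor []) (\<lambda>_. 1)" by (rule fun_cong)
    then show "c = d" by (simp add: tscale_def etensor_def multilinear_empty)
  qed
  moreover have "tensor_space [] = range (\<lambda>c. tscale c (etensor []))"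
    by (simp add: tensor_space_def vT.span_singleton)
  ultimately show ?thesis by (metis bij_betw_def)
qed

text \<open>The maps \<open>\<phi>\<^sup>p\<close>, where \<open>a\<close> is the number of tensor factors in the domain of \<open>\<phi>\<close>.\<close>

definition at_pos ::
    "nat \<Rightarrow> nat \<Rightarrow> (('k, 'm, 'h) tensor \<Rightarrow> ('k, 'm, 'h) tensor) \<Rightarrow>
     ('k, 'm, 'h) tensor \<Rightarrow> ('k, 'm, 'h) tensor" where
  "at_pos p a \<phi> = id \<otimes>\<^bsub>p - 1\<^esub> \<phi> \<otimes>\<^bsub>a\<^esub> id"

fun tensor_pow ::
    "(('k, 'm, 'h) tensor \<Rightarrow> ('k, 'm, 'h) tensor) \<Rightarrow> nat \<Rightarrow> nat \<Rightarrow>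
     ('k, 'm, 'h) tensor \<Rightarrow> ('k, 'm, 'h) tensor" where
  "tensor_pow f a 0 = id"
| "tensor_pow f a (Suc n) = f \<otimes>\<^bsub>a\<^esub> tensor_pow f a n"

definition permute :: "(nat \<Rightarrow> nat) \<Rightarrow> ('k, 'm, 'h) tensor \<Rightarrow> ('k, 'm, 'h) tensor" where
  "permute \<theta> = extend (\<lambda>xs. etensor (move \<theta> xs))"

text \<open>The flip \<open>\<tau>\<close> of two objects, of which the left one has \<open>a\<close> tensor factors.\<close>

definition flip :: "nat \<Rightarrow> ('k, 'm, 'h) tensor \<Rightarrow> ('k, 'm, 'h) tensor" where
  "flip a = extend (\<lambda>xs. etensor (drop a xs @ take a xs))"

definition bialgebra where
  "bialgebra \<mu> \<nu> \<Delta> \<epsilon> \<longleftrightarrow>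
     \<mu> \<in> tensor_hom [FH, FH] [FH] \<and> \<nu> \<in> tensor_hom [] [FH] \<and>
     \<Delta> \<in> tensor_hom [FH] [FH, FH] \<and> \<epsilon> \<in> tensor_hom [FH] [] \<and>
     (\<mu> \<circ> (\<mu> \<otimes>\<^bsub>2\<^esub> id) \<doteq>\<^bsub>[FH, FH, FH]\<^esub> \<mu> \<circ> (id \<otimes>\<^bsub>1\<^esub> \<mu>)) \<and>
     (\<mu> \<circ> (\<nu> \<otimes>\<^bsub>0\<^esub> id) \<doteq>\<^bsub>[FH]\<^esub> id) \<and>
     (\<mu> \<circ> (id \<otimes>\<^bsub>1\<^esub> \<nu>) \<doteq>\<^bsub>[FH]\<^esub> id) \<and>
     ((\<Delta> \<otimes>\<^bsub>1\<^esub> id) \<circ> \<Delta> \<doteq>\<^bsub>[FH]\<^esub> (id \<otimes>\<^bsub>1\<^esub> \<Delta>) \<circ> \<Delta>) \<and>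
     ((\<epsilon> \<otimes>\<^bsub>1\<^esub> id) \<circ> \<Delta> \<doteq>\<^bsub>[FH]\<^esub> id) \<and>
     ((id \<otimes>\<^bsub>1\<^esub> \<epsilon>) \<circ> \<Delta> \<doteq>\<^bsub>[FH]\<^esub> id) \<and>
     (\<Delta> \<circ> \<mu> \<doteq>\<^bsub>[FH, FH]\<^esub> (\<mu> \<otimes>\<^bsub>2\<^esub> \<mu>) \<circ> (id \<otimes>\<^bsub>1\<^esub> flip 1 \<otimes>\<^bsub>2\<^esub> id) \<circ> (\<Delta> \<otimes>\<^bsub>1\<^esub> \<Delta>)) \<and>
     (\<Delta> \<circ> \<nu> \<doteq>\<^bsub>[]\<^esub> \<nu> \<otimes>\<^bsub>0\<^esub> \<nu>) \<and>
     (\<epsilon> \<circ> \<mu> \<doteq>\<^bsub>[FH, FH]\<^esub> \<epsilon> \<otimes>\<^bsub>1\<^esub> \<epsilon>) \<and>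
     (\<epsilon> \<circ> \<nu> \<doteq>\<^bsub>[]\<^esub> id)"

text \<open>
  (Co)modules and Hopf bimodules over \<open>H\<close> whose underlying space is that of an arbitrary word \<open>N\<close>.
  The argument \<open>lam\<close> is the left action.
\<close>

definition bimodule where
  "bimodule \<mu> \<nu> N \<rho> lam \<longleftrightarrow>
     \<rho> \<in> tensor_hom (N @ [FH]) N \<and> lam \<in> tensor_hom (FH # N) N \<and>
     (\<rho> \<circ> (\<rho> \<otimes>\<^bsub>length N + 1\<^esub> id) \<doteq>\<^bsub>N @ [FH, FH]\<^esub> \<rho> \<circ> (id \<otimes>\<^bsub>length N\<^esub> \<mu>)) \<and>
     (\<rho> \<circ> (id \<otimes>\<^bsub>length N\<^esub> \<nu>) \<doteq>\<^bsub>N\<^esub> id) \<and>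
     (lam \<circ> (id \<otimes>\<^bsub>1\<^esub> lam) \<doteq>\<^bsub>[FH, FH] @ N\<^esub> lam \<circ> (\<mu> \<otimes>\<^bsub>2\<^esub> id)) \<and>
     (lam \<circ> (\<nu> \<otimes>\<^bsub>0\<^esub> id) \<doteq>\<^bsub>N\<^esub> id) \<and>
     (\<rho> \<circ> (lam \<otimes>\<^bsub>1 + length N\<^esub> id) \<doteq>\<^bsub>FH # N @ [FH]\<^esub> lam \<circ> (id \<otimes>\<^bsub>1\<^esub> \<rho>))"

definition bicomodule where
  "bicomodule \<Delta> \<epsilon> N \<delta> \<gamma> \<longleftrightarrow>
     \<delta> \<in> tensor_hom N (N @ [FH]) \<and> \<gamma> \<in> tensor_hom N (FH # N) \<and>
     ((\<delta> \<otimes>\<^bsub>length N\<^esub> id) \<circ> \<delta> \<doteq>\<^bsub>N\<^esub> (id \<otimes>\<^bsub>length N\<^esub> \<Delta>) \<circ> \<delta>) \<and>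
     ((id \<otimes>\<^bsub>length N\<^esub> \<epsilon>) \<circ> \<delta> \<doteq>\<^bsub>N\<^esub> id) \<and>
     ((id \<otimes>\<^bsub>1\<^esub> \<gamma>) \<circ> \<gamma> \<doteq>\<^bsub>N\<^esub> (\<Delta> \<otimes>\<^bsub>1\<^esub> id) \<circ> \<gamma>) \<and>
     ((\<epsilon> \<otimes>\<^bsub>1\<^esub> id) \<circ> \<gamma> \<doteq>\<^bsub>N\<^esub> id) \<and>
     ((\<gamma> \<otimes>\<^bsub>length N\<^esub> id) \<circ> \<delta> \<doteq>\<^bsub>N\<^esub> (id \<otimes>\<^bsub>1\<^esub> \<delta>) \<circ> \<gamma>)"

definition hopf_bimodule where
  "hopf_bimodule \<mu> \<nu> \<Delta> \<epsilon> N \<rho> lam \<delta> \<gamma> \<longleftrightarrow>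
     bimodule \<mu> \<nu> N \<rho> lam \<and> bicomodule \<Delta> \<epsilon> N \<delta> \<gamma> \<and>
     (\<delta> \<circ> \<rho> \<doteq>\<^bsub>N @ [FH]\<^esub>
        (\<rho> \<otimes>\<^bsub>length N + 1\<^esub> \<mu>) \<circ> (id \<otimes>\<^bsub>length N\<^esub> flip 1 \<otimes>\<^bsub>2\<^esub> id) \<circ> (\<delta> \<otimes>\<^bsub>length N\<^esub> \<Delta>)) \<and>
     (\<delta> \<circ> lam \<doteq>\<^bsub>FH # N\<^esub>
        (lam \<otimes>\<^bsub>1 + length N\<^esub> \<mu>) \<circ> (id \<otimes>\<^bsub>1\<^esub> flip 1 \<otimes>\<^bsub>1 + length N\<^esub> id) \<circ> (\<Delta> \<otimes>\<^bsub>1\<^esub> \<delta>)) \<and>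
     (\<gamma> \<circ> \<rho> \<doteq>\<^bsub>N @ [FH]\<^esub>
        (\<mu> \<otimes>\<^bsub>2\<^esub> \<rho>) \<circ> (id \<otimes>\<^bsub>1\<^esub> flip (length N) \<otimes>\<^bsub>length N + 1\<^esub> id) \<circ> (\<gamma> \<otimes>\<^bsub>length N\<^esub> \<Delta>)) \<and>
     (\<gamma> \<circ> lam \<doteq>\<^bsub>FH # N\<^esub>
        (\<mu> \<otimes>\<^bsub>2\<^esub> lam) \<circ> (id \<otimes>\<^bsub>1\<^esub> flip 1 \<otimes>\<^bsub>2\<^esub> id) \<circ> (\<Delta> \<otimes>\<^bsub>1\<^esub> \<gamma>))"

definition hopf_bimodule_hom where
  "hopf_bimodule_hom N \<rho> lam \<delta> \<gamma> N' \<rho>' lam' \<delta>' \<gamma>' f \<longleftrightarrow>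
     f \<in> tensor_hom N N' \<and>
     (f \<circ> \<rho> \<doteq>\<^bsub>N @ [FH]\<^esub> \<rho>' \<circ> (f \<otimes>\<^bsub>length N\<^esub> id)) \<and>
     (f \<circ> lam \<doteq>\<^bsub>FH # N\<^esub> lam' \<circ> (id \<otimes>\<^bsub>1\<^esub> f)) \<and>
     (\<delta>' \<circ> f \<doteq>\<^bsub>N\<^esub> (f \<otimes>\<^bsub>length N\<^esub> id) \<circ> \<delta>) \<and>
     (\<gamma>' \<circ> f \<doteq>\<^bsub>N\<^esub> (id \<otimes>\<^bsub>1\<^esub> f) \<circ> \<gamma>)"

text \<open>The bar differential on \<open>M \<otimes> H\<^sup>\<otimes>\<^sup>n\<close>, for \<open>n \<ge> 1\<close>, and the four structure maps of \<open>M \<otimes> H\<^sup>\<otimes>\<^sup>n\<close>.\<close>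

definition bar_d where
  "bar_d \<mu> \<rho> n = (\<lambda>t. at_pos 1 2 \<rho> t + (\<Sum>i = 1..n - 1. tscale ((- 1) ^ i) (at_pos (i + 1) 2 \<mu> t)))"

definition bar_rho where
  "bar_rho \<mu> \<rho> n = (if n = 0 then \<rho> else at_pos (n + 1) 2 \<mu>)"

definition bar_lambda where
  "bar_lambda lam = at_pos 1 2 lam"

definition bar_delta where
  "bar_delta \<mu> \<Delta> \<delta> n =
     (at_pos (n + 2) 2 \<mu> ^^ n) \<circ> permute (inv (omega (n + 1))) \<circ> (\<delta> \<otimes>\<^bsub>1\<^esub> tensor_pow \<Delta> 1 n)"

definition bar_gamma where
  "bar_gamma \<mu> \<Delta> \<gamma> n =
     (at_pos 1 2 \<mu> ^^ n) \<circ> permute (inv (omega (n + 1))) \<circ> (\<gamma> \<otimes>\<^bsub>1\<^esub> tensor_pow \<Delta> 1 n)"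

end

end

theory Submission
  imports Defs
begin

text \<open>
  The bar complex is built one tensor factor at a time, and each step is an instance of the same
  construction. If \<open>N\<close> is a Hopf bimodule, then so is \<open>N \<otimes> H\<close> with the left action of \<open>N\<close>, the
  right action of \<open>H\<close> on itself, and the diagonal coactions
  \<open>n \<otimes> h \<mapsto> n\<^sub>0 \<otimes> h\<^sub>1 \<otimes> n\<^sub>1 h\<^sub>2\<close> and \<open>n \<otimes> h \<mapsto> n\<^sub>-\<^sub>1 h\<^sub>1 \<otimes> n\<^sub>0 \<otimes> h\<^sub>2\<close>
  (\<open>hopf_bimodule_tensor_H\<close>). The point is that coassociativity, counits and the compatibility of
  the two coactions of \<open>N \<otimes> H\<close> are those of \<open>N\<close> multiplied, inside \<open>H\<close>, with those of \<open>H\<close>; this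
  works because \<open>\<Delta>\<close> and \<open>\<epsilon>\<close> are multiplicative. Starting with \<open>M\<close>, the construction yields
  \<open>M \<otimes> H\<^sup>\<otimes>\<^sup>n\<close> with the peripheral actions and the diagonal coactions.

  Two kinds of maps are Hopf bimodule morphisms: the right action \<open>\<rho>\<^sub>N : N \<otimes> H \<rightarrow> N\<close>
  (\<open>rho_hom\<close>), because the axioms relating \<open>\<rho>\<^sub>N\<close> to the rest of the structure say exactly that, and
  \<open>f \<otimes> id : N \<otimes> H \<rightarrow> P \<otimes> H\<close> for a morphism \<open>f : N \<rightarrow> P\<close> (\<open>hom_tensor_H\<close>). Writing \<open>\<rho>\<^sub>n\<close> for the right
  action of \<open>M \<otimes> H\<^sup>\<otimes>\<^sup>n\<close>, the bar differential satisfies \<open>d\<^sub>1 = \<rho>\<^sub>0\<close> and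
  \<open>d\<^sub>n\<^sub>+\<^sub>1 = d\<^sub>n \<otimes> id + (-1)\<^sup>n \<rho>\<^sub>n\<close>, so it is a morphism by induction. The same recursion gives
  \<open>d\<^sub>n d\<^sub>n\<^sub>+\<^sub>1 = 0\<close>: the part \<open>(d\<^sub>n\<^sub>-\<^sub>1 d\<^sub>n) \<otimes> id\<close> vanishes by induction, and what remains,
  \<open>(-1)\<^sup>n\<^sup>-\<^sup>1 \<rho>\<^sub>n\<^sub>-\<^sub>1 (d\<^sub>n \<otimes> id) + (-1)\<^sup>n d\<^sub>n \<rho>\<^sub>n\<close>, vanishes since \<open>d\<^sub>n\<close> is right linear (\<open>bar_total\<close>).

  The explicit formulas for the coactions, an unshuffle \<open>\<omega>\<^sup>-\<^sup>1\<close> followed by iterated multiplication,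
  satisfy the recursion because the last factor of \<open>M \<otimes> H\<^sup>\<otimes>\<^sup>n\<close> only contributes the last entry of
  either half of the unshuffled word, hence the last multiplication (\<open>bar_delta_snoc\<close>,
  \<open>bar_gamma_snoc\<close>).

  Identities of linear maps are checked on elementary tensors. A linear map between tensor spaces is
  given by a function with arbitrary values outside its domain, which makes such evaluations
  depend on domain conditions at every step. They disappear for maps that are linear on all tensors of all
  shapes (\<open>total_linear\<close>); each structure map is first replaced by one of these (\<open>totalize\<close>), and
  the result is carried back along the relation \<open>same_hom\<close>.
\<close>

section \<open>Calculating with elementary tensors\<close>

text \<open>
  A tensor is itself a function, of multilinear forms, but is treated as an element of a vector space;
  its sums are not to be evaluated pointwise.
\<close>

declare plus_fun_apply [simp del] zero_fun_apply [simp del]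

context tensor_words
begin

interpretation vT: vector_space "tscale :: 'k \<Rightarrow> ('k, 'm, 'h) tensor \<Rightarrow> ('k, 'm, 'h) tensor"
  by (rule vector_space_tscale)

lemma extend_add: "extend F (s + t) = extend F s + extend F t"
  by (simp add: extend_def fun_eq_iff plus_fun_apply)

lemma extend_zero: "extend F 0 = 0"
  by (simp add: extend_def fun_eq_iff zero_fun_apply)

lemma extend_scale: "extend F (tscale c t) = tscale c (extend F t)"
  by (simp add: extend_def tscale_def fun_eq_iff)

lemma multilinear_cong:
  assumes "\<And>xs. map factor_of xs = w \<Longrightarrow> F xs = G xs"
  shows "multilinear s w F = multilinear s w G"
proof -
  have *: "(\<lambda>a. F (xs @ Inl a # ys)) = (\<lambda>a. G (xs @ Inl a # ys))"
    if "map factor_of xs @ FM # map factor_of ys = w" for xs ys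
    using that assms by auto
  have **: "(\<lambda>a. F (xs @ Inr a # ys)) = (\<lambda>a. G (xs @ Inr a # ys))"
    if "map factor_of xs @ FH # map factor_of ys = w" for xs ys
    using that assms by auto
  show ?thesis
    unfolding multilinear_def by (simp add: * ** cong: imp_cong)
qed

text \<open>
  An elementary tensor of shape \<open>w\<close> sees a form only through its values on tuples of shape \<open>w\<close>: the
  test for multilinearity in \<open>etensor\<close> involves no others.
\<close>

lemma extend_cong:
  assumes FG: "\<And>xs. map factor_of xs = w \<Longrightarrow> F xs = G xs" and t: "t \<in> tensor_space w"
  shows "extend F t = extend G t"
  using t unfolding tensor_space_def
proof (induction rule: vT.span_induct_alt)
  case base
  then show ?case by (simp add: extend_zero)
next
  case (step c x y)
  from step(1) obtain xs where x: "x = etensor xs" "map factor_of xs = w" by auto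
  have "extend F x = extend G x"
  proof
    fix \<phi>
    have "multilinear (*) w (\<lambda>xs. F xs \<phi>) = multilinear (*) w (\<lambda>xs. G xs \<phi>)"
      by (rule multilinear_cong) (simp add: FG)
    then show "extend F x \<phi> = extend G x \<phi>"
      by (simp add: extend_def etensor_def x FG)
  qed
  then show ?case by (simp add: extend_add extend_scale step)
qed

text \<open>
  The span of the elementary tensors of all shapes. The map \<open>juxt\<close> is an associative bilinear
  product with unit \<open>etensor []\<close> on it, so that shapes need not be tracked.
\<close>

definition tensors :: "('k, 'm, 'h) tensor set" where
  "tensors = vT.span (range etensor)"

lemma tensors_intros [simp]:
  "etensor xs \<in> tensors" "0 \<in> tensors"
  "s \<in> tensors \<Longrightarrow> t \<in> tensors \<Longrightarrow> s + t \<in> tensors"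
  "s \<in> tensors \<Longrightarrow> tscale c s \<in> tensors"
  "(\<And>i. i \<in> I \<Longrightarrow> g i \<in> tensors) \<Longrightarrow> sum g I \<in> tensors"
  unfolding tensors_def
  by (auto intro: vT.span_base vT.span_zero vT.span_add vT.span_scale vT.span_sum)

lemma tensors_induct [consumes 1, case_names zero step]:
  assumes "t \<in> tensors" "P 0"
    "\<And>c xs t. t \<in> tensors \<Longrightarrow> P t \<Longrightarrow> P (tscale c (etensor xs) + t)"
  shows "P t"
proof -
  have "t \<in> tensors \<and> P t"
    using assms(1) unfolding tensors_def
  proof (induction rule: vT.span_induct_alt)
    case base
    show ?case using assms(2) by (simp add: vT.span_zero)
  next
    case (step c x y)
    then show ?case using assms(3)
      by (metis imageE tensors_def tensors_intros(1,3,4))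
  qed
  then show ?thesis ..
qed

lemma tensor_space_subset_tensors: "t \<in> tensor_space w \<Longrightarrow> t \<in> tensors"
  unfolding tensor_space_def tensors_def
  using vT.span_mono[of "etensor ` {xs. map factor_of xs = w}" "range etensor"] by blast

lemma tensor_space_closed [simp]:
  "0 \<in> tensor_space w"
  "s \<in> tensor_space w \<Longrightarrow> t \<in> tensor_space w \<Longrightarrow> s + t \<in> tensor_space w"
  "s \<in> tensor_space w \<Longrightarrow> tscale c s \<in> tensor_space w"
  "(\<And>i. i \<in> I \<Longrightarrow> g i \<in> tensor_space w) \<Longrightarrow> sum g I \<in> tensor_space w"
  unfolding tensor_space_def
  by (auto intro: vT.span_zero vT.span_add vT.span_scale vT.span_sum)

lemma tensor_space_induct [consumes 1, case_names zero step]: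
  assumes "t \<in> tensor_space w" "P 0"
    "\<And>c xs t. map factor_of xs = w \<Longrightarrow> t \<in> tensor_space w \<Longrightarrow> P t \<Longrightarrow> P (tscale c (etensor xs) + t)"
  shows "P t"
proof -
  have "t \<in> tensor_space w \<and> P t"
    using assms(1) unfolding tensor_space_def
  proof (induction rule: vT.span_induct_alt)
    case base
    show ?case using assms(2) by (simp add: vT.span_zero)
  next
    case (step c x y)
    then show ?case using assms(3)
      by (auto simp: tensor_space_def[symmetric] etensor_in_tensor_space)
  qed
  then show ?thesis ..
qed

text \<open>
  By definition \<open>juxt s t\<close> is linear in \<open>s\<close> for any \<open>t\<close>, whereas linearity in \<open>t\<close> requires \<open>s\<close> to be a
  combination of elementary tensors. This lemma, which makes \<open>juxt s t\<close> explicit for an elementary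
  \<open>s\<close>, is what the reduction to that case rests on.
\<close>

lemma juxt_etensor_left_tensors:
  assumes "t \<in> tensors"
  shows "juxt (etensor xs) t = extend (\<lambda>ys. etensor (xs @ ys)) t"
proof -
  have "multilinear tscale u (\<lambda>xs. extend (\<lambda>ys. etensor (xs @ ys)) t)" for u
    using assms
  proof (induction rule: tensors_induct)
    case zero
    show ?case
      using multilinear_extend_append[OF tensor_space_closed(1)] by simp
  next
    case (step c vs y)
    have *: "extend (\<lambda>ys. etensor (xs @ ys)) (tscale c (etensor vs) + y) =
        tscale c (etensor (xs @ vs)) + extend (\<lambda>ys. etensor (xs @ ys)) y" for xs
      by (simp add: extend_add extend_scale extend_etensor[OF multilinear_append(1) refl])
    show ?case
      unfolding * by (rule multilinear_lincomb[OF multilinear_append(2) step(2)])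
  qed
  then show ?thesis
    unfolding juxt_def by (rule extend_etensor[OF _ refl])
qed

lemma juxt_zero_left [simp]: "juxt 0 t = 0"
  by (simp add: juxt_def extend_zero)

lemma juxt_add_right:
  assumes "s \<in> tensors" "t \<in> tensors" "t' \<in> tensors"
  shows "juxt s (t + t') = juxt s t + juxt s t'"
  using assms(1)
proof (induction rule: tensors_induct)
  case (step b xs y)
  then show ?case
    by (simp add: juxt_add_left juxt_scale_left juxt_etensor_left_tensors assms extend_add
        vT.scale_right_distrib)
qed simp

lemma juxt_scale_right:
  assumes "s \<in> tensors" "t \<in> tensors"
  shows "juxt s (tscale c t) = tscale c (juxt s t)"
  using assms(1)
proof (induction rule: tensors_induct)
  case (step b xs y)
  then show ?case
    by (simp add: juxt_add_left juxt_scale_left juxt_etensor_left_tensors assms extend_scale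
        vT.scale_right_distrib vT.scale_left_commute[of b c] del: vT.scale_scale)
qed simp

lemma juxt_zero_right [simp]: "s \<in> tensors \<Longrightarrow> juxt s 0 = 0"
  using juxt_scale_right[of s 0 0] by simp

lemma juxt_in_tensor_space:
  "s \<in> tensor_space u \<Longrightarrow> t \<in> tensor_space v \<Longrightarrow> juxt s t \<in> tensor_space (u @ v)"
proof (induction rule: tensor_space_induct)
  case (step c xs s)
  have "juxt (etensor xs) t \<in> tensor_space (u @ v)"
    using \<open>t \<in> tensor_space v\<close>
  proof (induction rule: tensor_space_induct)
    case zero
    then show ?case by simp
  next
    case (step c ys t)
    then show ?case using \<open>map factor_of xs = u\<close>
      by (simp add: juxt_add_right juxt_scale_right juxt_etensor tensor_space_subset_tensors
          etensor_in_tensor_space)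
  qed
  then show ?case using step by (simp add: juxt_add_left juxt_scale_left)
qed simp

lemma juxt_in_tensors [simp]:
  "s \<in> tensors \<Longrightarrow> t \<in> tensors \<Longrightarrow> juxt s t \<in> tensors"
proof (induction rule: tensors_induct)
  case (step c xs s)
  have "juxt (etensor xs) t \<in> tensors"
    using \<open>t \<in> tensors\<close>
    by (induction rule: tensors_induct) (simp_all add: juxt_add_right juxt_scale_right juxt_etensor)
  then show ?case using step by (simp add: juxt_add_left juxt_scale_left)
qed simp

lemma juxt_sum_left: "juxt (sum g I) t = (\<Sum>i\<in>I. juxt (g i) t)"
  by (induction I rule: infinite_finite_induct) (simp_all add: juxt_add_left)

lemma juxt_sum_right:
  "s \<in> tensors \<Longrightarrow> (\<And>i. g i \<in> tensors) \<Longrightarrow> juxt s (sum g I) = (\<Sum>i\<in>I. juxt s (g i))"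
  by (induction I rule: infinite_finite_induct) (simp_all add: juxt_add_right)

lemma juxt_assoc:
  assumes "r \<in> tensors" "s \<in> tensors" "t \<in> tensors"
  shows "juxt (juxt r s) t = juxt r (juxt s t)"
  using assms(1)
proof (induction rule: tensors_induct)
  case (step c xs r)
  have "juxt (juxt (etensor xs) s) t = juxt (etensor xs) (juxt s t)"
    using assms(2)
  proof (induction rule: tensors_induct)
    case (step c ys s)
    have "juxt (juxt (etensor xs) (etensor ys)) t = juxt (etensor xs) (juxt (etensor ys) t)"
      using assms(3)
      by (induction rule: tensors_induct) (simp_all add: juxt_add_right juxt_scale_right juxt_etensor)
    then show ?case
      using step assms by (simp add: juxt_add_right juxt_scale_right juxt_add_left juxt_scale_left)
  qed simp
  then show ?case
    using step by (simp add: juxt_add_left juxt_scale_left)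
qed simp

lemma juxt_unit_left [simp]: "t \<in> tensors \<Longrightarrow> juxt (etensor []) t = t"
  by (induction rule: tensors_induct) (simp_all add: juxt_add_right juxt_scale_right juxt_etensor)

lemma juxt_unit_right [simp]: "t \<in> tensors \<Longrightarrow> juxt t (etensor []) = t"
  by (induction rule: tensors_induct) (simp_all add: juxt_add_left juxt_scale_left juxt_etensor)

text \<open>
  Maps for which tensor products can be evaluated on \<^emph>\<open>every\<close> elementary tensor, whatever its
  shape. The last condition is needed for \<open>juxt (f s) (g t)\<close> to be linear in \<open>t\<close>.
\<close>

definition total_linear :: "(('k, 'm, 'h) tensor \<Rightarrow> ('k, 'm, 'h) tensor) \<Rightarrow> bool" where
  "total_linear f \<longleftrightarrow> (\<forall>s t. f (s + t) = f s + f t) \<and> (\<forall>c t. f (tscale c t) = tscale c (f t)) \<and>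
     (\<forall>t \<in> tensors. f t \<in> tensors)"

lemma total_linearD:
  assumes "total_linear f"
  shows total_linear_add: "f (s + t) = f s + f t"
    and total_linear_scale: "f (tscale c t) = tscale c (f t)"
    and total_linear_zero: "f 0 = 0"
    and total_linear_sum: "f (sum g I) = (\<Sum>i\<in>I. f (g i))"
    and total_linear_tensors: "t \<in> tensors \<Longrightarrow> f t \<in> tensors"
proof -
  show add: "f (s + t) = f s + f t" for s t using assms by (simp add: total_linear_def)
  show "f (tscale c t) = tscale c (f t)" for t using assms by (simp add: total_linear_def)
  show zero: "f 0 = 0" using add[of 0 0] by simp
  show "f (sum g I) = (\<Sum>i\<in>I. f (g i))"
    by (induction I rule: infinite_finite_induct) (simp_all add: add zero)
  show "t \<in> tensors \<Longrightarrow> f t \<in> tensors" using assms by (simp add: total_linear_def)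
qed

lemma total_linear_id [simp]: "total_linear id"
  by (simp add: total_linear_def)

lemma total_linear_comp [simp]: "total_linear f \<Longrightarrow> total_linear g \<Longrightarrow> total_linear (f \<circ> g)"
  by (simp add: total_linear_def)

lemma total_linear_funpow [simp]: "total_linear f \<Longrightarrow> total_linear (f ^^ n)"
  by (induction n) simp_all

lemma total_linear_extend:
  assumes "\<And>w. multilinear tscale w F" "\<And>xs. F xs \<in> tensors"
  shows "total_linear (extend F)"
proof -
  have "extend F t \<in> tensors" if "t \<in> tensors" for t
    using that
  proof (induction rule: tensors_induct)
    case zero
    show ?case by (simp add: extend_zero)
  next
    case (step c xs t)
    then show ?case
      by (simp add: extend_add extend_scale extend_etensor[OF assms(1) refl] assms(2))
  qed
  then show ?thesis by (simp add: total_linear_def extend_add extend_scale)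
qed

text \<open>
  A cut beyond the end of the word leaves an empty second part.
\<close>

lemma multilinear_take_drop_any:
  assumes "\<And>u v ys. map factor_of ys = v \<Longrightarrow> multilinear s u (\<lambda>xs. B xs ys)"
    and "\<And>u v xs. map factor_of xs = u \<Longrightarrow> multilinear s v (\<lambda>ys. B xs ys)"
  shows "multilinear s w (\<lambda>zs. B (take a zs) (drop a zs))"
proof -
  have "multilinear s (take a w @ drop a w)
      (\<lambda>zs. B (take (length (take a w)) zs) (drop (length (take a w)) zs))"
    by (rule multilinear_take_drop) (use assms in blast)+
  then have "multilinear s w
      (\<lambda>zs. B (take (length (take a w)) zs) (drop (length (take a w)) zs))" by simp
  also have "?this \<longleftrightarrow> ?thesis"
    by (rule multilinear_cong) (auto simp: min_def)
  finally show ?thesis .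
qed

lemma multilinear_total_linear:
  assumes "total_linear f"
  shows "multilinear tscale w (\<lambda>xs. f (etensor xs))"
proof (rule multilinear_compose[OF multilinear_etensor])
  show "Vector_Spaces.linear tscale tscale f"
    using assms unfolding Vector_Spaces.linear_iff
    by (simp add: total_linear_def vT.vector_space_axioms)
qed

lemma multilinear_tensor_map:
  assumes "total_linear f" "total_linear g"
  shows "multilinear tscale w (\<lambda>xs. juxt (f (etensor (take a xs))) (g (etensor (drop a xs))))"
proof (rule multilinear_take_drop_any[where B = "\<lambda>xs ys. juxt (f (etensor xs)) (g (etensor ys))"])
  fix u ys
  show "multilinear tscale u (\<lambda>xs. juxt (f (etensor xs)) (g (etensor ys)))"
    by (rule multilinear_compose[OF multilinear_total_linear[OF assms(1)]])
      (simp add: Vector_Spaces.linear_iff vT.vector_space_axioms juxt_add_left juxt_scale_left)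
next
  fix v xs
  have *: "Vector_Spaces.linear sV tscale (\<lambda>a. juxt (f (etensor xs)) (g (etensor (F a))))"
    if "Vector_Spaces.linear sV tscale (\<lambda>a. etensor (F a))"
    for F and sV :: "'k \<Rightarrow> 'c::ab_group_add \<Rightarrow> 'c"
    using that assms unfolding Vector_Spaces.linear_iff
    by (simp add: total_linear_add total_linear_scale total_linear_tensors juxt_add_right juxt_scale_right)
  show "multilinear tscale v (\<lambda>ys. juxt (f (etensor xs)) (g (etensor ys)))"
    unfolding multilinear_def
    by (intro allI conjI impI *) (use multilinear_etensor[of v] in \<open>simp_all add: multilinear_def\<close>)
qed

lemma tensor_map_add: "(f \<otimes>\<^bsub>a\<^esub> g) (s + t) = (f \<otimes>\<^bsub>a\<^esub> g) s + (f \<otimes>\<^bsub>a\<^esub> g) t"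
  by (simp add: tensor_map_def extend_add)

text \<open>
  The evaluation rule on which all later calculations rely. It holds on every shape, which lets it
  act as a rewrite rule.
\<close>

lemma tensor_map_total:
  assumes "total_linear f" "total_linear g"
  shows "(f \<otimes>\<^bsub>a\<^esub> g) (etensor xs) = juxt (f (etensor (take a xs))) (g (etensor (drop a xs)))"
  unfolding tensor_map_def by (rule extend_etensor[OF multilinear_tensor_map[OF assms] refl])

lemma total_linear_tensor_map [simp]:
  assumes "total_linear f" "total_linear g"
  shows "total_linear (f \<otimes>\<^bsub>a\<^esub> g)"
  unfolding tensor_map_def
  by (rule total_linear_extend[OF multilinear_tensor_map[OF assms]])
    (simp add: assms[THEN total_linear_tensors])

lemma multilinear_flip: "multilinear tscale w (\<lambda>xs. etensor (drop a xs @ take a xs))"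
  by (rule multilinear_take_drop_any[where B = "\<lambda>xs ys. etensor (ys @ xs)"])
    (rule multilinear_append)+

lemma flip_etensor: "flip a (etensor xs) = etensor (drop a xs @ take a xs)"
  unfolding flip_def by (rule extend_etensor[OF multilinear_flip refl])

lemma total_linear_flip [simp]: "total_linear (flip a)"
  unfolding flip_def by (rule total_linear_extend[OF multilinear_flip]) simp

lemma tensor_homD:
  assumes "f \<in> tensor_hom u v"
  shows "t \<in> tensor_space u \<Longrightarrow> f t \<in> tensor_space v"
    and "s \<in> tensor_space u \<Longrightarrow> t \<in> tensor_space u \<Longrightarrow> f (s + t) = f s + f t"
    and "t \<in> tensor_space u \<Longrightarrow> f (tscale c t) = tscale c (f t)"
    and "f 0 = 0"
proof -
  show "t \<in> tensor_space u \<Longrightarrow> f t \<in> tensor_space v"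
    "s \<in> tensor_space u \<Longrightarrow> t \<in> tensor_space u \<Longrightarrow> f (s + t) = f s + f t"
    "t \<in> tensor_space u \<Longrightarrow> f (tscale c t) = tscale c (f t)"
    using assms by (simp_all add: tensor_hom_def)
  have "f (tscale 0 0) = tscale 0 (f 0)"
    using assms tensor_space_closed(1)[of u] unfolding tensor_hom_def by blast
  then show "f 0 = 0" by simp
qed

lemma tensor_homI:
  assumes "total_linear f" "\<And>xs. map factor_of xs = u \<Longrightarrow> f (etensor xs) \<in> tensor_space v"
  shows "f \<in> tensor_hom u v"
proof -
  have "f t \<in> tensor_space v" if "t \<in> tensor_space u" for t
    using that
    by (induction rule: tensor_space_induct)
      (simp_all add: assms total_linearD[OF assms(1)])
  then show ?thesis
    by (simp add: tensor_hom_def total_linear_add[OF assms(1)] total_linear_scale[OF assms(1)])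
qed

lemma hom_eqI:
  assumes f: "f \<in> tensor_hom u v" and g: "g \<in> tensor_hom u v'"
    and eq: "\<And>xs. map factor_of xs = u \<Longrightarrow> f (etensor xs) = g (etensor xs)"
  shows "f \<doteq>\<^bsub>u\<^esub> g"
proof -
  have "f t = g t" if "t \<in> tensor_space u" for t
    using that
    by (induction rule: tensor_space_induct)
      (simp_all add: tensor_homD[OF f] tensor_homD[OF g] eq etensor_in_tensor_space)
  then show ?thesis by (simp add: map_eq_def)
qed

lemma total_eqI:
  assumes f: "total_linear f" and g: "total_linear g"
    and eq: "\<And>xs. map factor_of xs = u \<Longrightarrow> f (etensor xs) = g (etensor xs)"
  shows "f \<doteq>\<^bsub>u\<^esub> g"
proof -
  have "f t = g t" if "t \<in> tensor_space u" for t
    using that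
    by (induction rule: tensor_space_induct)
      (simp_all add: total_linearD[OF f] total_linearD[OF g] eq)
  then show ?thesis by (simp add: map_eq_def)
qed

lemma tensor_map_in_hom:
  assumes f: "f \<in> tensor_hom u u'" and g: "g \<in> tensor_hom v v'" and a: "length u = a"
  shows "(f \<otimes>\<^bsub>a\<^esub> g) \<in> tensor_hom (u @ v) (u' @ v')"
proof -
  have "(f \<otimes>\<^bsub>a\<^esub> g) t \<in> tensor_space (u' @ v')" if "t \<in> tensor_space (u @ v)" for t
    using that
  proof (induction rule: tensor_space_induct)
    case zero
    show ?case by (simp add: tensor_map_def extend_zero)
  next
    case (step c xs t)
    from step(1) obtain us vs where xs: "xs = us @ vs" "map factor_of us = u" "map factor_of vs = v"
      by (auto simp: map_eq_append_conv)
    have "(f \<otimes>\<^bsub>a\<^esub> g) (etensor xs) \<in> tensor_space (u' @ v')"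
      using tensor_map_etensor[OF f g xs(2,3)] a
      by (simp add: xs juxt_in_tensor_space tensor_homD[OF f] tensor_homD[OF g] etensor_in_tensor_space)
    then show ?case using step by (simp add: tensor_map_def extend_add extend_scale)
  qed
  then show ?thesis by (simp add: tensor_hom_def tensor_map_def extend_add extend_scale)
qed

section \<open>Replacing structure maps by everywhere linear ones\<close>

text \<open>
  Two functions representing the same linear map. The relation is a congruence for composition and
  tensor product, hence for every axiom of bialgebras, Hopf bimodules and their morphisms.
\<close>

definition same_hom where
  "same_hom u v f f' \<longleftrightarrow> f \<in> tensor_hom u v \<and> f' \<in> tensor_hom u v \<and> (f \<doteq>\<^bsub>u\<^esub> f')"

lemma same_hom_comp:
  "same_hom u v f f' \<Longrightarrow> same_hom v w g g' \<Longrightarrow> same_hom u w (g \<circ> f) (g' \<circ> f')"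
  by (simp add: same_hom_def tensor_hom_def map_eq_def)

lemma same_hom_id: "same_hom u u id id"
  by (simp add: same_hom_def tensor_hom_def map_eq_def)

lemma same_hom_tensor:
  assumes "same_hom u u' f f'" "same_hom v v' g g'" "length u = a"
  shows "same_hom (u @ v) (u' @ v') (f \<otimes>\<^bsub>a\<^esub> g) (f' \<otimes>\<^bsub>a\<^esub> g')"
proof -
  have "(f \<otimes>\<^bsub>a\<^esub> g) t = (f' \<otimes>\<^bsub>a\<^esub> g') t" if "t \<in> tensor_space (u @ v)" for t
    unfolding tensor_map_def
  proof (rule extend_cong[OF _ that])
    fix xs :: "('m + 'h) list" assume "map factor_of xs = u @ v"
    then have "etensor (take a xs) \<in> tensor_space u" "etensor (drop a xs) \<in> tensor_space v"
      using assms(3) by (auto intro!: etensor_in_tensor_space simp: take_map[symmetric] drop_map[symmetric])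
    then show "juxt (f (etensor (take a xs))) (g (etensor (drop a xs))) =
        juxt (f' (etensor (take a xs))) (g' (etensor (drop a xs)))"
      using assms by (simp add: same_hom_def map_eq_def)
  qed
  then show ?thesis using assms
    by (simp add: same_hom_def map_eq_def tensor_map_in_hom)
qed

lemma same_hom_flip: "same_hom (u @ v) (v @ u) (flip (length u)) (flip (length u))"
  unfolding same_hom_def map_eq_def
  by (auto intro!: tensor_homI etensor_in_tensor_space simp: flip_etensor drop_map[symmetric] take_map[symmetric])

text \<open>
  The extension of a linear map by zero on the elementary tensors of other shapes. Extending by zero
  keeps the prescribed values multilinear on every shape.
\<close>

definition totalize where
  "totalize u f = extend (\<lambda>xs. if map factor_of xs = u then f (etensor xs) else 0)"

lemma totalize:
  assumes f: "f \<in> tensor_hom u v"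
  shows total_linear_totalize: "total_linear (totalize u f)"
    and same_hom_totalize: "same_hom u v f (totalize u f)"
proof -
  let ?F = "\<lambda>xs. if map factor_of xs = u then f (etensor xs) else 0"
  have "multilinear tscale w ?F" for w
  proof (cases "w = u")
    case True
    have "multilinear tscale u ?F = multilinear tscale u (\<lambda>xs. f (etensor xs))"
      by (rule multilinear_cong) simp
    then show ?thesis
      using multilinear_on[OF multilinear_etensor etensor_in_tensor_space tensor_homD(2,3)[OF f]] True
      by blast
  next
    case False
    have "multilinear tscale w ?F = multilinear tscale w (\<lambda>_. 0 :: ('k, 'm, 'h) tensor)"
      by (rule multilinear_cong) (simp add: False)
    also have "\<dots>"
      using multilinear_etensor[of w] vT.vector_space_axioms
      by (auto simp: multilinear_def Vector_Spaces.linear_iff vM.vector_space_axioms vH.vector_space_axioms)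
    finally show ?thesis .
  qed
  note ml = this
  have mem: "map factor_of xs = u \<Longrightarrow> f (etensor xs) \<in> tensor_space v" for xs
    by (simp add: tensor_homD[OF f] etensor_in_tensor_space)
  show tl: "total_linear (totalize u f)"
    unfolding totalize_def
    by (rule total_linear_extend[OF ml]) (auto intro: tensor_space_subset_tensors mem)
  have ev: "totalize u f (etensor xs) = f (etensor xs)" if "map factor_of xs = u" for xs
    unfolding totalize_def by (subst extend_etensor[OF ml that]) (simp add: that)
  have hom: "totalize u f \<in> tensor_hom u v"
    by (rule tensor_homI[OF tl]) (simp add: ev mem)
  show "same_hom u v f (totalize u f)"
    unfolding same_hom_def using f hom hom_eqI[OF f hom] ev by simp
qed

lemma same_hom_tensorI:
  assumes "same_hom u u' f f'" "same_hom v v' g g'" "length u = a" "u @ v = w" "u' @ v' = w'"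
  shows "same_hom w w' (f \<otimes>\<^bsub>a\<^esub> g) (f' \<otimes>\<^bsub>a\<^esub> g')"
  using same_hom_tensor[OF assms(1-3)] assms(4,5) by simp

lemma same_hom_flipI:
  assumes "length u = a" "u @ v = w" "v @ u = w'"
  shows "same_hom w w' (flip a) (flip a)"
  using same_hom_flip[of u v] assms by simp

lemma map_eq_transfer:
  "(f \<doteq>\<^bsub>u\<^esub> g) \<Longrightarrow> same_hom u v f f' \<Longrightarrow> same_hom u v' g g' \<Longrightarrow> (f' \<doteq>\<^bsub>u\<^esub> g')"
  by (simp add: same_hom_def map_eq_def)

text \<open>
  In the congruence lemmas each axiom is transported along a derivation of \<open>same_hom\<close> that follows
  the build-up of its two sides from compositions, tensor products, identities and flips.
\<close>

lemma bialgebra_cong: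
  assumes H: "bialgebra \<mu> \<nu> \<Delta> \<epsilon>"
    and m: "same_hom [FH, FH] [FH] \<mu> \<mu>'" and u: "same_hom [] [FH] \<nu> \<nu>'"
    and d: "same_hom [FH] [FH, FH] \<Delta> \<Delta>'" and e: "same_hom [FH] [] \<epsilon> \<epsilon>'"
  shows "bialgebra \<mu>' \<nu>' \<Delta>' \<epsilon>'"
proof -
  note C = same_hom_comp and T = same_hom_tensorI and I = same_hom_id[of "[FH]"]
    and F = same_hom_flipI[of "[FH]" 1 "[FH]"]
  have hom: "\<mu>' \<in> tensor_hom [FH, FH] [FH]" "\<nu>' \<in> tensor_hom [] [FH]"
    "\<Delta>' \<in> tensor_hom [FH] [FH, FH]" "\<epsilon>' \<in> tensor_hom [FH] []"
    using m u d e by (simp_all add: same_hom_def)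
  have assoc: "\<mu>' \<circ> (\<mu>' \<otimes>\<^bsub>2\<^esub> id) \<doteq>\<^bsub>[FH, FH, FH]\<^esub> \<mu>' \<circ> (id \<otimes>\<^bsub>1\<^esub> \<mu>')"
    by (rule map_eq_transfer[OF _ C[OF T[OF m I] m] C[OF T[OF I m] m]])
      (use H in \<open>simp_all add: bialgebra_def\<close>)
  have unit: "\<mu>' \<circ> (\<nu>' \<otimes>\<^bsub>0\<^esub> id) \<doteq>\<^bsub>[FH]\<^esub> id" "\<mu>' \<circ> (id \<otimes>\<^bsub>1\<^esub> \<nu>') \<doteq>\<^bsub>[FH]\<^esub> id"
    by (rule map_eq_transfer[OF _ C[OF T[OF u I] m] I] map_eq_transfer[OF _ C[OF T[OF I u] m] I];
        use H in \<open>simp add: bialgebra_def\<close>)+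
  have coassoc: "(\<Delta>' \<otimes>\<^bsub>1\<^esub> id) \<circ> \<Delta>' \<doteq>\<^bsub>[FH]\<^esub> (id \<otimes>\<^bsub>1\<^esub> \<Delta>') \<circ> \<Delta>'"
    by (rule map_eq_transfer[OF _ C[OF d T[OF d I]] C[OF d T[OF I d]]])
      (use H in \<open>simp_all add: bialgebra_def\<close>)
  have counit: "(\<epsilon>' \<otimes>\<^bsub>1\<^esub> id) \<circ> \<Delta>' \<doteq>\<^bsub>[FH]\<^esub> id" "(id \<otimes>\<^bsub>1\<^esub> \<epsilon>') \<circ> \<Delta>' \<doteq>\<^bsub>[FH]\<^esub> id"
    by (rule map_eq_transfer[OF _ C[OF d T[OF e I]] I] map_eq_transfer[OF _ C[OF d T[OF I e]] I];
        use H in \<open>simp add: bialgebra_def\<close>)+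
  have mult: "\<Delta>' \<circ> \<mu>' \<doteq>\<^bsub>[FH, FH]\<^esub> (\<mu>' \<otimes>\<^bsub>2\<^esub> \<mu>') \<circ> (id \<otimes>\<^bsub>1\<^esub> flip 1 \<otimes>\<^bsub>2\<^esub> id) \<circ> (\<Delta>' \<otimes>\<^bsub>1\<^esub> \<Delta>')"
    by (rule map_eq_transfer[OF _ C[OF m d] C[OF T[OF d d] C[OF T[OF I T[OF F I]] T[OF m m]]]])
      (simp_all, use H in \<open>simp add: bialgebra_def\<close>, simp)
  have rest: "\<Delta>' \<circ> \<nu>' \<doteq>\<^bsub>[]\<^esub> \<nu>' \<otimes>\<^bsub>0\<^esub> \<nu>'"
    "\<epsilon>' \<circ> \<mu>' \<doteq>\<^bsub>[FH, FH]\<^esub> \<epsilon>' \<otimes>\<^bsub>1\<^esub> \<epsilon>'" "\<epsilon>' \<circ> \<nu>' \<doteq>\<^bsub>[]\<^esub> id"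
    by (rule map_eq_transfer[OF _ C[OF u d] T[OF u u]] map_eq_transfer[OF _ C[OF m e] T[OF e e]]
         map_eq_transfer[OF _ C[OF u e] same_hom_id];
        use H in \<open>simp add: bialgebra_def\<close>)+
  show ?thesis
    unfolding bialgebra_def using hom assoc unit coassoc counit mult rest by blast
qed

lemma hopf_bimodule_cong:
  assumes N: "hopf_bimodule \<mu> \<nu> \<Delta> \<epsilon> N \<rho> lam \<delta> \<gamma>"
    and m: "same_hom [FH, FH] [FH] \<mu> \<mu>'" and u: "same_hom [] [FH] \<nu> \<nu>'"
    and d: "same_hom [FH] [FH, FH] \<Delta> \<Delta>'" and e: "same_hom [FH] [] \<epsilon> \<epsilon>'"
    and r: "same_hom (N @ [FH]) N \<rho> \<rho>'" and l: "same_hom (FH # N) N lam lam'"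
    and dr: "same_hom N (N @ [FH]) \<delta> \<delta>'" and dl: "same_hom N (FH # N) \<gamma> \<gamma>'"
  shows "hopf_bimodule \<mu>' \<nu>' \<Delta>' \<epsilon>' N \<rho>' lam' \<delta>' \<gamma>'"
proof -
  note C = same_hom_comp and T = same_hom_tensorI and IH = same_hom_id[of "[FH]"]
    and IN = same_hom_id[of N]
    and F = same_hom_flipI[of "[FH]" 1 "[FH]"] and FN = same_hom_flipI[of "[FH]" 1 N]
    and NF = same_hom_flipI[of N "length N" "[FH]"]
  note N' = N[unfolded hopf_bimodule_def bimodule_def bicomodule_def]
  have hom: "\<rho>' \<in> tensor_hom (N @ [FH]) N" "lam' \<in> tensor_hom (FH # N) N"
    "\<delta>' \<in> tensor_hom N (N @ [FH])" "\<gamma>' \<in> tensor_hom N (FH # N)"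
    using r l dr dl by (simp_all add: same_hom_def)
  have right: "\<rho>' \<circ> (\<rho>' \<otimes>\<^bsub>length N + 1\<^esub> id) \<doteq>\<^bsub>N @ [FH, FH]\<^esub> \<rho>' \<circ> (id \<otimes>\<^bsub>length N\<^esub> \<mu>')"
    "\<rho>' \<circ> (id \<otimes>\<^bsub>length N\<^esub> \<nu>') \<doteq>\<^bsub>N\<^esub> id"
    by (rule map_eq_transfer[OF _ C[OF T[OF r IH] r] C[OF T[OF IN m] r]]
        map_eq_transfer[OF _ C[OF T[OF IN u] r] IN]; use N' in simp)+
  have left: "lam' \<circ> (id \<otimes>\<^bsub>1\<^esub> lam') \<doteq>\<^bsub>[FH, FH] @ N\<^esub> lam' \<circ> (\<mu>' \<otimes>\<^bsub>2\<^esub> id)"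
    "lam' \<circ> (\<nu>' \<otimes>\<^bsub>0\<^esub> id) \<doteq>\<^bsub>N\<^esub> id"
    "\<rho>' \<circ> (lam' \<otimes>\<^bsub>1 + length N\<^esub> id) \<doteq>\<^bsub>FH # N @ [FH]\<^esub> lam' \<circ> (id \<otimes>\<^bsub>1\<^esub> \<rho>')"
    by (rule map_eq_transfer[OF _ C[OF T[OF IH l] l] C[OF T[OF m IN] l]]
        map_eq_transfer[OF _ C[OF T[OF u IN] l] IN]
        map_eq_transfer[OF _ C[OF T[OF l IH] r] C[OF T[OF IH r] l]]; use N' in simp)+
  have coright: "(\<delta>' \<otimes>\<^bsub>length N\<^esub> id) \<circ> \<delta>' \<doteq>\<^bsub>N\<^esub> (id \<otimes>\<^bsub>length N\<^esub> \<Delta>') \<circ> \<delta>'"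
    "(id \<otimes>\<^bsub>length N\<^esub> \<epsilon>') \<circ> \<delta>' \<doteq>\<^bsub>N\<^esub> id"
    by (rule map_eq_transfer[OF _ C[OF dr T[OF dr IH]] C[OF dr T[OF IN d]]]
        map_eq_transfer[OF _ C[OF dr T[OF IN e]] IN]; use N' in simp)+
  have coleft: "(id \<otimes>\<^bsub>1\<^esub> \<gamma>') \<circ> \<gamma>' \<doteq>\<^bsub>N\<^esub> (\<Delta>' \<otimes>\<^bsub>1\<^esub> id) \<circ> \<gamma>'"
    "(\<epsilon>' \<otimes>\<^bsub>1\<^esub> id) \<circ> \<gamma>' \<doteq>\<^bsub>N\<^esub> id"
    "(\<gamma>' \<otimes>\<^bsub>length N\<^esub> id) \<circ> \<delta>' \<doteq>\<^bsub>N\<^esub> (id \<otimes>\<^bsub>1\<^esub> \<delta>') \<circ> \<gamma>'"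
    by (rule map_eq_transfer[OF _ C[OF dl T[OF IH dl]] C[OF dl T[OF d IN]]]
        map_eq_transfer[OF _ C[OF dl T[OF e IN]] IN]
        map_eq_transfer[OF _ C[OF dr T[OF dl IH]] C[OF dl T[OF IH dr]]]; use N' in simp)+
  have "\<delta>' \<circ> \<rho>' \<doteq>\<^bsub>N @ [FH]\<^esub>
        (\<rho>' \<otimes>\<^bsub>length N + 1\<^esub> \<mu>') \<circ> (id \<otimes>\<^bsub>length N\<^esub> flip 1 \<otimes>\<^bsub>2\<^esub> id) \<circ> (\<delta>' \<otimes>\<^bsub>length N\<^esub> \<Delta>')"
    by (rule map_eq_transfer[OF _ C[OF r dr] C[OF T[OF dr d] C[OF T[OF IN T[OF F IH]] T[OF r m]]]])
      (simp_all, use N' in simp, simp)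
  moreover have "\<delta>' \<circ> lam' \<doteq>\<^bsub>FH # N\<^esub>
        (lam' \<otimes>\<^bsub>1 + length N\<^esub> \<mu>') \<circ> (id \<otimes>\<^bsub>1\<^esub> flip 1 \<otimes>\<^bsub>1 + length N\<^esub> id) \<circ> (\<Delta>' \<otimes>\<^bsub>1\<^esub> \<delta>')"
    by (rule map_eq_transfer[OF _ C[OF l dr] C[OF T[OF d dr] C[OF T[OF IH T[OF FN IH]] T[OF l m]]]])
      (simp_all, use N' in simp, simp)
  moreover have "\<gamma>' \<circ> \<rho>' \<doteq>\<^bsub>N @ [FH]\<^esub>
        (\<mu>' \<otimes>\<^bsub>2\<^esub> \<rho>') \<circ> (id \<otimes>\<^bsub>1\<^esub> flip (length N) \<otimes>\<^bsub>length N + 1\<^esub> id) \<circ> (\<gamma>' \<otimes>\<^bsub>length N\<^esub> \<Delta>')"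
    by (rule map_eq_transfer[OF _ C[OF r dl] C[OF T[OF dl d] C[OF T[OF IH T[OF NF IH]] T[OF m r]]]])
      (simp_all, use N' in simp, simp)
  moreover have "\<gamma>' \<circ> lam' \<doteq>\<^bsub>FH # N\<^esub>
        (\<mu>' \<otimes>\<^bsub>2\<^esub> lam') \<circ> (id \<otimes>\<^bsub>1\<^esub> flip 1 \<otimes>\<^bsub>2\<^esub> id) \<circ> (\<Delta>' \<otimes>\<^bsub>1\<^esub> \<gamma>')"
    by (rule map_eq_transfer[OF _ C[OF l dl] C[OF T[OF d dl] C[OF T[OF IH T[OF F IN]] T[OF m l]]]])
      (simp_all, use N' in simp, simp)
  ultimately show ?thesis
    unfolding hopf_bimodule_def bimodule_def bicomodule_def
    using hom right left coright coleft by blast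
qed

lemma hopf_bimodule_hom_cong:
  assumes f: "hopf_bimodule_hom N \<rho> lam \<delta> \<gamma> P \<rho>1 lam1 \<delta>1 \<gamma>1 f" and f': "same_hom N P f f'"
    and r: "same_hom (N @ [FH]) N \<rho> \<rho>'" and l: "same_hom (FH # N) N lam lam'"
    and dr: "same_hom N (N @ [FH]) \<delta> \<delta>'" and dl: "same_hom N (FH # N) \<gamma> \<gamma>'"
    and r1: "same_hom (P @ [FH]) P \<rho>1 \<rho>1'" and l1: "same_hom (FH # P) P lam1 lam1'"
    and dr1: "same_hom P (P @ [FH]) \<delta>1 \<delta>1'" and dl1: "same_hom P (FH # P) \<gamma>1 \<gamma>1'"
  shows "hopf_bimodule_hom N \<rho>' lam' \<delta>' \<gamma>' P \<rho>1' lam1' \<delta>1' \<gamma>1' f'"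
proof -
  note C = same_hom_comp and T = same_hom_tensorI and IH = same_hom_id[of "[FH]"]
  note f1 = f[unfolded hopf_bimodule_hom_def]
  have "f' \<circ> \<rho>' \<doteq>\<^bsub>N @ [FH]\<^esub> \<rho>1' \<circ> (f' \<otimes>\<^bsub>length N\<^esub> id)" "f' \<circ> lam' \<doteq>\<^bsub>FH # N\<^esub> lam1' \<circ> (id \<otimes>\<^bsub>1\<^esub> f')"
    "\<delta>1' \<circ> f' \<doteq>\<^bsub>N\<^esub> (f' \<otimes>\<^bsub>length N\<^esub> id) \<circ> \<delta>'" "\<gamma>1' \<circ> f' \<doteq>\<^bsub>N\<^esub> (id \<otimes>\<^bsub>1\<^esub> f') \<circ> \<gamma>'"
    by (rule map_eq_transfer[OF _ C[OF r f'] C[OF T[OF f' IH] r1]]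
        map_eq_transfer[OF _ C[OF l f'] C[OF T[OF IH f'] l1]]
        map_eq_transfer[OF _ C[OF f' dr1] C[OF dr T[OF f' IH]]]
        map_eq_transfer[OF _ C[OF f' dl1] C[OF dl T[OF IH f']]]; use f1 in simp)+
  then show ?thesis
    unfolding hopf_bimodule_hom_def using f' by (simp add: same_hom_def)
qed

section \<open>Sweedler notation\<close>

text \<open>
  For a nonempty word the scalar can be moved into the first factor, so that the tensors of that
  shape are plain sums of elementary ones.
\<close>

lemma etensor_absorb_scalar:
  assumes "map factor_of xs = w" "w \<noteq> []"
  shows "\<exists>ys. map factor_of ys = w \<and> tscale c (etensor xs) = etensor ys"
proof (cases xs)
  case (Cons x zs)
  show ?thesis
  proof (cases x)
    case (Inl m)
    have "Vector_Spaces.linear sM tscale (\<lambda>m. etensor ([] @ Inl m # zs))"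
      using multilinear_etensor[of w, unfolded multilinear_def, rule_format, of "[]" zs] assms Cons Inl
      by simp
    then have "tscale c (etensor xs) = etensor (Inl (sM c m) # zs)"
      using Cons Inl by (simp add: Vector_Spaces.linear_iff)
    then show ?thesis using assms Cons Inl by (intro exI[of _ "Inl (sM c m) # zs"]) auto
  next
    case (Inr h)
    have "Vector_Spaces.linear sH tscale (\<lambda>h. etensor ([] @ Inr h # zs))"
      using multilinear_etensor[of w, unfolded multilinear_def, rule_format, of "[]" zs] assms Cons Inr
      by simp
    then have "tscale c (etensor xs) = etensor (Inr (sH c h) # zs)"
      using Cons Inr by (simp add: Vector_Spaces.linear_iff)
    then show ?thesis using assms Cons Inr by (intro exI[of _ "Inr (sH c h) # zs"]) auto
  qed
qed (use assms in simp)

lemma ex_shape: "\<exists>xs :: ('m + 'h) list. map factor_of xs = w"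
proof (induction w)
  case (Cons x w)
  then obtain xs :: "('m + 'h) list" where "map factor_of xs = w" by blast
  then have "map factor_of ((if x = FM then Inl 0 else Inr 0 :: 'm + 'h) # xs) = x # w"
    by (cases x) auto
  then show ?case by (rule exI)
qed simp

lemma tensor_space_sum:
  assumes "t \<in> tensor_space w" "w \<noteq> []"
  shows "\<exists>(k::nat) l. t = (\<Sum>i<k. etensor (l i)) \<and> (\<forall>i. map factor_of (l i) = w)"
  using assms(1)
proof (induction rule: tensor_space_induct)
  case zero
  obtain xs :: "('m + 'h) list" where "map factor_of xs = w" using ex_shape by blast
  then show ?case by (intro exI[of _ 0] exI[of _ "\<lambda>_. xs"]) simp
next
  case (step c xs t)
  then obtain k l where kl: "t = (\<Sum>i<(k::nat). etensor (l i))" "\<forall>i. map factor_of (l i) = w" by blast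
  from etensor_absorb_scalar[OF step(1) assms(2)] obtain ys
    where ys: "map factor_of ys = w" "tscale c (etensor xs) = etensor ys" by blast
  have "tscale c (etensor xs) + t = (\<Sum>i<Suc k. etensor ((l(k := ys)) i))"
    by (simp add: kl(1) ys(2) add.commute)
  then show ?case
    using kl(2) ys(1) by (intro exI[of _ "Suc k"] exI[of _ "l(k := ys)"]) auto
qed

text \<open>
  The lists \<open>l xs i\<close> have shape \<open>v\<close> for all \<open>xs\<close> and \<open>i\<close>, also beyond the range of summation and for
  \<open>xs\<close> of a wrong shape; thus the terms of iterated sums can be rewritten without side conditions.
\<close>

lemma sweedler_hom:
  assumes f: "f \<in> tensor_hom u v" and v: "v \<noteq> []"
  shows "\<exists>(k :: ('m + 'h) list \<Rightarrow> nat) l.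
    (\<forall>xs. map factor_of xs = u \<longrightarrow> f (etensor xs) = (\<Sum>i<k xs. etensor (l xs i))) \<and>
    (\<forall>xs i. map factor_of (l xs i) = v)"
proof -
  have "\<exists>k l. (map factor_of xs = u \<longrightarrow> f (etensor xs) = (\<Sum>i<k. etensor (l i))) \<and>
      (\<forall>i :: nat. map factor_of (l i) = v)" for xs
  proof (cases "map factor_of xs = u")
    case True
    then have "f (etensor xs) \<in> tensor_space v"
      by (simp add: tensor_homD[OF f] etensor_in_tensor_space)
    from tensor_space_sum[OF this v] show ?thesis by blast
  next
    case False
    obtain ys :: "('m + 'h) list" where "map factor_of ys = v" using ex_shape by blast
    then show ?thesis using False by (intro exI[of _ 0] exI[of _ "\<lambda>_. ys"]) simp
  qed
  then show ?thesis by metis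
qed

lemma tensor_map_juxt:
  assumes "total_linear f" "total_linear g" "s \<in> tensor_space u" "length u = a" "t \<in> tensors"
  shows "(f \<otimes>\<^bsub>a\<^esub> g) (juxt s t) = juxt (f s) (g t)"
  using assms(3)
proof (induction rule: tensor_space_induct)
  case zero
  then show ?case by (simp add: total_linear_zero assms)
next
  case (step c xs s)
  have len: "length xs = a" using step(1) assms(4) by auto
  have "(f \<otimes>\<^bsub>a\<^esub> g) (juxt (etensor xs) t) = juxt (f (etensor xs)) (g t)"
    using assms(5)
  proof (induction rule: tensors_induct)
    case zero
    then show ?case by (simp add: total_linearD assms)
  next
    case (step c ys t)
    then show ?case
      using len by (simp add: juxt_add_right juxt_scale_right total_linearD assms(1,2) juxt_etensor
          total_linear_add[OF total_linear_tensor_map] total_linear_scale[OF total_linear_tensor_map]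
          tensor_map_total)
  qed
  then show ?case using step
    by (simp add: juxt_add_left juxt_scale_left assms(1,2) total_linear_add[OF assms(1)]
        total_linear_scale[OF assms(1)]
        total_linear_add[OF total_linear_tensor_map] total_linear_scale[OF total_linear_tensor_map])
qed

lemma tensor_map_sum: "(f \<otimes>\<^bsub>a\<^esub> g) (sum h I) = (\<Sum>i\<in>I. (f \<otimes>\<^bsub>a\<^esub> g) (h i))"
  unfolding tensor_map_def
  by (induction I rule: infinite_finite_induct) (simp_all add: extend_zero extend_add)

lemma tensor_map_scale: "(f \<otimes>\<^bsub>a\<^esub> g) (tscale c t) = tscale c ((f \<otimes>\<^bsub>a\<^esub> g) t)"
  by (simp add: tensor_map_def extend_scale)

lemma flip_sum: "flip a (sum h I) = (\<Sum>i\<in>I. flip a (h i))"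
  by (rule total_linear_sum) simp

lemma tscale_sum: "tscale c (sum h I :: ('k, 'm, 'h) tensor) = (\<Sum>i\<in>I. tscale c (h i))"
  by (simp add: vT.scale_sum_right)

lemma shape_conv:
  "map factor_of xs = u @ v \<longleftrightarrow> (\<exists>ys zs. xs = ys @ zs \<and> map factor_of ys = u \<and> map factor_of zs = v)"
  "map factor_of xs = FH # w \<longleftrightarrow> (\<exists>a ys. xs = Inr a # ys \<and> map factor_of ys = w)"
  "map factor_of xs = FM # w \<longleftrightarrow> (\<exists>a ys. xs = Inl a # ys \<and> map factor_of ys = w)"
  by (auto simp: map_eq_append_conv map_eq_Cons_conv factor_of_eq)

lemma tscale_tscale: "tscale a (tscale b t) = tscale (a * b) t"
  by (simp add: tscale_def mult.assoc)

text \<open>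
  The diagonal coactions on \<open>N \<otimes> H\<close>. In Sweedler notation, \<open>diag_right\<close> is
  \<open>n \<otimes> h \<mapsto> n\<^sub>0 \<otimes> h\<^sub>1 \<otimes> n\<^sub>1 h\<^sub>2\<close> and \<open>diag_left\<close> is \<open>n \<otimes> h \<mapsto> n\<^sub>-\<^sub>1 h\<^sub>1 \<otimes> n\<^sub>0 \<otimes> h\<^sub>2\<close>.
\<close>

definition "diag_right \<mu> \<Delta> N \<delta> =
  (id \<otimes>\<^bsub>length N + 1\<^esub> \<mu>) \<circ> (id \<otimes>\<^bsub>length N\<^esub> flip 1 \<otimes>\<^bsub>2\<^esub> id) \<circ> (\<delta> \<otimes>\<^bsub>length N\<^esub> \<Delta>)"
definition "diag_left \<mu> \<Delta> N \<gamma> =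
  (\<mu> \<otimes>\<^bsub>2\<^esub> id) \<circ> (id \<otimes>\<^bsub>1\<^esub> flip (length N) \<otimes>\<^bsub>length N + 1\<^esub> id) \<circ> (\<gamma> \<otimes>\<^bsub>length N\<^esub> \<Delta>)"

lemmas evaluate = tensor_map_total tensor_map_sum tensor_map_scale flip_sum flip_etensor
  juxt_sum_left juxt_sum_right juxt_etensor juxt_scale_left juxt_scale_right tscale_tscale tscale_sum

end

text \<open>
  A bialgebra with everywhere linear structure maps and chosen coordinates: \<open>mul\<close>, \<open>one\<close> and \<open>eps\<close>
  act on the vectors of \<open>H\<close> themselves, and the summands of \<open>\<Delta> a\<close> are \<open>hl a j \<otimes> hr a j\<close>. The
  summands need not depend linearly on \<open>a\<close>, so identities such as coassociativity hold for the sums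
  only and are applied to whole tensors.
\<close>

locale sweedler_bialgebra = tensor_words sM sH
  for sM :: "'k::field \<Rightarrow> 'm::ab_group_add \<Rightarrow> 'm"
  and sH :: "'k \<Rightarrow> 'h::ab_group_add \<Rightarrow> 'h" +
  fixes \<mu> \<nu> \<Delta> \<epsilon> :: "('k, 'm, 'h) tensor \<Rightarrow> ('k, 'm, 'h) tensor"
    and mul :: "'h \<Rightarrow> 'h \<Rightarrow> 'h" and one :: 'h and eps :: "'h \<Rightarrow> 'k"
    and cop :: "'h \<Rightarrow> nat" and hl hr :: "'h \<Rightarrow> nat \<Rightarrow> 'h"
  assumes bialg: "bialgebra \<mu> \<nu> \<Delta> \<epsilon>"
    and total [simp]: "total_linear \<mu>" "total_linear \<nu>" "total_linear \<Delta>" "total_linear \<epsilon>"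
    and mul: "\<mu> (etensor [Inr a, Inr b]) = etensor [Inr (mul a b)]"
    and one: "\<nu> (etensor []) = etensor [Inr one]"
    and eps: "\<epsilon> (etensor [Inr a]) = tscale (eps a) (etensor [])"
    and cop: "\<Delta> (etensor [Inr a]) = (\<Sum>j<cop a. etensor [Inr (hl a j), Inr (hr a j)])"
begin

lemma map_eqD: "f \<doteq>\<^bsub>w\<^esub> g \<Longrightarrow> map factor_of xs = w \<Longrightarrow> f (etensor xs) = g (etensor xs)"
  by (simp add: map_eq_def etensor_in_tensor_space)

lemmas total_sums = total[THEN total_linear_sum] total[THEN total_linear_scale]
lemmas ev = evaluate total_sums mul one eps

lemma etensor_H_inj: "etensor [Inr a] = (etensor [Inr b] :: ('k, 'm, 'h) tensor) \<longleftrightarrow> a = b"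
  using bij_betw_etensor_H by (auto simp: bij_betw_def inj_on_def)

lemma mul_assoc: "mul (mul a b) c = mul a (mul b c)"
proof -
  have "\<mu> \<circ> (\<mu> \<otimes>\<^bsub>2\<^esub> id) \<doteq>\<^bsub>[FH, FH, FH]\<^esub> \<mu> \<circ> (id \<otimes>\<^bsub>1\<^esub> \<mu>)"
    using bialg by (simp add: bialgebra_def)
  from map_eqD[OF this, of "[Inr a, Inr b, Inr c]"] show ?thesis
    by (simp add: ev etensor_H_inj)
qed

text \<open>
  Among the two expansions of \<open>\<Delta> (a b)\<close>, the one by \<open>cop\<close> in terms of the product and this one in
  terms of the factors, each calculation below uses the one that matches the other side.
\<close>

lemma cop_mul:
  "\<Delta> (etensor [Inr (mul a b)]) =
    (\<Sum>i<cop a. \<Sum>j<cop b. etensor [Inr (mul (hl a i) (hl b j)), Inr (mul (hr a i) (hr b j))])"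
proof -
  have "\<Delta> \<circ> \<mu> \<doteq>\<^bsub>[FH, FH]\<^esub> (\<mu> \<otimes>\<^bsub>2\<^esub> \<mu>) \<circ> (id \<otimes>\<^bsub>1\<^esub> flip 1 \<otimes>\<^bsub>2\<^esub> id) \<circ> (\<Delta> \<otimes>\<^bsub>1\<^esub> \<Delta>)"
    using bialg by (simp add: bialgebra_def)
  from map_eqD[OF this, of "[Inr a, Inr b]"]
  have "\<Delta> (etensor [Inr (mul a b)]) =
      ((\<mu> \<otimes>\<^bsub>2\<^esub> \<mu>) \<circ> (id \<otimes>\<^bsub>1\<^esub> flip 1 \<otimes>\<^bsub>2\<^esub> id) \<circ> (\<Delta> \<otimes>\<^bsub>1\<^esub> \<Delta>)) (etensor [Inr a, Inr b])"
    by (simp add: mul)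
  also have "\<dots> = (\<Sum>i<cop a. \<Sum>j<cop b. etensor [Inr (mul (hl a i) (hl b j)), Inr (mul (hr a i) (hr b j))])"
    by (simp add: ev cop)
  finally show ?thesis .
qed

lemma mul_one: "mul a one = a"
proof -
  have "\<mu> \<circ> (id \<otimes>\<^bsub>1\<^esub> \<nu>) \<doteq>\<^bsub>[FH]\<^esub> id"
    using bialg by (simp add: bialgebra_def)
  from map_eqD[OF this, of "[Inr a]"] show ?thesis
    by (simp add: ev etensor_H_inj)
qed

lemma eps_mul: "eps (mul a b) = eps a * eps b"
proof -
  have "\<epsilon> \<circ> \<mu> \<doteq>\<^bsub>[FH, FH]\<^esub> \<epsilon> \<otimes>\<^bsub>1\<^esub> \<epsilon>"
    using bialg by (simp add: bialgebra_def)
  from map_eqD[OF this, of "[Inr a, Inr b]"]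
  have "tscale (eps (mul a b)) (etensor []) = (tscale (eps a * eps b) (etensor []) :: ('k, 'm, 'h) tensor)"
    by (simp add: ev mult.commute)
  then show ?thesis
    using bij_betw_etensor_unit by (auto simp: bij_betw_def inj_on_def)
qed

lemma coassoc: "(\<Delta> \<otimes>\<^bsub>1\<^esub> id) (\<Delta> (etensor [Inr a])) = (id \<otimes>\<^bsub>1\<^esub> \<Delta>) (\<Delta> (etensor [Inr a]))"
  and counit_left: "(\<epsilon> \<otimes>\<^bsub>1\<^esub> id) (\<Delta> (etensor [Inr a])) = etensor [Inr a]"
  and counit_right: "(id \<otimes>\<^bsub>1\<^esub> \<epsilon>) (\<Delta> (etensor [Inr a])) = etensor [Inr a]"
  using bialg map_eqD[of _ "[FH]" _ "[Inr a]"] by (force simp: bialgebra_def)+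

end

text \<open>
  The analogous coordinates for a Hopf bimodule \<open>N\<close>: \<open>al\<close> lists the summands of the left
  action, \<open>rn\<close> and \<open>rh\<close> the components in \<open>N\<close> and \<open>H\<close> of the right coaction, \<open>lh\<close> and \<open>ln\<close> those of the
  left coaction, and \<open>act\<close>, \<open>rc\<close>, \<open>lc\<close> the numbers of summands. Elements of \<open>N\<close> enter as lists of vectors,
  because elementary tensors span its space.
\<close>

locale sweedler_hopf_bimodule = sweedler_bialgebra sM sH \<mu> \<nu> \<Delta> \<epsilon> mul one eps cop hl hr
  for sM :: "'k::field \<Rightarrow> 'm::ab_group_add \<Rightarrow> 'm"
  and sH :: "'k \<Rightarrow> 'h::ab_group_add \<Rightarrow> 'h"
  and \<mu> \<nu> \<Delta> \<epsilon> mul one eps cop hl hr +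
  fixes N :: "factor list"
    and \<rho> lam \<delta> \<gamma> :: "('k, 'm, 'h) tensor \<Rightarrow> ('k, 'm, 'h) tensor"
    and act :: "'h \<Rightarrow> ('m + 'h) list \<Rightarrow> nat" and al :: "'h \<Rightarrow> ('m + 'h) list \<Rightarrow> nat \<Rightarrow> ('m + 'h) list"
    and rc :: "('m + 'h) list \<Rightarrow> nat" and rn :: "('m + 'h) list \<Rightarrow> nat \<Rightarrow> ('m + 'h) list"
    and rh :: "('m + 'h) list \<Rightarrow> nat \<Rightarrow> 'h"
    and lc :: "('m + 'h) list \<Rightarrow> nat" and lh :: "('m + 'h) list \<Rightarrow> nat \<Rightarrow> 'h"
    and ln :: "('m + 'h) list \<Rightarrow> nat \<Rightarrow> ('m + 'h) list"
  assumes hopf: "hopf_bimodule \<mu> \<nu> \<Delta> \<epsilon> N \<rho> lam \<delta> \<gamma>"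
    and totalN [simp]: "total_linear \<rho>" "total_linear lam" "total_linear \<delta>" "total_linear \<gamma>"
    and act: "map factor_of ns = N \<Longrightarrow>
      lam (etensor (Inr a # ns)) = (\<Sum>i<act a ns. etensor (al a ns i))"
    and rco: "map factor_of ns = N \<Longrightarrow>
      \<delta> (etensor ns) = (\<Sum>i<rc ns. etensor (rn ns i @ [Inr (rh ns i)]))"
    and lco: "map factor_of ns = N \<Longrightarrow>
      \<gamma> (etensor ns) = (\<Sum>i<lc ns. etensor (Inr (lh ns i) # ln ns i))"
    and shapes [simp]: "map factor_of (al a ns i) = N" "map factor_of (rn ns i) = N"
      "map factor_of (ln ns i) = N"
begin

lemma lengths [simp]: "length (al a ns i) = length N" "length (rn ns i) = length N"
  "length (ln ns i) = length N"
  by (metis length_map shapes)+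

lemmas total_sumsN = totalN[THEN total_linear_sum] totalN[THEN total_linear_scale]
lemmas evN = ev total_sumsN act rco lco

lemmas hopf_eqs = hopf[unfolded hopf_bimodule_def bimodule_def bicomodule_def]

lemma length_N: "map factor_of ns = N \<Longrightarrow> length ns = length N"
  by (metis length_map)

abbreviation "right_coaction \<equiv> diag_right \<mu> \<Delta> N \<delta>"
abbreviation "left_coaction \<equiv> diag_left \<mu> \<Delta> N \<gamma>"

lemma total_diag [simp]: "total_linear right_coaction" "total_linear left_coaction"
  by (simp_all add: diag_right_def diag_left_def)

lemmas total_sumsD = total_diag[THEN total_linear_sum] total_diag[THEN total_linear_scale]

lemma diag_right: "map factor_of ns = N \<Longrightarrow> right_coaction (etensor (ns @ [Inr a])) =
  (\<Sum>i<rc ns. \<Sum>j<cop a. etensor (rn ns i @ [Inr (hl a j), Inr (mul (rh ns i) (hr a j))]))"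
  by (simp add: diag_right_def evN cop length_N)

lemma diag_left: "map factor_of ns = N \<Longrightarrow> left_coaction (etensor (ns @ [Inr a])) =
  (\<Sum>i<lc ns. \<Sum>j<cop a. etensor (Inr (mul (lh ns i) (hl a j)) # ln ns i @ [Inr (hr a j)]))"
  by (simp add: diag_left_def evN cop length_N)

lemma shape_snoc:
  assumes "map factor_of zs = N @ [FH]"
  obtains ns a where "zs = ns @ [Inr a]" "map factor_of ns = N"
  using assms by (auto simp: shape_conv)

section \<open>The Hopf bimodule on the tensor product with H\<close>

text \<open>
  The left axioms hold because the left action leaves the last factor alone: they are those of \<open>N\<close>,
  juxtaposed with that factor.
\<close>

lemma bimodule_tensor_H:
  "bimodule \<mu> \<nu> (N @ [FH]) (id \<otimes>\<^bsub>length N\<^esub> \<mu>) (lam \<otimes>\<^bsub>length N + 1\<^esub> id)"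
proof -
  let ?\<rho> = "id \<otimes>\<^bsub>length N\<^esub> \<mu>" and ?lam = "lam \<otimes>\<^bsub>length N + 1\<^esub> id"
  have hom: "?\<rho> \<in> tensor_hom ((N @ [FH]) @ [FH]) (N @ [FH])" "?lam \<in> tensor_hom (FH # N @ [FH]) (N @ [FH])"
    using tensor_map_in_hom[OF same_hom_id[of N, unfolded same_hom_def, THEN conjunct1], of \<mu> "[FH, FH]" "[FH]"]
      tensor_map_in_hom[OF _ same_hom_id[of "[FH]", unfolded same_hom_def, THEN conjunct1], of lam "FH # N" N]
      bialg hopf_eqs by (simp_all add: bialgebra_def)
  have "?\<rho> \<circ> (?\<rho> \<otimes>\<^bsub>length (N @ [FH]) + 1\<^esub> id) \<doteq>\<^bsub>(N @ [FH]) @ [FH, FH]\<^esub> ?\<rho> \<circ> (id \<otimes>\<^bsub>length (N @ [FH])\<^esub> \<mu>)"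
  proof (rule total_eqI)
    fix xs :: "('m + 'h) list" assume "map factor_of xs = (N @ [FH]) @ [FH, FH]"
    then obtain ns a b c where xs: "xs = ns @ [Inr a, Inr b, Inr c]" and ns: "map factor_of ns = N"
      by (auto simp: shape_conv)
    show "(?\<rho> \<circ> (?\<rho> \<otimes>\<^bsub>length (N @ [FH]) + 1\<^esub> id)) (etensor xs) = (?\<rho> \<circ> (id \<otimes>\<^bsub>length (N @ [FH])\<^esub> \<mu>)) (etensor xs)"
      by (simp add: xs ns evN mul_assoc length_N)
  qed simp_all
  moreover have "?\<rho> \<circ> (id \<otimes>\<^bsub>length (N @ [FH])\<^esub> \<nu>) \<doteq>\<^bsub>N @ [FH]\<^esub> id"
  proof (rule total_eqI)
    fix xs :: "('m + 'h) list" assume "map factor_of xs = N @ [FH]"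
    then obtain ns a where xs: "xs = ns @ [Inr a]" and ns: "map factor_of ns = N"
      by (auto simp: shape_conv)
    show "(?\<rho> \<circ> (id \<otimes>\<^bsub>length (N @ [FH])\<^esub> \<nu>)) (etensor xs) = id (etensor xs)"
      by (simp add: xs ns evN mul_one length_N)
  qed simp_all
  moreover have "?lam \<circ> (id \<otimes>\<^bsub>1\<^esub> ?lam) \<doteq>\<^bsub>[FH, FH] @ N @ [FH]\<^esub> ?lam \<circ> (\<mu> \<otimes>\<^bsub>2\<^esub> id)"
  proof (rule total_eqI)
    fix xs :: "('m + 'h) list" assume "map factor_of xs = [FH, FH] @ N @ [FH]"
    then obtain a b ns c where xs: "xs = Inr a # Inr b # ns @ [Inr c]" and ns: "map factor_of ns = N"
      by (auto simp: shape_conv)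
    have "lam \<circ> (id \<otimes>\<^bsub>1\<^esub> lam) \<doteq>\<^bsub>[FH, FH] @ N\<^esub> lam \<circ> (\<mu> \<otimes>\<^bsub>2\<^esub> id)"
      using hopf_eqs by simp
    from arg_cong[OF map_eqD[OF this, of "Inr a # Inr b # ns"], of "\<lambda>t. juxt t (etensor [Inr c])"]
    show "(?lam \<circ> (id \<otimes>\<^bsub>1\<^esub> ?lam)) (etensor xs) = (?lam \<circ> (\<mu> \<otimes>\<^bsub>2\<^esub> id)) (etensor xs)"
      by (simp add: xs ns evN length_N)
  qed simp_all
  moreover have "?lam \<circ> (\<nu> \<otimes>\<^bsub>0\<^esub> id) \<doteq>\<^bsub>N @ [FH]\<^esub> id"
  proof (rule total_eqI)
    fix xs :: "('m + 'h) list" assume "map factor_of xs = N @ [FH]"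
    then obtain ns c where xs: "xs = ns @ [Inr c]" and ns: "map factor_of ns = N"
      by (rule shape_snoc)
    have "lam \<circ> (\<nu> \<otimes>\<^bsub>0\<^esub> id) \<doteq>\<^bsub>N\<^esub> id"
      using hopf_eqs by simp
    from arg_cong[OF map_eqD[OF this ns], of "\<lambda>t. juxt t (etensor [Inr c])"]
    show "(?lam \<circ> (\<nu> \<otimes>\<^bsub>0\<^esub> id)) (etensor xs) = id (etensor xs)"
      by (simp add: xs ns evN length_N)
  qed simp_all
  moreover have "?\<rho> \<circ> (?lam \<otimes>\<^bsub>1 + length (N @ [FH])\<^esub> id) \<doteq>\<^bsub>FH # (N @ [FH]) @ [FH]\<^esub> ?lam \<circ> (id \<otimes>\<^bsub>1\<^esub> ?\<rho>)"
  proof (rule total_eqI)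
    fix xs :: "('m + 'h) list" assume "map factor_of xs = FH # (N @ [FH]) @ [FH]"
    then obtain a ns b c where xs: "xs = Inr a # ns @ [Inr b, Inr c]" and ns: "map factor_of ns = N"
      by (auto simp: shape_conv)
    show "(?\<rho> \<circ> (?lam \<otimes>\<^bsub>1 + length (N @ [FH])\<^esub> id)) (etensor xs) = (?lam \<circ> (id \<otimes>\<^bsub>1\<^esub> ?\<rho>)) (etensor xs)"
      by (simp add: xs ns evN  length_N)
  qed simp_all
  ultimately show ?thesis using hom unfolding bimodule_def by blast
qed

text \<open>
  Multiplication of an iterated coaction on \<open>N\<close> with an iterated coproduct on \<open>H\<close>, the factors of \<open>H\<close>
  being matched in order:
  \<open>interleave_right\<close> maps \<open>n a a' b c c'\<close> to \<open>n \<otimes> b \<otimes> a c \<otimes> a' c'\<close>,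
  \<open>interleave_left\<close> maps \<open>a a' n b b' c\<close> to \<open>a b \<otimes> a' b' \<otimes> n \<otimes> c\<close>, and
  \<open>interleave_mixed\<close> maps \<open>a n a' b c b'\<close> to \<open>a b \<otimes> n \<otimes> c \<otimes> a' b'\<close>.
  Both sides of each coaction axiom for \<open>N \<otimes> H\<close> are images, under one of these maps, of the two sides
  of the corresponding axioms for \<open>N\<close> and \<open>H\<close>.
\<close>

definition "interleave_right = (id \<otimes>\<^bsub>length N + 1\<^esub> \<mu> \<otimes>\<^bsub>2\<^esub> \<mu>) \<circ> (id \<otimes>\<^bsub>length N + 2\<^esub> flip 1 \<otimes>\<^bsub>2\<^esub> id) \<circ>
  (id \<otimes>\<^bsub>length N\<^esub> flip 2 \<otimes>\<^bsub>3\<^esub> id)"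
definition "interleave_left = (\<mu> \<otimes>\<^bsub>2\<^esub> \<mu> \<otimes>\<^bsub>2\<^esub> id) \<circ> (id \<otimes>\<^bsub>3\<^esub> flip (length N) \<otimes>\<^bsub>length N + 1\<^esub> id) \<circ>
  (id \<otimes>\<^bsub>1\<^esub> flip (length N + 1) \<otimes>\<^bsub>length N + 2\<^esub> id)"
definition "interleave_mixed = (\<mu> \<otimes>\<^bsub>2\<^esub> id \<otimes>\<^bsub>length N + 1\<^esub> \<mu>) \<circ> (id \<otimes>\<^bsub>length N + 2\<^esub> flip 1 \<otimes>\<^bsub>2\<^esub> id) \<circ>
  (id \<otimes>\<^bsub>1\<^esub> flip (length N + 1) \<otimes>\<^bsub>length N + 2\<^esub> id)"

text \<open>
  Applying \<open>\<Delta>\<close> to the last factor \<open>n\<^sub>1 h\<^sub>2\<close> and using that \<open>\<Delta>\<close> is multiplicative turns the right-hand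
  side into an interleaving as well. The two expansions list their sums in different orders; the sums
  over the terms of \<open>h\<close> and over those of the iterated coaction of \<open>n\<close> are exchanged at the end.
\<close>

lemma coassoc_diag_right:
  assumes ns: "map factor_of ns = N"
  shows "(right_coaction \<otimes>\<^bsub>length N + 1\<^esub> id) (right_coaction (etensor (ns @ [Inr a]))) =
   (id \<otimes>\<^bsub>length N + 1\<^esub> \<Delta>) (right_coaction (etensor (ns @ [Inr a])))"
proof -
  have "(right_coaction \<otimes>\<^bsub>length N + 1\<^esub> id) (right_coaction (etensor (ns @ [Inr a]))) =
   interleave_right (juxt ((\<delta> \<otimes>\<^bsub>length N\<^esub> id) (\<delta> (etensor ns))) ((\<Delta> \<otimes>\<^bsub>1\<^esub> id) (\<Delta> (etensor [Inr a]))))"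
    by (simp add: diag_right ns evN cop interleave_right_def total_sumsD, rule sum.cong[OF refl], rule sum.swap)
  also have "(\<delta> \<otimes>\<^bsub>length N\<^esub> id) (\<delta> (etensor ns)) = (id \<otimes>\<^bsub>length N\<^esub> \<Delta>) (\<delta> (etensor ns))"
    using hopf_eqs map_eqD[of _ N _ ns] ns by force
  also have "interleave_right (juxt \<dots> ((\<Delta> \<otimes>\<^bsub>1\<^esub> id) (\<Delta> (etensor [Inr a])))) = 
    (id \<otimes>\<^bsub>length N + 1\<^esub> \<Delta>) (right_coaction (etensor (ns @ [Inr a])))"
    unfolding coassoc
    by (simp add: diag_right ns evN cop_mul, simp add: evN cop interleave_right_def, rule sum.cong[OF refl], rule sum.swap)
  finally show ?thesis .
qed

lemma coassoc_diag_left: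
  assumes ns: "map factor_of ns = N"
  shows "(id \<otimes>\<^bsub>1\<^esub> left_coaction) (left_coaction (etensor (ns @ [Inr a]))) =
   (\<Delta> \<otimes>\<^bsub>1\<^esub> id) (left_coaction (etensor (ns @ [Inr a])))"
proof -
  have "(id \<otimes>\<^bsub>1\<^esub> left_coaction) (left_coaction (etensor (ns @ [Inr a]))) =
   interleave_left (juxt ((id \<otimes>\<^bsub>1\<^esub> \<gamma>) (\<gamma> (etensor ns))) ((id \<otimes>\<^bsub>1\<^esub> \<Delta>) (\<Delta> (etensor [Inr a]))))"
    by (simp add: diag_left ns evN cop interleave_left_def total_sumsD, rule sum.cong[OF refl], rule sum.swap)
  also have "(id \<otimes>\<^bsub>1\<^esub> \<gamma>) (\<gamma> (etensor ns)) = (\<Delta> \<otimes>\<^bsub>1\<^esub> id) (\<gamma> (etensor ns))"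
    using hopf_eqs map_eqD[of _ N _ ns] ns by force
  also have "interleave_left (juxt \<dots> ((id \<otimes>\<^bsub>1\<^esub> \<Delta>) (\<Delta> (etensor [Inr a])))) = 
    (\<Delta> \<otimes>\<^bsub>1\<^esub> id) (left_coaction (etensor (ns @ [Inr a])))"
    unfolding coassoc[symmetric]
    by (simp add: diag_left ns evN cop_mul, simp add: evN cop interleave_left_def, rule sum.cong[OF refl], rule sum.swap)
  finally show ?thesis .
qed

lemma diag_compat:
  assumes ns: "map factor_of ns = N"
  shows "(left_coaction \<otimes>\<^bsub>length N + 1\<^esub> id) (right_coaction (etensor (ns @ [Inr a]))) =
   (id \<otimes>\<^bsub>1\<^esub> right_coaction) (left_coaction (etensor (ns @ [Inr a])))"
proof -
  have "(left_coaction \<otimes>\<^bsub>length N + 1\<^esub> id) (right_coaction (etensor (ns @ [Inr a]))) =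
   interleave_mixed (juxt ((\<gamma> \<otimes>\<^bsub>length N\<^esub> id) (\<delta> (etensor ns))) ((\<Delta> \<otimes>\<^bsub>1\<^esub> id) (\<Delta> (etensor [Inr a]))))"
    by (simp add: diag_left diag_right ns evN cop interleave_mixed_def total_sumsD, rule sum.cong[OF refl], rule sum.swap)
  also have "(\<gamma> \<otimes>\<^bsub>length N\<^esub> id) (\<delta> (etensor ns)) = (id \<otimes>\<^bsub>1\<^esub> \<delta>) (\<gamma> (etensor ns))"
    using hopf_eqs map_eqD[of _ N _ ns] ns by force
  also have "interleave_mixed (juxt \<dots> ((\<Delta> \<otimes>\<^bsub>1\<^esub> id) (\<Delta> (etensor [Inr a])))) = 
    (id \<otimes>\<^bsub>1\<^esub> right_coaction) (left_coaction (etensor (ns @ [Inr a])))"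
    unfolding coassoc
    by (simp add: diag_left diag_right ns evN cop interleave_mixed_def total_sumsD, rule sum.cong[OF refl], rule sum.swap)
  finally show ?thesis .
qed

lemma counit_diag_right:
  assumes ns: "map factor_of ns = N"
  shows "(id \<otimes>\<^bsub>length N + 1\<^esub> \<epsilon>) (right_coaction (etensor (ns @ [Inr a]))) = etensor (ns @ [Inr a])"
proof -
  have "(id \<otimes>\<^bsub>length N + 1\<^esub> \<epsilon>) (right_coaction (etensor (ns @ [Inr a]))) =
    juxt ((id \<otimes>\<^bsub>length N\<^esub> \<epsilon>) (\<delta> (etensor ns))) ((id \<otimes>\<^bsub>1\<^esub> \<epsilon>) (\<Delta> (etensor [Inr a])))"
    by (simp add: diag_right ns evN cop total_sumsD eps_mul mult.commute)
  also have "(id \<otimes>\<^bsub>length N\<^esub> \<epsilon>) (\<delta> (etensor ns)) = etensor ns"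
    using hopf_eqs map_eqD[of _ N _ ns] ns by force
  finally show ?thesis unfolding counit_right juxt_etensor .
qed

lemma counit_diag_left:
  assumes ns: "map factor_of ns = N"
  shows "(\<epsilon> \<otimes>\<^bsub>1\<^esub> id) (left_coaction (etensor (ns @ [Inr a]))) = etensor (ns @ [Inr a])"
proof -
  have "(\<epsilon> \<otimes>\<^bsub>1\<^esub> id) (left_coaction (etensor (ns @ [Inr a]))) =
    juxt ((\<epsilon> \<otimes>\<^bsub>1\<^esub> id) (\<gamma> (etensor ns))) ((\<epsilon> \<otimes>\<^bsub>1\<^esub> id) (\<Delta> (etensor [Inr a])))"
    by (simp add: diag_left ns evN cop total_sumsD eps_mul mult.commute)
  also have "(\<epsilon> \<otimes>\<^bsub>1\<^esub> id) (\<gamma> (etensor ns)) = etensor ns"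
    using hopf_eqs map_eqD[of _ N _ ns] ns by force
  finally show ?thesis unfolding counit_left juxt_etensor .
qed

lemma diag_in_hom: "right_coaction \<in> tensor_hom (N @ [FH]) ((N @ [FH]) @ [FH])"
  "left_coaction \<in> tensor_hom (N @ [FH]) (FH # N @ [FH])"
proof -
  have "right_coaction (etensor xs) \<in> tensor_space ((N @ [FH]) @ [FH])"
    "left_coaction (etensor xs) \<in> tensor_space (FH # N @ [FH])"
    if "map factor_of xs = N @ [FH]" for xs
    using that
    by (rule shape_snoc; simp add: diag_right diag_left etensor_in_tensor_space)+
  then show "right_coaction \<in> tensor_hom (N @ [FH]) ((N @ [FH]) @ [FH])"
    "left_coaction \<in> tensor_hom (N @ [FH]) (FH # N @ [FH])"
    by (simp_all add: tensor_homI)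
qed

lemma bicomodule_tensor_H: "bicomodule \<Delta> \<epsilon> (N @ [FH]) right_coaction left_coaction"
  unfolding bicomodule_def
  by (intro conjI diag_in_hom total_eqI;
      (elim shape_snoc)?, simp add: coassoc_diag_right[simplified] coassoc_diag_left[simplified]
        diag_compat[simplified] counit_diag_right[simplified] counit_diag_left[simplified])

abbreviation "rmul \<equiv> id \<otimes>\<^bsub>length N\<^esub> \<mu>"
abbreviation "lmul \<equiv> lam \<otimes>\<^bsub>length N + 1\<^esub> id"

text \<open>
  The right action changes the last factor \<open>h\<close> only, and the claim is the multiplicativity of \<open>\<Delta>\<close> there,
  followed by associativity in the coacting copy of \<open>H\<close>.
\<close>

lemma diag_right_rho:
  "right_coaction \<circ> rmul \<doteq>\<^bsub>(N @ [FH]) @ [FH]\<^esub>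
     (rmul \<otimes>\<^bsub>length (N @ [FH]) + 1\<^esub> \<mu>) \<circ> (id \<otimes>\<^bsub>length (N @ [FH])\<^esub> flip 1 \<otimes>\<^bsub>2\<^esub> id) \<circ>
     (right_coaction \<otimes>\<^bsub>length (N @ [FH])\<^esub> \<Delta>)" (is "_ \<doteq>\<^bsub>_\<^esub> ?R")
proof (rule total_eqI)
  fix xs :: "('m + 'h) list" assume "map factor_of xs = (N @ [FH]) @ [FH]"
  then obtain ns a b where xs: "xs = ns @ [Inr a, Inr b]" and ns: "map factor_of ns = N"
    by (auto simp: shape_conv)
  have "?R (etensor xs) = (\<Sum>i<rc ns. \<Sum>j<cop a. \<Sum>k<cop b.
      etensor (rn ns i @ [Inr (mul (hl a j) (hl b k)), Inr (mul (rh ns i) (mul (hr a j) (hr b k)))]))"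
    using diag_right[OF ns, of a] by (simp add: xs ns evN cop mul_assoc length_N)
  also have "\<dots> = right_coaction (etensor (ns @ [Inr (mul a b)]))"
    by (simp add: diag_right_def ns evN cop_mul length_N)
  finally show "(right_coaction \<circ> rmul) (etensor xs) = ?R (etensor xs)"
    by (simp add: xs ns evN length_N)
qed simp_all

lemma diag_left_rho:
  "left_coaction \<circ> rmul \<doteq>\<^bsub>(N @ [FH]) @ [FH]\<^esub>
     (\<mu> \<otimes>\<^bsub>2\<^esub> rmul) \<circ> (id \<otimes>\<^bsub>1\<^esub> flip (length (N @ [FH])) \<otimes>\<^bsub>length (N @ [FH]) + 1\<^esub> id) \<circ>
     (left_coaction \<otimes>\<^bsub>length (N @ [FH])\<^esub> \<Delta>)" (is "_ \<doteq>\<^bsub>_\<^esub> ?R")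
proof (rule total_eqI)
  fix xs :: "('m + 'h) list" assume "map factor_of xs = (N @ [FH]) @ [FH]"
  then obtain ns a b where xs: "xs = ns @ [Inr a, Inr b]" and ns: "map factor_of ns = N"
    by (auto simp: shape_conv)
  have "?R (etensor xs) = (\<Sum>i<lc ns. \<Sum>j<cop a. \<Sum>k<cop b.
      etensor (Inr (mul (lh ns i) (mul (hl a j) (hl b k))) # ln ns i @ [Inr (mul (hr a j) (hr b k))]))"
    using diag_left[OF ns, of a] by (simp add: xs ns evN cop mul_assoc length_N)
  also have "\<dots> = left_coaction (etensor (ns @ [Inr (mul a b)]))"
    by (simp add: diag_left_def ns evN cop_mul length_N)
  finally show "(left_coaction \<circ> rmul) (etensor xs) = ?R (etensor xs)"
    by (simp add: xs ns evN length_N)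
qed simp_all

text \<open>
  Here the left action changes \<open>n\<close> only: the claim is the corresponding axiom for \<open>N\<close>, transported by
  the map \<open>?D\<close> through which the diagonal coaction factors.
\<close>

lemma diag_right_lambda:
  "right_coaction \<circ> lmul \<doteq>\<^bsub>FH # N @ [FH]\<^esub>
     (lmul \<otimes>\<^bsub>1 + length (N @ [FH])\<^esub> \<mu>) \<circ> (id \<otimes>\<^bsub>1\<^esub> flip 1 \<otimes>\<^bsub>1 + length (N @ [FH])\<^esub> id) \<circ>
     (\<Delta> \<otimes>\<^bsub>1\<^esub> right_coaction)" (is "_ \<doteq>\<^bsub>_\<^esub> ?R")
proof (rule total_eqI)
  fix xs :: "('m + 'h) list" assume "map factor_of xs = FH # N @ [FH]"
  then obtain g ns a where xs: "xs = Inr g # ns @ [Inr a]" and ns: "map factor_of ns = N"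
    by (auto simp: shape_conv)
  let ?D = "(id \<otimes>\<^bsub>length N + 1\<^esub> \<mu>) \<circ> (id \<otimes>\<^bsub>length N\<^esub> flip 1 \<otimes>\<^bsub>2\<^esub> id)"
  have "(right_coaction \<circ> lmul) (etensor xs) = ?D (juxt (\<delta> (lam (etensor (Inr g # ns)))) (\<Delta> (etensor [Inr a])))"
    by (simp add: diag_right_def xs ns evN cop length_N)
  also have "\<delta> \<circ> lam \<doteq>\<^bsub>FH # N\<^esub>
        (lam \<otimes>\<^bsub>1 + length N\<^esub> \<mu>) \<circ> (id \<otimes>\<^bsub>1\<^esub> flip 1 \<otimes>\<^bsub>1 + length N\<^esub> id) \<circ> (\<Delta> \<otimes>\<^bsub>1\<^esub> \<delta>)"
    using hopf_eqs by simp
  from map_eqD[OF this, of "Inr g # ns"] have "\<delta> (lam (etensor (Inr g # ns))) =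
      (lam \<otimes>\<^bsub>1 + length N\<^esub> \<mu>) ((id \<otimes>\<^bsub>1\<^esub> flip 1 \<otimes>\<^bsub>1 + length N\<^esub> id) ((\<Delta> \<otimes>\<^bsub>1\<^esub> \<delta>) (etensor (Inr g # ns))))"
    using ns by simp
  also have "?D (juxt \<dots> (\<Delta> (etensor [Inr a]))) = ?R (etensor xs)"
    by (simp add: xs ns evN cop mul_assoc length_N diag_right,
        rule sum.cong[OF refl], rule sum.cong[OF refl], rule sum.swap)
  finally show "(right_coaction \<circ> lmul) (etensor xs) = ?R (etensor xs)" .
qed simp_all

lemma diag_left_lambda:
  "left_coaction \<circ> lmul \<doteq>\<^bsub>FH # N @ [FH]\<^esub>
     (\<mu> \<otimes>\<^bsub>2\<^esub> lmul) \<circ> (id \<otimes>\<^bsub>1\<^esub> flip 1 \<otimes>\<^bsub>2\<^esub> id) \<circ> (\<Delta> \<otimes>\<^bsub>1\<^esub> left_coaction)" (is "_ \<doteq>\<^bsub>_\<^esub> ?R")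
proof (rule total_eqI)
  fix xs :: "('m + 'h) list" assume "map factor_of xs = FH # N @ [FH]"
  then obtain g ns a where xs: "xs = Inr g # ns @ [Inr a]" and ns: "map factor_of ns = N"
    by (auto simp: shape_conv)
  let ?D = "(\<mu> \<otimes>\<^bsub>2\<^esub> id) \<circ> (id \<otimes>\<^bsub>1\<^esub> flip (length N) \<otimes>\<^bsub>length N + 1\<^esub> id)"
  have "(left_coaction \<circ> lmul) (etensor xs) = ?D (juxt (\<gamma> (lam (etensor (Inr g # ns)))) (\<Delta> (etensor [Inr a])))"
    by (simp add: diag_left_def xs ns evN cop length_N)
  also have "\<gamma> \<circ> lam \<doteq>\<^bsub>FH # N\<^esub>
        (\<mu> \<otimes>\<^bsub>2\<^esub> lam) \<circ> (id \<otimes>\<^bsub>1\<^esub> flip 1 \<otimes>\<^bsub>2\<^esub> id) \<circ> (\<Delta> \<otimes>\<^bsub>1\<^esub> \<gamma>)"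
    using hopf_eqs by simp
  from map_eqD[OF this, of "Inr g # ns"] have "\<gamma> (lam (etensor (Inr g # ns))) =
      (\<mu> \<otimes>\<^bsub>2\<^esub> lam) ((id \<otimes>\<^bsub>1\<^esub> flip 1 \<otimes>\<^bsub>2\<^esub> id) ((\<Delta> \<otimes>\<^bsub>1\<^esub> \<gamma>) (etensor (Inr g # ns))))"
    using ns by simp
  also have "?D (juxt \<dots> (\<Delta> (etensor [Inr a]))) = ?R (etensor xs)"
    by (simp add: xs ns evN cop mul_assoc length_N diag_left,
        rule sum.cong[OF refl], rule sum.cong[OF refl], rule sum.swap)
  finally show "(left_coaction \<circ> lmul) (etensor xs) = ?R (etensor xs)" .
qed simp_all

lemma hopf_bimodule_tensor_H:
  "hopf_bimodule \<mu> \<nu> \<Delta> \<epsilon> (N @ [FH]) rmul lmul right_coaction left_coaction"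
  unfolding hopf_bimodule_def
  using bimodule_tensor_H bicomodule_tensor_H diag_right_rho diag_left_rho diag_right_lambda diag_left_lambda
  by blast

section \<open>Morphisms between tensor products with H\<close>

text \<open>
  Associativity of \<open>\<rho>\<close>, commutation of the two actions and the two axioms for \<open>\<delta> \<circ> \<rho>\<close> and \<open>\<gamma> \<circ> \<rho>\<close> are
  the four conditions on a morphism. The diagonal coactions have been defined by the right-hand
  sides of the latter, except that \<open>\<rho>\<close> is not yet applied.
\<close>

lemma rho_hom: "hopf_bimodule_hom (N @ [FH]) rmul lmul right_coaction left_coaction N \<rho> lam \<delta> \<gamma> \<rho>"
proof -
  have "\<delta> \<circ> \<rho> \<doteq>\<^bsub>N @ [FH]\<^esub> (\<rho> \<otimes>\<^bsub>length (N @ [FH])\<^esub> id) \<circ> right_coaction"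
  proof (rule total_eqI)
    fix xs :: "('m + 'h) list" assume "map factor_of xs = N @ [FH]"
    then obtain ns a where xs: "xs = ns @ [Inr a]" and ns: "map factor_of ns = N"
      by (rule shape_snoc)
    have "\<delta> \<circ> \<rho> \<doteq>\<^bsub>N @ [FH]\<^esub>
        (\<rho> \<otimes>\<^bsub>length N + 1\<^esub> \<mu>) \<circ> (id \<otimes>\<^bsub>length N\<^esub> flip 1 \<otimes>\<^bsub>2\<^esub> id) \<circ> (\<delta> \<otimes>\<^bsub>length N\<^esub> \<Delta>)"
      using hopf_eqs by simp
    from map_eqD[OF this, of xs]
    show "(\<delta> \<circ> \<rho>) (etensor xs) = ((\<rho> \<otimes>\<^bsub>length (N @ [FH])\<^esub> id) \<circ> right_coaction) (etensor xs)"
      by (simp add: xs ns evN cop length_N diag_right)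
  qed simp_all
  moreover have "\<gamma> \<circ> \<rho> \<doteq>\<^bsub>N @ [FH]\<^esub> (id \<otimes>\<^bsub>1\<^esub> \<rho>) \<circ> left_coaction"
  proof (rule total_eqI)
    fix xs :: "('m + 'h) list" assume "map factor_of xs = N @ [FH]"
    then obtain ns a where xs: "xs = ns @ [Inr a]" and ns: "map factor_of ns = N"
      by (rule shape_snoc)
    have "\<gamma> \<circ> \<rho> \<doteq>\<^bsub>N @ [FH]\<^esub>
        (\<mu> \<otimes>\<^bsub>2\<^esub> \<rho>) \<circ> (id \<otimes>\<^bsub>1\<^esub> flip (length N) \<otimes>\<^bsub>length N + 1\<^esub> id) \<circ> (\<gamma> \<otimes>\<^bsub>length N\<^esub> \<Delta>)"
      using hopf_eqs by simp
    from map_eqD[OF this, of xs]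
    show "(\<gamma> \<circ> \<rho>) (etensor xs) = ((id \<otimes>\<^bsub>1\<^esub> \<rho>) \<circ> left_coaction) (etensor xs)"
      by (simp add: xs ns evN cop length_N diag_left)
  qed simp_all
  ultimately show ?thesis
    unfolding hopf_bimodule_hom_def using hopf_eqs by (simp add: map_eq_def)
qed

text \<open>
  For the coactions, \<open>f\<close> is moved past the coaction on \<open>N\<close>; the rest of the diagonal coaction (the
  map \<open>?D\<close>) does not change the factor to which \<open>f\<close> is applied.
\<close>

lemma hom_tensor_H:
  assumes f: "hopf_bimodule_hom N \<rho> lam \<delta> \<gamma> P \<rho>1 lam1 \<delta>1 \<gamma>1 f"
    and P: "P \<noteq> []"
    and total1 [simp]: "total_linear f" "total_linear lam1" "total_linear \<delta>1" "total_linear \<gamma>1"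
  shows "hopf_bimodule_hom (N @ [FH]) rmul lmul right_coaction left_coaction
    (P @ [FH]) (id \<otimes>\<^bsub>length P\<^esub> \<mu>) (lam1 \<otimes>\<^bsub>length P + 1\<^esub> id) (diag_right \<mu> \<Delta> P \<delta>1) (diag_left \<mu> \<Delta> P \<gamma>1)
    (f \<otimes>\<^bsub>length N\<^esub> id)"
proof -
  note f1 = f[unfolded hopf_bimodule_hom_def]
  from f1 have fhom: "f \<in> tensor_hom N P" by simp
  from sweedler_hom[OF this P] obtain k :: "('m + 'h) list \<Rightarrow> nat" and fl
    where fl: "\<And>ns. map factor_of ns = N \<Longrightarrow> f (etensor ns) = (\<Sum>i<k ns. etensor (fl ns i))"
      and shape_fl [simp]: "\<And>ns i. map factor_of (fl ns i) = P" by blast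
  have length_fl [simp]: "length (fl ns i) = length P" for ns i
    by (metis length_map shape_fl)
  note evf = evN total1[THEN total_linear_sum] total1[THEN total_linear_scale]
  have total2 [simp]: "total_linear (diag_right \<mu> \<Delta> P \<delta>1)" "total_linear (diag_left \<mu> \<Delta> P \<gamma>1)"
    by (simp_all add: diag_right_def diag_left_def)
  have fP: "f (etensor ns) \<in> tensor_space P" if "map factor_of ns = N" for ns
    using that by (intro tensor_homD(1)[OF fhom] etensor_in_tensor_space)
  have hom: "f \<otimes>\<^bsub>length N\<^esub> id \<in> tensor_hom (N @ [FH]) (P @ [FH])"
    using tensor_map_in_hom[OF fhom same_hom_id[of "[FH]", unfolded same_hom_def, THEN conjunct1]] by simp
  have r: "(f \<otimes>\<^bsub>length N\<^esub> id) \<circ> rmul \<doteq>\<^bsub>(N @ [FH]) @ [FH]\<^esub>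
      (id \<otimes>\<^bsub>length P\<^esub> \<mu>) \<circ> ((f \<otimes>\<^bsub>length N\<^esub> id) \<otimes>\<^bsub>length (N @ [FH])\<^esub> id)" (is "?L \<doteq>\<^bsub>_\<^esub> ?R")
  proof (rule total_eqI)
    fix xs :: "('m + 'h) list" assume "map factor_of xs = (N @ [FH]) @ [FH]"
    then obtain ns a b where xs: "xs = ns @ [Inr a, Inr b]" and ns: "map factor_of ns = N"
      by (auto simp: shape_conv)
    show "?L (etensor xs) = ?R (etensor xs)"
      by (simp add: xs ns evf length_N fl)
  qed simp_all
  have l: "(f \<otimes>\<^bsub>length N\<^esub> id) \<circ> lmul \<doteq>\<^bsub>FH # N @ [FH]\<^esub>
      (lam1 \<otimes>\<^bsub>length P + 1\<^esub> id) \<circ> (id \<otimes>\<^bsub>1\<^esub> (f \<otimes>\<^bsub>length N\<^esub> id))" (is "?L \<doteq>\<^bsub>_\<^esub> ?R")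
  proof (rule total_eqI)
    fix xs :: "('m + 'h) list" assume "map factor_of xs = FH # N @ [FH]"
    then obtain g ns a where xs: "xs = Inr g # ns @ [Inr a]" and ns: "map factor_of ns = N"
      by (auto simp: shape_conv)
    have "f \<circ> lam \<doteq>\<^bsub>FH # N\<^esub> lam1 \<circ> (id \<otimes>\<^bsub>1\<^esub> f)" using f1 by simp
    from arg_cong[OF map_eqD[OF this, of "Inr g # ns"], of "\<lambda>t. juxt t (etensor [Inr a])"]
    show "?L (etensor xs) = ?R (etensor xs)"
      by (simp add: xs ns evf length_N fl)
  qed simp_all
  have dr: "diag_right \<mu> \<Delta> P \<delta>1 \<circ> (f \<otimes>\<^bsub>length N\<^esub> id) \<doteq>\<^bsub>N @ [FH]\<^esub>
      ((f \<otimes>\<^bsub>length N\<^esub> id) \<otimes>\<^bsub>length (N @ [FH])\<^esub> id) \<circ> right_coaction" (is "?L \<doteq>\<^bsub>_\<^esub> ?R")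
  proof (rule total_eqI)
    fix xs :: "('m + 'h) list" assume "map factor_of xs = N @ [FH]"
    then obtain ns a where xs: "xs = ns @ [Inr a]" and ns: "map factor_of ns = N"
      by (rule shape_snoc)
    \<comment> \<open>the diagonal coaction after the coaction of \<open>P\<close> and the coproduct have been applied\<close>
    let ?D = "(id \<otimes>\<^bsub>length P + 1\<^esub> \<mu>) \<circ> (id \<otimes>\<^bsub>length P\<^esub> flip 1 \<otimes>\<^bsub>2\<^esub> id)"
    have "?L (etensor xs) = ?D (juxt (\<delta>1 (f (etensor ns))) (\<Delta> (etensor [Inr a])))"
      by (simp add: diag_right_def xs ns tensor_map_total tensor_map_juxt[OF _ _ fP[OF ns]] length_N)
    also have "\<delta>1 \<circ> f \<doteq>\<^bsub>N\<^esub> (f \<otimes>\<^bsub>length N\<^esub> id) \<circ> \<delta>" using f1 by simp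
    from map_eqD[OF this ns] have "\<delta>1 (f (etensor ns)) = (f \<otimes>\<^bsub>length N\<^esub> id) (\<delta> (etensor ns))" by simp
    also have "?D (juxt \<dots> (\<Delta> (etensor [Inr a]))) = ?R (etensor xs)"
      by (simp add: xs ns evf length_N fl diag_right cop, rule sum.cong[OF refl], rule sum.swap)
    finally show "?L (etensor xs) = ?R (etensor xs)" .
  qed simp_all
  have dl: "diag_left \<mu> \<Delta> P \<gamma>1 \<circ> (f \<otimes>\<^bsub>length N\<^esub> id) \<doteq>\<^bsub>N @ [FH]\<^esub>
      (id \<otimes>\<^bsub>1\<^esub> (f \<otimes>\<^bsub>length N\<^esub> id)) \<circ> left_coaction" (is "?L \<doteq>\<^bsub>_\<^esub> ?R")
  proof (rule total_eqI)
    fix xs :: "('m + 'h) list" assume "map factor_of xs = N @ [FH]"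
    then obtain ns a where xs: "xs = ns @ [Inr a]" and ns: "map factor_of ns = N"
      by (rule shape_snoc)
    let ?D = "(\<mu> \<otimes>\<^bsub>2\<^esub> id) \<circ> (id \<otimes>\<^bsub>1\<^esub> flip (length P) \<otimes>\<^bsub>length P + 1\<^esub> id)"
    have "?L (etensor xs) = ?D (juxt (\<gamma>1 (f (etensor ns))) (\<Delta> (etensor [Inr a])))"
      by (simp add: diag_left_def xs ns tensor_map_total tensor_map_juxt[OF _ _ fP[OF ns]] length_N)
    also have "\<gamma>1 \<circ> f \<doteq>\<^bsub>N\<^esub> (id \<otimes>\<^bsub>1\<^esub> f) \<circ> \<gamma>" using f1 by simp
    from map_eqD[OF this ns] have "\<gamma>1 (f (etensor ns)) = (id \<otimes>\<^bsub>1\<^esub> f) (\<gamma> (etensor ns))" by simp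
    also have "?D (juxt \<dots> (\<Delta> (etensor [Inr a]))) = ?R (etensor xs)"
      by (simp add: xs ns evf length_N fl diag_left cop, rule sum.cong[OF refl], rule sum.swap)
    finally show "?L (etensor xs) = ?R (etensor xs)" .
  qed simp_all
  show ?thesis
    unfolding hopf_bimodule_hom_def using hom r l dr dl by blast
qed

end

section \<open>Unshuffling words\<close>

text \<open>
  The permutation \<open>\<omega>\<^sub>2\<^sub>k\<^sup>-\<^sup>1\<close> moves the entries at odd positions, counted from 1, in front of the
  others. On a word of odd length both \<open>odds\<close> and \<open>evens\<close> drop the last entry.
\<close>

fun odds :: "'a list \<Rightarrow> 'a list" where
  "odds (a # b # xs) = a # odds xs"
| "odds xs = []"

fun evens :: "'a list \<Rightarrow> 'a list" where
  "evens (a # b # xs) = b # evens xs"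
| "evens xs = []"

lemma length_odds [simp]: "length (odds xs) = length xs div 2"
  by (induction xs rule: odds.induct) auto

lemma length_evens [simp]: "length (evens xs) = length xs div 2"
  by (induction xs rule: evens.induct) auto

lemma odds_nth: "i < length xs div 2 \<Longrightarrow> odds xs ! i = xs ! (2 * i)"
proof (induction xs arbitrary: i rule: odds.induct)
  case (1 a b xs)
  then show ?case by (cases i) auto
qed auto

lemma evens_nth: "i < length xs div 2 \<Longrightarrow> evens xs ! i = xs ! (2 * i + 1)"
proof (induction xs arbitrary: i rule: evens.induct)
  case (1 a b xs)
  then show ?case by (cases i) auto
qed auto

lemma odds_map: "odds (map f xs) = map f (odds xs)" and evens_map: "evens (map f xs) = map f (evens xs)"
  by (induction xs rule: odds.induct) auto

lemma odds_snoc: "even (length xs) \<Longrightarrow> odds (xs @ [p, q]) = odds xs @ [p]"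
  by (induction xs rule: odds.induct) auto

lemma evens_snoc: "even (length xs) \<Longrightarrow> evens (xs @ [p, q]) = evens xs @ [q]"
  by (induction xs rule: evens.induct) auto

lemma odds_replicate [simp]: "odds (replicate (2 * n) x) = replicate n x"
  and evens_replicate [simp]: "evens (replicate (2 * n) x) = replicate n x"
  by (induction n) auto

lemma bij_omega: "bij (omega k)"
proof (rule o_bij)
  define g where "g p = (if 1 \<le> p \<and> p \<le> 2 * k then (if odd p then (p + 1) div 2 else k + p div 2) else p)" for p
  show "g \<circ> omega k = id"
    by (rule ext) (auto simp: g_def omega_def)
  show "omega k \<circ> g = id"
    by (rule ext) (auto simp: g_def omega_def elim!: oddE evenE)
qed

lemma move_inv_omega:
  assumes "length xs = 2 * k"
  shows "move (inv (omega k)) xs = odds xs @ evens xs"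
proof (rule nth_equalityI)
  show "length (move (inv (omega k)) xs) = length (odds xs @ evens xs)"
    using assms by (simp add: move_def)
  fix i assume "i < length (move (inv (omega k)) xs)"
  then have i: "i < 2 * k" using assms by (simp add: move_def del: upt_Suc)
  then have "move (inv (omega k)) xs ! i = xs ! (omega k (Suc i) - 1)"
    using assms by (simp add: move_def inv_inv_eq[OF bij_omega] del: upt_Suc)
  also have "\<dots> = (odds xs @ evens xs) ! i"
    using i assms by (auto simp: omega_def nth_append odds_nth evens_nth Suc_diff_le)
  finally show "move (inv (omega k)) xs ! i = (odds xs @ evens xs) ! i" .
qed

context tensor_words
begin

interpretation vT: vector_space "tscale :: 'k \<Rightarrow> ('k, 'm, 'h) tensor \<Rightarrow> ('k, 'm, 'h) tensor"
  by (rule vector_space_tscale)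

lemma multilinear_middle: "multilinear tscale w (\<lambda>xs. etensor (us @ xs @ vs))"
  unfolding multilinear_def
proof (intro allI conjI impI)
  fix xs ys :: "('m + 'h) list" assume "map factor_of xs @ FM # map factor_of ys = w"
  then show "Vector_Spaces.linear sM tscale (\<lambda>a. etensor (us @ (xs @ Inl a # ys) @ vs))"
    using multilinear_etensor[of "map factor_of us @ w @ map factor_of vs", unfolded multilinear_def,
      rule_format, of "us @ xs" "ys @ vs"] by auto
next
  fix xs ys :: "('m + 'h) list" assume "map factor_of xs @ FH # map factor_of ys = w"
  then show "Vector_Spaces.linear sH tscale (\<lambda>a. etensor (us @ (xs @ Inr a # ys) @ vs))"
    using multilinear_etensor[of "map factor_of us @ w @ map factor_of vs", unfolded multilinear_def,
      rule_format, of "us @ xs" "ys @ vs"] by auto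
qed

text \<open>
  The surrounding lists \<open>us\<close>, \<open>vs\<close>, \<open>ws\<close> make room for the first two entries of a word when
  they are split off in the induction.
\<close>

lemma multilinear_unshuffle:
  assumes "length w = 2 * k"
  shows "multilinear tscale w (\<lambda>xs. etensor (us @ odds xs @ vs @ evens xs @ ws))"
  using assms
proof (induction k arbitrary: w us vs ws)
  case 0
  then show ?case by (simp add: multilinear_empty)
next
  case (Suc k)
  then obtain x y w' where w: "w = x # y # w'" and w': "length w' = 2 * k"
    by (cases w rule: odds.cases) auto
  let ?B = "\<lambda>zs xs. etensor ((us @ [zs ! 0]) @ odds xs @ (vs @ [zs ! 1]) @ evens xs @ ws)"
  have "multilinear tscale ([x, y] @ w') (\<lambda>zs. ?B (take (length [x, y]) zs) (drop (length [x, y]) zs))"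
  proof (rule multilinear_take_drop[where B = ?B])
    fix zs show "multilinear tscale w' (?B zs)" by (rule Suc.IH[OF w'])
  next
    fix xs :: "('m + 'h) list"
    let ?C = "\<lambda>ps qs. etensor (us @ ps @ odds xs @ vs @ qs @ evens xs @ ws)"
    have "multilinear tscale ([x] @ [y]) (\<lambda>zs. ?C (take (length [x]) zs) (drop (length [x]) zs))"
    proof (rule multilinear_take_drop[where B = ?C])
      fix qs show "multilinear tscale [x] (\<lambda>ps. ?C ps qs)"
        by (rule multilinear_middle)
    next
      fix ps show "multilinear tscale [y] (?C ps)"
        using multilinear_middle[of "[y]" "us @ ps @ odds xs @ vs"] by simp
    qed
    also have "?this \<longleftrightarrow> multilinear tscale [x, y] (\<lambda>zs. ?B zs xs)"
      by (simp, rule multilinear_cong) (auto simp: map_eq_Cons_conv)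
    finally show "multilinear tscale [x, y] (\<lambda>zs. ?B zs xs)" .
  qed
  also have "?this \<longleftrightarrow> ?case"
    unfolding w by (simp, rule multilinear_cong) (auto simp: map_eq_Cons_conv)
  finally show ?case .
qed

lemma permute_etensor:
  assumes "length xs = 2 * k"
  shows "permute (inv (omega k)) (etensor xs) = etensor (odds xs @ evens xs)"
proof -
  have "multilinear tscale (map factor_of xs) (\<lambda>ys. etensor (move (inv (omega k)) ys))
    = multilinear tscale (map factor_of xs) (\<lambda>ys. etensor ([] @ odds ys @ [] @ evens ys @ []))"
  proof (rule multilinear_cong)
    fix ys :: "('m + 'h) list" assume "map factor_of ys = map factor_of xs"
    then have "length ys = 2 * k" using assms by (metis length_map)
    then show "etensor (move (inv (omega k)) ys) = etensor ([] @ odds ys @ [] @ evens ys @ [])"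
      by (simp add: move_inv_omega)
  qed
  also have "\<dots>" by (rule multilinear_unshuffle[of _ k]) (simp add: assms)
  finally show ?thesis
    unfolding permute_def by (subst extend_etensor[OF _ refl]) (simp_all add: move_inv_omega assms)
qed

lemma permute_sum: "permute \<theta> (sum h I) = (\<Sum>i\<in>I. permute \<theta> (h i))"
  unfolding permute_def
  by (induction I rule: infinite_finite_induct) (simp_all add: extend_zero extend_add)

text \<open>
  A permutation of factors is not everywhere linear in the sense of \<open>total_linear\<close>: on tuples shorter
  than \<open>2 k\<close> it may refer to missing entries. So it is used on words of the right length only.
\<close>

lemma same_hom_permute:
  assumes "length w = 2 * k" "odds w @ evens w = w'"
  shows "same_hom w w' (permute (inv (omega k))) (permute (inv (omega k)))"
proof -
  have "permute (inv (omega k)) t \<in> tensor_space w'" if "t \<in> tensor_space w" for t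
    using that
  proof (induction rule: tensor_space_induct)
    case zero
    then show ?case by (simp add: permute_def extend_zero)
  next
    case (step c xs t)
    have "permute (inv (omega k)) (etensor xs) \<in> tensor_space w'"
      using step(1) assms by (auto simp: permute_etensor odds_map evens_map intro!: etensor_in_tensor_space)
    then show ?case using step by (simp add: permute_def extend_add extend_scale)
  qed
  then show ?thesis
    by (simp add: same_hom_def map_eq_def tensor_hom_def permute_def extend_add extend_scale)
qed

lemma same_hom_ident: "same_hom u u (\<lambda>t. t) (\<lambda>t. t)"
  using same_hom_id[of u] by (simp add: id_def)

lemma total_linear_ident [simp]: "total_linear (\<lambda>t. t)"
  using total_linear_id by (simp add: id_def)

lemma same_hom_pow:
  assumes "same_hom [FH] [FH, FH] \<Delta> \<Delta>'"
  shows "same_hom (replicate n FH) (replicate (2 * n) FH) (tensor_pow \<Delta> 1 n) (tensor_pow \<Delta>' 1 n)"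
proof (induction n)
  case 0
  show ?case by (simp add: same_hom_id same_hom_ident)
next
  case (Suc n)
  show ?case
    using same_hom_tensorI[OF assms Suc] by simp
qed

lemma same_hom_at_pos:
  assumes "same_hom v v' f f'" "Suc (length u) = p" "length v = a" "u @ v @ w = x" "u @ v' @ w = x'"
  shows "same_hom x x' (at_pos p a f) (at_pos p a f')"
  unfolding at_pos_def
  by (rule same_hom_tensorI[OF same_hom_id[of u] same_hom_tensorI[OF assms(1) same_hom_id[of w]]])
    (use assms in auto)

lemma same_hom_at_pos_funpow:
  assumes "same_hom [FH, FH] [FH] \<mu> \<mu>'" "Suc (length u) = p"
  shows "same_hom (u @ replicate (Suc k) FH @ v) (u @ FH # v) (at_pos p 2 \<mu> ^^ k) (at_pos p 2 \<mu>' ^^ k)"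
proof (induction k)
  case 0
  show ?case by (simp add: same_hom_id same_hom_ident)
next
  case (Suc k)
  have "same_hom (u @ replicate (Suc (Suc k)) FH @ v) (u @ replicate (Suc k) FH @ v) (at_pos p 2 \<mu>) (at_pos p 2 \<mu>')"
    by (rule same_hom_at_pos[OF assms]) simp_all
  from same_hom_comp[OF this Suc] show ?case by (simp only: funpow_Suc_right)
qed

lemma same_hom_bar_delta:
  assumes "same_hom [FH, FH] [FH] \<mu> \<mu>'" "same_hom [FH] [FH, FH] \<Delta> \<Delta>'" "same_hom [FM] [FM, FH] \<delta> \<delta>'"
  shows "same_hom (bar_word n) (bar_word n @ [FH]) (bar_delta \<mu> \<Delta> \<delta> n) (bar_delta \<mu>' \<Delta>' \<delta>' n)"
  unfolding bar_delta_def
proof (rule same_hom_comp[OF _ same_hom_comp])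
  show "same_hom (bar_word n) ([FM, FH] @ replicate (2 * n) FH) (\<delta> \<otimes>\<^bsub>1\<^esub> tensor_pow \<Delta> 1 n) (\<delta>' \<otimes>\<^bsub>1\<^esub> tensor_pow \<Delta>' 1 n)"
    by (rule same_hom_tensorI[OF assms(3) same_hom_pow[OF assms(2)]]) (simp_all add: bar_word_def)
  show "same_hom ([FM, FH] @ replicate (2 * n) FH) (bar_word n @ replicate (Suc n) FH @ [])
      (permute (inv (omega (n + 1)))) (permute (inv (omega (n + 1))))"
    by (rule same_hom_permute) (simp_all add: bar_word_def)
  show "same_hom (bar_word n @ replicate (Suc n) FH @ []) (bar_word n @ [FH]) (at_pos (n + 2) 2 \<mu> ^^ n) (at_pos (n + 2) 2 \<mu>' ^^ n)"
    by (rule same_hom_at_pos_funpow[OF assms(1)]) (simp add: bar_word_def)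
qed

lemma same_hom_bar_gamma:
  assumes "same_hom [FH, FH] [FH] \<mu> \<mu>'" "same_hom [FH] [FH, FH] \<Delta> \<Delta>'" "same_hom [FM] [FH, FM] \<gamma> \<gamma>'"
  shows "same_hom (bar_word n) (FH # bar_word n) (bar_gamma \<mu> \<Delta> \<gamma> n) (bar_gamma \<mu>' \<Delta>' \<gamma>' n)"
  unfolding bar_gamma_def
proof (rule same_hom_comp[OF _ same_hom_comp])
  show "same_hom (bar_word n) ([FH, FM] @ replicate (2 * n) FH) (\<gamma> \<otimes>\<^bsub>1\<^esub> tensor_pow \<Delta> 1 n) (\<gamma>' \<otimes>\<^bsub>1\<^esub> tensor_pow \<Delta>' 1 n)"
    by (rule same_hom_tensorI[OF assms(3) same_hom_pow[OF assms(2)]]) (simp_all add: bar_word_def)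
  show "same_hom ([FH, FM] @ replicate (2 * n) FH) ([] @ replicate (Suc n) FH @ bar_word n)
      (permute (inv (omega (n + 1)))) (permute (inv (omega (n + 1))))"
    by (rule same_hom_permute) (simp_all add: bar_word_def)
  show "same_hom ([] @ replicate (Suc n) FH @ bar_word n) (FH # bar_word n) (at_pos 1 2 \<mu> ^^ n) (at_pos 1 2 \<mu>' ^^ n)"
    using same_hom_at_pos_funpow[OF assms(1), of "[]" 1 n "bar_word n"] by simp
qed

lemma same_hom_add:
  "same_hom u v f f' \<Longrightarrow> same_hom u v g g' \<Longrightarrow> same_hom u v (\<lambda>t. f t + g t) (\<lambda>t. f' t + g' t)"
  by (simp add: same_hom_def tensor_hom_def map_eq_def vT.scale_right_distrib add_ac)

lemma same_hom_scale:
  "same_hom u v f f' \<Longrightarrow> same_hom u v (\<lambda>t. tscale c (f t)) (\<lambda>t. tscale c (f' t))"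
  by (simp add: same_hom_def tensor_hom_def map_eq_def vT.scale_right_distrib mult.commute)

lemma same_hom_zero: "same_hom u v (\<lambda>t. 0) (\<lambda>t. 0)"
  by (simp add: same_hom_def tensor_hom_def map_eq_def)

lemma same_hom_sum:
  "(\<And>i. i \<in> I \<Longrightarrow> same_hom u v (f i) (f' i)) \<Longrightarrow> same_hom u v (\<lambda>t. \<Sum>i\<in>I. f i t) (\<lambda>t. \<Sum>i\<in>I. f' i t)"
  by (induction I rule: infinite_finite_induct) (simp_all add: same_hom_zero same_hom_add)

lemma same_hom_bar_d:
  assumes "same_hom [FH, FH] [FH] \<mu> \<mu>'" "same_hom [FM, FH] [FM] \<rho> \<rho>'"
  shows "same_hom (bar_word (Suc n)) (bar_word n) (bar_d \<mu> \<rho> (Suc n)) (bar_d \<mu>' \<rho>' (Suc n))"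
  unfolding bar_d_def
proof (intro same_hom_add same_hom_sum same_hom_scale)
  show "same_hom (bar_word (Suc n)) (bar_word n) (at_pos 1 2 \<rho>) (at_pos 1 2 \<rho>')"
    by (rule same_hom_at_pos[OF assms(2), of "[]" _ _ "replicate n FH"]) (simp_all add: bar_word_def)
  fix i assume "i \<in> {1..Suc n - 1}"
  then have i: "1 \<le> i" "i \<le> n" by simp_all
  then have *: "replicate n FH = replicate (i - 1) FH @ FH # replicate (n - i) FH"
    by (subst replicate_Suc[symmetric], subst replicate_add[symmetric]) simp
  show "same_hom (bar_word (Suc n)) (bar_word n) (at_pos (i + 1) 2 \<mu>) (at_pos (i + 1) 2 \<mu>')"
    by (rule same_hom_at_pos[OF assms(1), of "FM # replicate (i - 1) FH" _ _ "replicate (n - i) FH"])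
      (use i in \<open>simp_all add: bar_word_def * replicate_app_Cons_same\<close>)
qed

lemma same_hom_sym: "same_hom u v f g \<Longrightarrow> same_hom u v g f"
  by (auto simp: same_hom_def map_eq_def)

text \<open>
  How a map given by an explicit formula is recognised as an everywhere linear one: by comparing
  values on elementary tensors.
\<close>

lemma same_hom_trans_total:
  assumes "same_hom u v f g" "total_linear h" "\<And>xs. map factor_of xs = u \<Longrightarrow> g (etensor xs) = h (etensor xs)"
  shows "same_hom u v f h"
proof -
  have g: "g \<in> tensor_hom u v" using assms(1) by (simp add: same_hom_def)
  have h: "h \<in> tensor_hom u v"
    by (rule tensor_homI[OF assms(2)])
      (simp add: assms(3)[symmetric] tensor_homD(1)[OF g] etensor_in_tensor_space)
  from hom_eqI[OF g h assms(3)] assms(1) h show ?thesis by (simp add: same_hom_def map_eq_def)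
qed

lemma hopf_bimodule_hom_lincomb:
  assumes f: "hopf_bimodule_hom N \<rho> lam \<delta> \<gamma> P \<rho>1 lam1 \<delta>1 \<gamma>1 f"
    and g: "hopf_bimodule_hom N \<rho> lam \<delta> \<gamma> P \<rho>1 lam1 \<delta>1 \<gamma>1 g"
    and coact: "\<delta> \<in> tensor_hom N (N @ [FH])" "\<gamma> \<in> tensor_hom N (FH # N)"
    and total: "total_linear f" "total_linear g" "total_linear \<rho>1" "total_linear lam1" "total_linear \<delta>1" "total_linear \<gamma>1"
  shows "hopf_bimodule_hom N \<rho> lam \<delta> \<gamma> P \<rho>1 lam1 \<delta>1 \<gamma>1 (\<lambda>t. f t + tscale c (g t))"
proof -
  let ?h = "\<lambda>t. f t + tscale c (g t)"
  have h: "total_linear ?h"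
    using total by (simp add: total_linear_def vT.scale_right_distrib add_ac mult.commute)
  have L: "(?h \<otimes>\<^bsub>a\<^esub> id) t = (f \<otimes>\<^bsub>a\<^esub> id) t + tscale c ((g \<otimes>\<^bsub>a\<^esub> id) t)" if "t \<in> tensor_space w" for a t w
    using that
    by (induction rule: tensor_space_induct)
      (simp_all add: total h total_linear_zero[OF total_linear_tensor_map] tensor_map_add tensor_map_scale
        tensor_map_total juxt_add_left juxt_scale_left vT.scale_right_distrib add_ac mult.commute)
  have R: "(id \<otimes>\<^bsub>a\<^esub> ?h) t = (id \<otimes>\<^bsub>a\<^esub> f) t + tscale c ((id \<otimes>\<^bsub>a\<^esub> g) t)" if "t \<in> tensor_space w" for a t w
    using that
    by (induction rule: tensor_space_induct)
      (simp_all add: total h total_linear_zero[OF total_linear_tensor_map] tensor_map_add tensor_map_scale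
        tensor_map_total juxt_add_right juxt_scale_right total[THEN total_linear_tensors] vT.scale_right_distrib add_ac mult.commute)
  note fg = f[unfolded hopf_bimodule_hom_def map_eq_def] g[unfolded hopf_bimodule_hom_def map_eq_def]
  show ?thesis
    unfolding hopf_bimodule_hom_def map_eq_def
    using fg by (auto simp: L[OF tensor_homD(1)[OF coact(1)]] R[OF tensor_homD(1)[OF coact(2)]] L R total[THEN total_linear_add] total[THEN total_linear_scale] tensor_hom_def
      vT.scale_right_distrib add_ac mult.commute)
qed

section \<open>Recursive description of the bar complex\<close>

text \<open>
  The structure maps of \<open>M \<otimes> H\<^sup>\<otimes>\<^sup>n\<close>, built up from \<open>n\<close> to \<open>n + 1\<close> by the construction of \<open>N \<otimes> H\<close>.
  The map \<open>bar_diff \<mu> \<rho> n\<close> is the differential \<open>d\<^sub>n\<^sub>+\<^sub>1\<close>, which has \<open>n\<close> as target degree, so that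
  \<open>n = 0\<close> gives the first differential.
\<close>

fun bar_right where "bar_right \<mu> \<rho> 0 = \<rho>" | "bar_right \<mu> \<rho> (Suc n) = id \<otimes>\<^bsub>Suc n\<^esub> \<mu>"
fun bar_left where "bar_left lam 0 = lam" | "bar_left lam (Suc n) = bar_left lam n \<otimes>\<^bsub>Suc (Suc n)\<^esub> id"
fun bar_coright where "bar_coright \<mu> \<Delta> \<delta> 0 = \<delta>"
| "bar_coright \<mu> \<Delta> \<delta> (Suc n) = diag_right \<mu> \<Delta> (bar_word n) (bar_coright \<mu> \<Delta> \<delta> n)"
fun bar_coleft where "bar_coleft \<mu> \<Delta> \<gamma> 0 = \<gamma>"
| "bar_coleft \<mu> \<Delta> \<gamma> (Suc n) = diag_left \<mu> \<Delta> (bar_word n) (bar_coleft \<mu> \<Delta> \<gamma> n)"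
fun bar_diff where "bar_diff \<mu> \<rho> 0 = \<rho>"
| "bar_diff \<mu> \<rho> (Suc n) = (\<lambda>t. (bar_diff \<mu> \<rho> n \<otimes>\<^bsub>Suc (Suc n)\<^esub> id) t + tscale ((- 1) ^ Suc n) (bar_right \<mu> \<rho> (Suc n) t))"

lemma bar_word_Suc: "bar_word (Suc n) = bar_word n @ [FH]"
  by (simp add: bar_word_def replicate_append_same)

lemma length_bar_word [simp]: "length (bar_word n) = Suc n"
  by (simp add: bar_word_def)

lemma total_linear_lincomb:
  assumes "total_linear f" "total_linear g"
  shows "total_linear (\<lambda>t. f t + tscale c (g t))"
  using assms by (simp add: total_linear_def vT.scale_right_distrib add_ac mult.commute)

lemma total_bar:
  shows "total_linear \<mu> \<Longrightarrow> total_linear \<rho> \<Longrightarrow> total_linear (bar_right \<mu> \<rho> n)"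
    and "total_linear lam \<Longrightarrow> total_linear (bar_left lam n)"
    and "total_linear \<mu> \<Longrightarrow> total_linear \<Delta> \<Longrightarrow> total_linear \<delta> \<Longrightarrow> total_linear (bar_coright \<mu> \<Delta> \<delta> n)"
    and "total_linear \<mu> \<Longrightarrow> total_linear \<Delta> \<Longrightarrow> total_linear \<gamma> \<Longrightarrow> total_linear (bar_coleft \<mu> \<Delta> \<gamma> n)"
    and "total_linear \<mu> \<Longrightarrow> total_linear \<rho> \<Longrightarrow> total_linear (bar_diff \<mu> \<rho> n)"
proof -
  show r: "total_linear \<mu> \<Longrightarrow> total_linear \<rho> \<Longrightarrow> total_linear (bar_right \<mu> \<rho> n)" for n
    by (cases n) simp_all
  show "total_linear lam \<Longrightarrow> total_linear (bar_left lam n)"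
    by (induction n) simp_all
  show "total_linear \<mu> \<Longrightarrow> total_linear \<Delta> \<Longrightarrow> total_linear \<delta> \<Longrightarrow> total_linear (bar_coright \<mu> \<Delta> \<delta> n)"
    by (induction n) (simp_all add: diag_right_def)
  show "total_linear \<mu> \<Longrightarrow> total_linear \<Delta> \<Longrightarrow> total_linear \<gamma> \<Longrightarrow> total_linear (bar_coleft \<mu> \<Delta> \<gamma> n)"
    by (induction n) (simp_all add: diag_left_def)
  show "total_linear \<mu> \<Longrightarrow> total_linear \<rho> \<Longrightarrow> total_linear (bar_diff \<mu> \<rho> n)"
    by (induction n) (simp_all only: bar_diff.simps total_linear_lincomb total_linear_tensor_map total_linear_id r)
qed

lemma at_pos_etensor:
  assumes "total_linear f"
  shows "at_pos p a f (etensor xs) =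
    juxt (etensor (take (p - 1) xs)) (juxt (f (etensor (take a (drop (p - 1) xs)))) (etensor (drop a (drop (p - 1) xs))))"
  by (simp add: at_pos_def tensor_map_total assms)

lemma bar_rho_eq:
  assumes "total_linear \<mu>" "map factor_of xs = bar_word n @ [FH]"
  shows "bar_rho \<mu> \<rho> n (etensor xs) = bar_right \<mu> \<rho> n (etensor xs)"
proof (cases n)
  case (Suc k)
  have "length xs = k + 3" using assms(2)[THEN arg_cong[where f = length]] Suc by simp
  then show ?thesis
    using Suc assms(1) by (simp add: bar_rho_def at_pos_etensor tensor_map_total total_linear_tensors)
qed (simp add: bar_rho_def)

lemma bar_lambda_eq:
  assumes "total_linear lam"
  shows "map factor_of xs = FH # bar_word n \<Longrightarrow> bar_lambda lam (etensor xs) = bar_left lam n (etensor xs)"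
proof (induction n arbitrary: xs)
  case 0
  then have "length xs = 2" by (auto simp: bar_word_def map_eq_Cons_conv)
  then show ?case using assms by (simp add: bar_lambda_def at_pos_etensor total_linear_tensors)
next
  case (Suc n)
  from Suc.prems obtain ys a where xs: "xs = ys @ [Inr a]" and ys: "map factor_of ys = FH # bar_word n"
    by (simp only: bar_word_Suc append_Cons[symmetric] shape_conv(1)) (auto simp: shape_conv(2))
  have len: "length ys = Suc (Suc n)" using arg_cong[OF ys, where f = length] by simp
  have "bar_lambda lam (etensor xs) = juxt (bar_lambda lam (etensor ys)) (etensor [Inr a])"
    using len by (simp add: xs bar_lambda_def at_pos_etensor assms total_linear_tensors juxt_assoc juxt_etensor)
  then show ?case
    using len by (simp add: Suc.IH[OF ys] xs tensor_map_total total_bar(2) assms)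
qed

text \<open>
  All summands of \<open>d\<^sub>n\<^sub>+\<^sub>2\<close> but the last one leave the last factor alone, so together they are
  \<open>d\<^sub>n\<^sub>+\<^sub>1 \<otimes> id\<close>; up to sign, the last one is the right action on \<open>M \<otimes> H\<^sup>\<otimes>\<^sup>n\<^sup>+\<^sup>1\<close>.
\<close>

lemma bar_d_eq:
  assumes \<mu>: "total_linear \<mu>" and \<rho>: "total_linear \<rho>"
  shows "map factor_of xs = bar_word (Suc n) \<Longrightarrow> bar_d \<mu> \<rho> (Suc n) (etensor xs) = bar_diff \<mu> \<rho> n (etensor xs)"
proof (induction n arbitrary: xs)
  case 0
  then have "length xs = 2" by (auto simp: bar_word_def map_eq_Cons_conv)
  then show ?case using assms by (simp add: bar_d_def at_pos_etensor total_linear_tensors)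
next
  case (Suc n)
  from Suc.prems obtain ys a where xs: "xs = ys @ [Inr a]" and ys: "map factor_of ys = bar_word (Suc n)"
    by (subst (asm) bar_word_Suc) (auto simp: shape_conv)
  have len: "length ys = Suc (Suc n)" using arg_cong[OF ys, where f = length] by simp
  have snoc: "at_pos p 2 f (etensor xs) = juxt (at_pos p 2 f (etensor ys)) (etensor [Inr a])"
    if "total_linear f" "p \<le> Suc n" for f p
    using len that by (simp add: xs at_pos_etensor total_linear_tensors juxt_assoc juxt_etensor)
  have last: "at_pos (Suc n + 1) 2 \<mu> (etensor xs) = bar_right \<mu> \<rho> (Suc n) (etensor xs)"
    using bar_rho_eq[OF \<mu>, of xs "Suc n" \<rho>] Suc.prems by (simp add: bar_rho_def bar_word_Suc) 
  have "bar_d \<mu> \<rho> (Suc (Suc n)) (etensor xs) = at_pos 1 2 \<rho> (etensor xs) +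
      (\<Sum>i = 1..n. tscale ((- 1) ^ i) (at_pos (i + 1) 2 \<mu> (etensor xs))) +
      tscale ((- 1) ^ Suc n) (at_pos (Suc n + 1) 2 \<mu> (etensor xs))"
    by (simp add: bar_d_def add_ac)
  also have "(\<Sum>i = 1..n. tscale ((- 1) ^ i) (at_pos (i + 1) 2 \<mu> (etensor xs))) =
      (\<Sum>i = 1..n. tscale ((- 1) ^ i) (juxt (at_pos (i + 1) 2 \<mu> (etensor ys)) (etensor [Inr a])))"
    by (rule sum.cong[OF refl]) (simp add: snoc \<mu>)
  also have "at_pos 1 2 \<rho> (etensor xs) + \<dots> = juxt (bar_d \<mu> \<rho> (Suc n) (etensor ys)) (etensor [Inr a])"
    by (simp add: snoc \<rho> bar_d_def juxt_add_left juxt_sum_left juxt_scale_left)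
  also have "bar_d \<mu> \<rho> (Suc n) (etensor ys) = bar_diff \<mu> \<rho> n (etensor ys)" by (rule Suc.IH[OF ys])
  also have "at_pos (Suc n + 1) 2 \<mu> (etensor xs) = bar_right \<mu> \<rho> (Suc n) (etensor xs)" by (rule last)
  finally show ?case
    using len by (simp add: tensor_map_total total_bar(5) assms xs del: power_Suc bar_right.simps)
qed

end

context sweedler_bialgebra
begin

section \<open>The explicit diagonal coactions\<close>

text \<open>
  The power \<open>\<Delta>\<^sup>\<otimes>\<^sup>n\<close> is defined by splitting off the first factor, while the recursion for the coactions
  needs the last one.
\<close>

lemma pow_snoc:
  "length hs = n \<Longrightarrow> tensor_pow \<Delta> 1 (Suc n) (etensor (hs @ [h])) =
     juxt (tensor_pow \<Delta> 1 n (etensor hs)) (\<Delta> (etensor [h]))"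
  and total_pow [simp]: "total_linear (tensor_pow \<Delta> a n)"
proof -
  show t: "total_linear (tensor_pow \<Delta> a n)" for a n
    by (induction n) simp_all
  show "length hs = n \<Longrightarrow> tensor_pow \<Delta> 1 (Suc n) (etensor (hs @ [h])) =
     juxt (tensor_pow \<Delta> 1 n (etensor hs)) (\<Delta> (etensor [h]))"
  proof (induction n arbitrary: hs)
    case 0
    then show ?case by (simp add: tensor_map_total total_linear_tensors)
  next
    case (Suc n)
    then obtain g gs where hs: "hs = g # gs" and gs: "length gs = n" by (cases hs) auto
    from Suc.IH[OF gs] show ?case
      using gs t
      by (simp add: hs tensor_map_total total_linear_tensors juxt_assoc)
  qed
qed

lemma mul_iterate:
  "length us = p \<Longrightarrow> length bs = k \<Longrightarrow>
   (at_pos (Suc p) 2 \<mu> ^^ k) (etensor (us @ Inr a # map Inr bs @ vs)) = etensor (us @ Inr (foldl mul a bs) # vs)"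
proof (induction k arbitrary: a bs)
  case 0
  then show ?case by simp
next
  case (Suc k)
  then obtain b bs' where bs: "bs = b # bs'" and bs': "length bs' = k" by (cases bs) auto
  have "at_pos (Suc p) 2 \<mu> (etensor (us @ Inr a # map Inr bs @ vs)) = etensor (us @ Inr (mul a b) # map Inr bs' @ vs)"
    using Suc.prems(1) by (simp add: at_pos_etensor bs mul juxt_etensor)
  then show ?case
    using Suc.IH[OF Suc.prems(1) bs'] by (simp add: funpow_Suc_right bs del: funpow.simps)
qed

lemma shape_replicate: "map factor_of xs = replicate n FH \<Longrightarrow> \<exists>bs. xs = map Inr bs \<and> length bs = n"
proof (induction n arbitrary: xs)
  case (Suc n)
  then obtain a ys where "xs = Inr a # ys" "map factor_of ys = replicate n FH"
    by (auto simp: shape_conv(2))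
  with Suc.IH[of ys] obtain bs where "xs = map Inr (a # bs)" "length (a # bs) = Suc n" by auto
  then show ?case by blast
qed simp

lemma total_at_pos [simp]: "total_linear f \<Longrightarrow> total_linear (at_pos p a f)"
  by (simp add: at_pos_def)

text \<open>
  Let \<open>y\<close> be a summand of \<open>(\<delta> \<otimes> \<Delta>\<^sup>\<otimes>\<^sup>n) xs\<close> and \<open>p \<otimes> q\<close> one of \<open>\<Delta> h\<close>. Unshuffling \<open>y p q\<close> gives
  \<open>odds y\<close>, \<open>p\<close>, \<open>evens y\<close>, \<open>q\<close>. Of the \<open>n + 1\<close> multiplications, the first \<open>n\<close> reduce \<open>evens y\<close> to a
  single factor, as they do in degree \<open>n\<close>, and the last one multiplies it with \<open>q\<close>.
\<close>

lemma bar_delta_snoc: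
  assumes \<delta>: "total_linear \<delta>" "\<delta> \<in> tensor_hom [FM] [FM, FH]" and xs: "map factor_of xs = bar_word n"
  shows "bar_delta \<mu> \<Delta> \<delta> (Suc n) (etensor (xs @ [Inr h])) =
    ((id \<otimes>\<^bsub>Suc (Suc n)\<^esub> \<mu>) \<circ> (id \<otimes>\<^bsub>Suc n\<^esub> flip 1 \<otimes>\<^bsub>2\<^esub> id))
      (juxt (bar_delta \<mu> \<Delta> \<delta> n (etensor xs)) (\<Delta> (etensor [Inr h])))"
proof -
  let ?X = "\<lambda>n. \<delta> \<otimes>\<^bsub>1\<^esub> tensor_pow \<Delta> 1 n"
  let ?D = "(id \<otimes>\<^bsub>Suc (Suc n)\<^esub> \<mu>) \<circ> (id \<otimes>\<^bsub>Suc n\<^esub> flip 1 \<otimes>\<^bsub>2\<^esub> id)"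
  let ?W = "[FM, FH] @ replicate (2 * n) FH"
  have D: "\<Delta> \<in> tensor_hom [FH] [FH, FH]" using bialg by (simp add: bialgebra_def)
  then have "same_hom [FH] [FH, FH] \<Delta> \<Delta>" "same_hom [FM] [FM, FH] \<delta> \<delta>"
    using \<delta> by (simp_all add: same_hom_def map_eq_def)
  then have "same_hom (bar_word n) ?W (?X n) (?X n)"
    by (intro same_hom_tensorI[OF _ same_hom_pow]) (simp_all add: bar_word_def)
  then have "?X n \<in> tensor_hom (bar_word n) ?W" by (simp add: same_hom_def)
  from tensor_homD(1)[OF this etensor_in_tensor_space[OF xs]]
  have "?X n (etensor xs) \<in> tensor_space ?W" .
  then obtain k y where y: "?X n (etensor xs) = (\<Sum>i<(k::nat). etensor (y i))"
    and shape_y: "\<And>i. map factor_of (y i) = ?W"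
    using tensor_space_sum by blast
  have len: "length (y i) = 2 * Suc n" for i using arg_cong[OF shape_y, where f = length] by simp
  have len_xs: "length xs = Suc n" using arg_cong[OF xs, where f = length] by simp
  have X: "?X (Suc n) (etensor (xs @ [Inr h])) = juxt (?X n (etensor xs)) (\<Delta> (etensor [Inr h]))"
    using pow_snoc[of "drop 1 xs" n "Inr h"] len_xs
    by (simp add: tensor_map_total \<delta> juxt_assoc total_linear_tensors del: tensor_pow.simps)
  have summand: "(at_pos (Suc n + 2) 2 \<mu> ^^ Suc n) (permute (inv (omega (Suc n + 1))) (etensor (y i @ [Inr p, Inr q]))) =
      ?D (juxt ((at_pos (n + 2) 2 \<mu> ^^ n) (permute (inv (omega (n + 1))) (etensor (y i)))) (etensor [Inr p, Inr q]))"
    for i p q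
  proof -
    have "map factor_of (evens (y i)) = replicate (Suc n) FH"
      using shape_y[of i] by (simp add: evens_map[symmetric])
    then obtain b bs where e: "evens (y i) = Inr b # map Inr bs" and bs: "length bs = n"
      using shape_replicate[of "evens (y i)" "Suc n"] by (auto simp: length_Suc_conv)
    have "(at_pos (Suc (Suc n + 1)) 2 \<mu> ^^ Suc n) (etensor ((odds (y i) @ [Inr p]) @ Inr b # map Inr (bs @ [q]) @ [])) =
        etensor ((odds (y i) @ [Inr p]) @ Inr (foldl mul b (bs @ [q])) # [])"
      by (rule mul_iterate) (simp_all add: len bs)
    then have 1: "(at_pos (Suc n + 2) 2 \<mu> ^^ Suc n) (permute (inv (omega (Suc n + 1))) (etensor (y i @ [Inr p, Inr q]))) =
        etensor (odds (y i) @ [Inr p, Inr (mul (foldl mul b bs) q)])"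
      by (simp add: permute_etensor len odds_snoc evens_snoc e del: funpow.simps)
    have "(at_pos (Suc (n + 1)) 2 \<mu> ^^ n) (etensor (odds (y i) @ Inr b # map Inr bs @ [])) =
        etensor (odds (y i) @ Inr (foldl mul b bs) # [])"
      by (rule mul_iterate) (simp_all add: len bs)
    then have 2: "(at_pos (n + 2) 2 \<mu> ^^ n) (permute (inv (omega (n + 1))) (etensor (y i))) =
        etensor (odds (y i) @ [Inr (foldl mul b bs)])"
      by (simp add: permute_etensor len e)
    show ?thesis unfolding 1 2 by (simp add: len ev)
  qed
  have at_sum: "(at_pos p 2 \<mu> ^^ m) (sum g I) = (\<Sum>i\<in>I. (at_pos p 2 \<mu> ^^ m) (g i))" for p m g I
    by (rule total_linear_sum) simp
  have perm: "permute (inv (omega (n + 1))) (etensor (y i)) \<in> tensors" for i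
    by (simp add: permute_etensor len)
  have at_mem: "(at_pos p 2 \<mu> ^^ m) t \<in> tensors" if "t \<in> tensors" for p m t
    using that by (rule total_linear_tensors[OF total_linear_funpow[OF total_at_pos[OF total(1)]]])
  show ?thesis
    unfolding bar_delta_def o_apply X y
    by (simp only: cop juxt_sum_left juxt_sum_right tensors_intros permute_sum at_sum juxt_etensor append_Cons append_Nil
        tensor_map_sum perm at_mem summand[unfolded o_apply])
qed

text \<open>
  As for the right coaction, but here the multiplications take place in \<open>odds y\<close>, \<open>p\<close>, and the last
  one involves \<open>p\<close>.
\<close>

lemma bar_gamma_snoc:
  assumes \<gamma>: "total_linear \<gamma>" "\<gamma> \<in> tensor_hom [FM] [FH, FM]" and xs: "map factor_of xs = bar_word n"
  shows "bar_gamma \<mu> \<Delta> \<gamma> (Suc n) (etensor (xs @ [Inr h])) =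
    ((\<mu> \<otimes>\<^bsub>2\<^esub> id) \<circ> (id \<otimes>\<^bsub>1\<^esub> flip (Suc n) \<otimes>\<^bsub>Suc (Suc n)\<^esub> id))
      (juxt (bar_gamma \<mu> \<Delta> \<gamma> n (etensor xs)) (\<Delta> (etensor [Inr h])))"
proof -
  let ?X = "\<lambda>n. \<gamma> \<otimes>\<^bsub>1\<^esub> tensor_pow \<Delta> 1 n"
  let ?D = "(\<mu> \<otimes>\<^bsub>2\<^esub> id) \<circ> (id \<otimes>\<^bsub>1\<^esub> flip (Suc n) \<otimes>\<^bsub>Suc (Suc n)\<^esub> id)"
  let ?W = "[FH, FM] @ replicate (2 * n) FH"
  have D: "\<Delta> \<in> tensor_hom [FH] [FH, FH]" using bialg by (simp add: bialgebra_def)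
  then have "same_hom [FH] [FH, FH] \<Delta> \<Delta>" "same_hom [FM] [FH, FM] \<gamma> \<gamma>"
    using \<gamma> by (simp_all add: same_hom_def map_eq_def)
  then have "same_hom (bar_word n) ?W (?X n) (?X n)"
    by (intro same_hom_tensorI[OF _ same_hom_pow]) (simp_all add: bar_word_def)
  then have "?X n \<in> tensor_hom (bar_word n) ?W" by (simp add: same_hom_def)
  from tensor_homD(1)[OF this etensor_in_tensor_space[OF xs]]
  have "?X n (etensor xs) \<in> tensor_space ?W" .
  then obtain k y where y: "?X n (etensor xs) = (\<Sum>i<(k::nat). etensor (y i))"
    and shape_y: "\<And>i. map factor_of (y i) = ?W"
    using tensor_space_sum by blast
  have len: "length (y i) = 2 * Suc n" for i using arg_cong[OF shape_y, where f = length] by simp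
  have len_xs: "length xs = Suc n" using arg_cong[OF xs, where f = length] by simp
  have X: "?X (Suc n) (etensor (xs @ [Inr h])) = juxt (?X n (etensor xs)) (\<Delta> (etensor [Inr h]))"
    using pow_snoc[of "drop 1 xs" n "Inr h"] len_xs
    by (simp add: tensor_map_total \<gamma> juxt_assoc total_linear_tensors del: tensor_pow.simps)
  have summand: "(at_pos 1 2 \<mu> ^^ Suc n) (permute (inv (omega (Suc n + 1))) (etensor (y i @ [Inr p, Inr q]))) =
      ?D (juxt ((at_pos 1 2 \<mu> ^^ n) (permute (inv (omega (n + 1))) (etensor (y i)))) (etensor [Inr p, Inr q]))"
    for i p q
  proof -
    have "map factor_of (odds (y i)) = replicate (Suc n) FH"
      using shape_y[of i] by (simp add: odds_map[symmetric])
    then obtain b bs where e: "odds (y i) = Inr b # map Inr bs" and bs: "length bs = n"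
      using shape_replicate[of "odds (y i)" "Suc n"] by (auto simp: length_Suc_conv)
    have "(at_pos (Suc 0) 2 \<mu> ^^ Suc n) (etensor ([] @ Inr b # map Inr (bs @ [p]) @ evens (y i) @ [Inr q])) =
        etensor ([] @ Inr (foldl mul b (bs @ [p])) # evens (y i) @ [Inr q])"
      by (rule mul_iterate) (simp_all add: len bs)
    then have 1: "(at_pos 1 2 \<mu> ^^ Suc n) (permute (inv (omega (Suc n + 1))) (etensor (y i @ [Inr p, Inr q]))) =
        etensor (Inr (mul (foldl mul b bs) p) # evens (y i) @ [Inr q])"
      by (simp add: permute_etensor len odds_snoc evens_snoc e del: funpow.simps)
    have "(at_pos (Suc 0) 2 \<mu> ^^ n) (etensor ([] @ Inr b # map Inr bs @ evens (y i))) =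
        etensor ([] @ Inr (foldl mul b bs) # evens (y i))"
      by (rule mul_iterate) (simp_all add: len bs)
    then have 2: "(at_pos 1 2 \<mu> ^^ n) (permute (inv (omega (n + 1))) (etensor (y i))) =
        etensor (Inr (foldl mul b bs) # evens (y i))"
      by (simp add: permute_etensor len e)
    show ?thesis unfolding 1 2 by (simp add: len ev)
  qed
  have at_sum: "(at_pos p 2 \<mu> ^^ m) (sum g I) = (\<Sum>i\<in>I. (at_pos p 2 \<mu> ^^ m) (g i))" for p m g I
    by (rule total_linear_sum) simp
  have perm: "permute (inv (omega (n + 1))) (etensor (y i)) \<in> tensors" for i
    by (simp add: permute_etensor len)
  have at_mem: "(at_pos p 2 \<mu> ^^ m) t \<in> tensors" if "t \<in> tensors" for p m t
    using that by (rule total_linear_tensors[OF total_linear_funpow[OF total_at_pos[OF total(1)]]])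
  show ?thesis
    unfolding bar_gamma_def o_apply X y
    by (simp only: cop juxt_sum_left juxt_sum_right tensors_intros permute_sum at_sum juxt_etensor append_Cons append_Nil
        tensor_map_sum perm at_mem summand[unfolded o_apply])
qed

end

context tensor_words
begin

interpretation vT: vector_space "tscale :: 'k \<Rightarrow> ('k, 'm, 'h) tensor \<Rightarrow> ('k, 'm, 'h) tensor"
  by (rule vector_space_tscale)

section \<open>The bar complex of Hopf bimodules\<close>

lemma ex_sweedler_bialgebra:
  assumes H: "bialgebra \<mu> \<nu> \<Delta> \<epsilon>"
    and total: "total_linear \<mu>" "total_linear \<nu>" "total_linear \<Delta>" "total_linear \<epsilon>"
  shows "\<exists>mul one eps cop hl hr. sweedler_bialgebra sM sH \<mu> \<nu> \<Delta> \<epsilon> mul one eps cop hl hr"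
proof -
  have hom: "\<mu> \<in> tensor_hom [FH, FH] [FH]" "\<nu> \<in> tensor_hom [] [FH]"
    "\<Delta> \<in> tensor_hom [FH] [FH, FH]" "\<epsilon> \<in> tensor_hom [FH] []"
    using H by (simp_all add: bialgebra_def)
  have H1: "\<exists>h. t = etensor [Inr h]" if "t \<in> tensor_space [FH]" for t
    using that bij_betw_imp_surj_on[OF bij_betw_etensor_H] by blast
  have K1: "\<exists>c. t = tscale c (etensor [])" if "t \<in> tensor_space []" for t
    using that bij_betw_imp_surj_on[OF bij_betw_etensor_unit] by blast
  define mul where "mul a b = (SOME h. \<mu> (etensor [Inr a, Inr b]) = etensor [Inr h])" for a b
  have "\<mu> (etensor [Inr a, Inr b]) \<in> tensor_space [FH]" for a b
    by (rule tensor_homD(1)[OF hom(1) etensor_in_tensor_space]) simp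
  from someI_ex[OF H1[OF this]] have mul: "\<mu> (etensor [Inr a, Inr b]) = etensor [Inr (mul a b)]" for a b
    unfolding mul_def .
  have "\<nu> (etensor []) \<in> tensor_space [FH]"
    by (rule tensor_homD(1)[OF hom(2) etensor_in_tensor_space]) simp
  from H1[OF this] obtain one where one: "\<nu> (etensor []) = etensor [Inr one]" ..
  define eps where "eps a = (SOME c. \<epsilon> (etensor [Inr a]) = tscale c (etensor []))" for a
  have "\<epsilon> (etensor [Inr a]) \<in> tensor_space []" for a
    by (rule tensor_homD(1)[OF hom(4) etensor_in_tensor_space]) simp
  from someI_ex[OF K1[OF this]] have eps: "\<epsilon> (etensor [Inr a]) = tscale (eps a) (etensor [])" for a
    unfolding eps_def .
  have "\<exists>(cop :: 'h \<Rightarrow> nat) hl hr. \<forall>a. \<Delta> (etensor [Inr a]) = (\<Sum>j<cop a. etensor [Inr (hl a j), Inr (hr a j)])"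
  proof -
    have "[FH, FH] \<noteq> []" by simp
    from sweedler_hom[OF hom(3) this] obtain k :: "('m + 'h) list \<Rightarrow> nat" and l
      where kl: "\<forall>xs. map factor_of xs = [FH] \<longrightarrow> \<Delta> (etensor xs) = (\<Sum>i<k xs. etensor (l xs i))"
        and l: "\<forall>xs i. map factor_of (l xs i) = [FH, FH]" by blast
    have "\<exists>b c. l xs i = [Inr b, Inr c]" for xs i
      using l[rule_format, of xs i] by (auto simp: shape_conv)
    then obtain b c where "l xs i = [Inr (b xs i), Inr (c xs i)]" for xs i by metis
    with kl have *: "\<Delta> (etensor [Inr a]) = (\<Sum>j<k [Inr a]. etensor [Inr (b [Inr a] j), Inr (c [Inr a] j)])" for a
      by simp
    show ?thesis
      by (intro exI[of _ "\<lambda>a. k [Inr a]"] exI[of _ "\<lambda>a. b [Inr a]"] exI[of _ "\<lambda>a. c [Inr a]"] allI *)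
  qed
  then obtain cop :: "'h \<Rightarrow> nat" and hl hr
    where cop: "\<Delta> (etensor [Inr a]) = (\<Sum>j<cop a. etensor [Inr (hl a j), Inr (hr a j)])" for a by blast
  have "sweedler_bialgebra sM sH \<mu> \<nu> \<Delta> \<epsilon> mul one eps cop hl hr"
    by (intro sweedler_bialgebra.intro tensor_words_axioms sweedler_bialgebra_axioms.intro H total mul one eps cop)
  then show ?thesis by blast
qed

end

context sweedler_bialgebra
begin

interpretation vT: vector_space "tscale :: 'k \<Rightarrow> ('k, 'm, 'h) tensor \<Rightarrow> ('k, 'm, 'h) tensor"
  by (rule vector_space_tscale)

lemma ex_sweedler_hopf_bimodule:
  assumes N: "hopf_bimodule \<mu> \<nu> \<Delta> \<epsilon> N \<rho> lam \<delta> \<gamma>"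
    and total: "total_linear \<rho>" "total_linear lam" "total_linear \<delta>" "total_linear \<gamma>"
    and ne: "N \<noteq> []"
  shows "\<exists>act al rc rn rh lc lh ln. sweedler_hopf_bimodule sM sH \<mu> \<nu> \<Delta> \<epsilon> mul one eps cop hl hr
    N \<rho> lam \<delta> \<gamma> act al rc rn rh lc lh ln"
proof -
  have hom: "lam \<in> tensor_hom (FH # N) N" "\<delta> \<in> tensor_hom N (N @ [FH])" "\<gamma> \<in> tensor_hom N (FH # N)"
    using N by (simp_all add: hopf_bimodule_def bimodule_def bicomodule_def)
  have ne': "N @ [FH] \<noteq> []" "FH # N \<noteq> []" by simp_all
  from sweedler_hom[OF hom(1) ne] obtain k1 :: "('m + 'h) list \<Rightarrow> nat" and l1
    where 1: "\<forall>xs. map factor_of xs = FH # N \<longrightarrow> lam (etensor xs) = (\<Sum>i<k1 xs. etensor (l1 xs i))"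
      "\<forall>xs i. map factor_of (l1 xs i) = N" by blast
  from sweedler_hom[OF hom(2) ne'(1)] obtain k2 :: "('m + 'h) list \<Rightarrow> nat" and l2
    where 2: "\<forall>xs. map factor_of xs = N \<longrightarrow> \<delta> (etensor xs) = (\<Sum>i<k2 xs. etensor (l2 xs i))"
      "\<forall>xs i. map factor_of (l2 xs i) = N @ [FH]" by blast
  have "\<exists>n a. l2 xs i = n @ [Inr a] \<and> map factor_of n = N" for xs i
    using 2(2)[rule_format, of xs i] by (auto simp: shape_conv)
  then obtain rn rh where r: "l2 xs i = rn xs i @ [Inr (rh xs i)]" "map factor_of (rn xs i) = N" for xs i by metis
  from sweedler_hom[OF hom(3) ne'(2)] obtain k3 :: "('m + 'h) list \<Rightarrow> nat" and l3
    where 3: "\<forall>xs. map factor_of xs = N \<longrightarrow> \<gamma> (etensor xs) = (\<Sum>i<k3 xs. etensor (l3 xs i))"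
      "\<forall>xs i. map factor_of (l3 xs i) = FH # N" by blast
  have "\<exists>n a. l3 xs i = Inr a # n \<and> map factor_of n = N" for xs i
    using 3(2)[rule_format, of xs i] by (auto simp: shape_conv)
  then obtain ln lh where l: "l3 xs i = Inr (lh xs i) # ln xs i" "map factor_of (ln xs i) = N" for xs i by metis
  have "sweedler_hopf_bimodule sM sH \<mu> \<nu> \<Delta> \<epsilon> mul one eps cop hl hr N \<rho> lam \<delta> \<gamma>
      (\<lambda>a ns. k1 (Inr a # ns)) (\<lambda>a ns. l1 (Inr a # ns)) k2 rn rh k3 lh ln"
    by (intro sweedler_hopf_bimodule.intro sweedler_bialgebra_axioms sweedler_hopf_bimodule_axioms.intro)
      (simp_all add: N total 1 2(1) 3(1) r l)
  then show ?thesis by blast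
qed

text \<open>
  The induction described at the beginning, for everywhere linear structure maps. In the last part,
  \<open>?z = (d\<^sub>n\<^sub>+\<^sub>2 \<otimes> id) xs\<close> occurs twice in \<open>d\<^sub>n\<^sub>+\<^sub>2 (d\<^sub>n\<^sub>+\<^sub>3 xs)\<close>, under the right action of \<open>M \<otimes> H\<^sup>\<otimes>\<^sup>n\<^sup>+\<^sup>1\<close> and with
  opposite signs: once from the last summand of \<open>d\<^sub>n\<^sub>+\<^sub>2\<close> and once, by right linearity, from that of
  \<open>d\<^sub>n\<^sub>+\<^sub>3\<close>.
\<close>

lemma bar_total:
  assumes M: "hopf_bimodule \<mu> \<nu> \<Delta> \<epsilon> [FM] \<rho> lam \<delta> \<gamma>"
    and totalM: "total_linear \<rho>" "total_linear lam" "total_linear \<delta>" "total_linear \<gamma>"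
  defines "R \<equiv> bar_right \<mu> \<rho>" and "L \<equiv> bar_left lam" and "D \<equiv> bar_coright \<mu> \<Delta> \<delta>"
    and "G \<equiv> bar_coleft \<mu> \<Delta> \<gamma>" and "d \<equiv> bar_diff \<mu> \<rho>"
  shows bar_hopf: "hopf_bimodule \<mu> \<nu> \<Delta> \<epsilon> (bar_word n) (R n) (L n) (D n) (G n)"
    and bar_hom: "hopf_bimodule_hom (bar_word (Suc n)) (R (Suc n)) (L (Suc n)) (D (Suc n)) (G (Suc n))
      (bar_word n) (R n) (L n) (D n) (G n) (d n)"
    and bar_square: "map factor_of xs = bar_word (Suc (Suc n)) \<Longrightarrow> d n (d (Suc n) (etensor xs)) = 0"
proof -
  have totals: "total_linear (R n)" "total_linear (L n)" "total_linear (D n)" "total_linear (G n)" "total_linear (d n)" for n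
    unfolding R_def L_def D_def G_def d_def by (simp_all add: total_bar totalM)
  have eqs: "R (Suc n) = id \<otimes>\<^bsub>length (bar_word n)\<^esub> \<mu>" "L (Suc n) = L n \<otimes>\<^bsub>length (bar_word n) + 1\<^esub> id"
    "D (Suc n) = diag_right \<mu> \<Delta> (bar_word n) (D n)" "G (Suc n) = diag_left \<mu> \<Delta> (bar_word n) (G n)" for n
    unfolding R_def L_def D_def G_def by simp_all
  have ne: "bar_word n \<noteq> []" for n by (simp add: bar_word_def)
  have step: "hopf_bimodule \<mu> \<nu> \<Delta> \<epsilon> (bar_word (Suc n)) (R (Suc n)) (L (Suc n)) (D (Suc n)) (G (Suc n))"
    "hopf_bimodule_hom (bar_word (Suc n)) (R (Suc n)) (L (Suc n)) (D (Suc n)) (G (Suc n))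
      (bar_word n) (R n) (L n) (D n) (G n) (R n)"
    "\<And>k f. total_linear f \<Longrightarrow>
        hopf_bimodule_hom (bar_word n) (R n) (L n) (D n) (G n) (bar_word k) (R k) (L k) (D k) (G k) f \<Longrightarrow>
        hopf_bimodule_hom (bar_word (Suc n)) (R (Suc n)) (L (Suc n)) (D (Suc n)) (G (Suc n))
          (bar_word (Suc k)) (R (Suc k)) (L (Suc k)) (D (Suc k)) (G (Suc k)) (f \<otimes>\<^bsub>Suc n\<^esub> id)"
    if "hopf_bimodule \<mu> \<nu> \<Delta> \<epsilon> (bar_word n) (R n) (L n) (D n) (G n)" for n
  proof -
    from ex_sweedler_hopf_bimodule[OF that totals(1-4) ne] obtain act al rc rn rh lc lh ln where
      "sweedler_hopf_bimodule sM sH \<mu> \<nu> \<Delta> \<epsilon> mul one eps cop hl hr (bar_word n) (R n) (L n) (D n) (G n) act al rc rn rh lc lh ln"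
      by blast
    then interpret N: sweedler_hopf_bimodule sM sH \<mu> \<nu> \<Delta> \<epsilon> mul one eps cop hl hr "bar_word n" "R n" "L n" "D n" "G n"
      act al rc rn rh lc lh ln .
    show "hopf_bimodule \<mu> \<nu> \<Delta> \<epsilon> (bar_word (Suc n)) (R (Suc n)) (L (Suc n)) (D (Suc n)) (G (Suc n))"
      unfolding bar_word_Suc eqs by (rule N.hopf_bimodule_tensor_H)
    show "hopf_bimodule_hom (bar_word (Suc n)) (R (Suc n)) (L (Suc n)) (D (Suc n)) (G (Suc n))
      (bar_word n) (R n) (L n) (D n) (G n) (R n)"
      unfolding bar_word_Suc eqs by (rule N.rho_hom)
    show "hopf_bimodule_hom (bar_word (Suc n)) (R (Suc n)) (L (Suc n)) (D (Suc n)) (G (Suc n))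
          (bar_word (Suc k)) (R (Suc k)) (L (Suc k)) (D (Suc k)) (G (Suc k)) (f \<otimes>\<^bsub>Suc n\<^esub> id)"
      if "total_linear f"
        "hopf_bimodule_hom (bar_word n) (R n) (L n) (D n) (G n) (bar_word k) (R k) (L k) (D k) (G k) f" for k f
      using N.hom_tensor_H[OF that(2) ne that(1) totals(2-4)]
      unfolding bar_word_Suc eqs by (simp only: length_bar_word)
  qed
  show hopf: "hopf_bimodule \<mu> \<nu> \<Delta> \<epsilon> (bar_word n) (R n) (L n) (D n) (G n)" for n
  proof (induction n)
    case 0
    show ?case using M unfolding R_def L_def D_def G_def by (simp add: bar_word_def)
  next
    case (Suc n)
    then show ?case by (rule step(1))
  qed
  show hom: "hopf_bimodule_hom (bar_word (Suc n)) (R (Suc n)) (L (Suc n)) (D (Suc n)) (G (Suc n))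
      (bar_word n) (R n) (L n) (D n) (G n) (d n)" for n
  proof (induction n)
    case 0
    have d0: "d 0 = R 0" unfolding d_def R_def by simp
    show ?case unfolding d0 by (rule step(2)[OF hopf])
  next
    case (Suc n)
    note 1 = step(3)[OF hopf totals(5) Suc] and 2 = step(2)[OF hopf[of "Suc n"]]
    have co: "D (Suc (Suc n)) \<in> tensor_hom (bar_word (Suc (Suc n))) (bar_word (Suc (Suc n)) @ [FH])"
      "G (Suc (Suc n)) \<in> tensor_hom (bar_word (Suc (Suc n))) (FH # bar_word (Suc (Suc n)))"
      using hopf[of "Suc (Suc n)"] by (simp_all add: hopf_bimodule_def bicomodule_def)
    have dS: "d (Suc n) = (\<lambda>t. (d n \<otimes>\<^bsub>Suc (Suc n)\<^esub> id) t + tscale ((- 1) ^ Suc n) (R (Suc n) t))"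
      unfolding d_def R_def by (rule bar_diff.simps)
    show ?case
      unfolding dS
      by (rule hopf_bimodule_hom_lincomb[OF 1 2 co]) (simp_all add: totals)
  qed
  have dS: "d (Suc n) t = (d n \<otimes>\<^bsub>Suc (Suc n)\<^esub> id) t + tscale ((- 1) ^ Suc n) (R (Suc n) t)" for n t
    unfolding d_def R_def by (simp only: bar_diff.simps)
  have equivariant: "d n (R (Suc n) t) = R n ((d n \<otimes>\<^bsub>Suc (Suc n)\<^esub> id) t)"
    if "t \<in> tensor_space (bar_word (Suc (Suc n)))" for n t
  proof -
    have "d n \<circ> R (Suc n) \<doteq>\<^bsub>bar_word (Suc n) @ [FH]\<^esub> R n \<circ> (d n \<otimes>\<^bsub>length (bar_word (Suc n))\<^esub> id)"
      using hom[of n] by (simp only: hopf_bimodule_hom_def)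
    with that show ?thesis by (simp add: map_eq_def bar_word_Suc[of "Suc n"])
  qed
  have d_mem: "d n t \<in> tensor_space (bar_word n)" if "t \<in> tensor_space (bar_word (Suc n))" for n t
    by (rule tensor_homD(1)[OF _ that]) (use hom[of n] in \<open>simp add: hopf_bimodule_hom_def\<close>)
  show "map factor_of xs = bar_word (Suc (Suc n)) \<Longrightarrow> d n (d (Suc n) (etensor xs)) = 0" for xs
  proof (induction n arbitrary: xs)
    case 0
    have x: "etensor xs \<in> tensor_space (bar_word (Suc (Suc 0)))" using 0 by (rule etensor_in_tensor_space)
    have d0: "d 0 = R 0" unfolding d_def R_def by simp
    have "d 0 (d (Suc 0) (etensor xs)) =
        d 0 ((d 0 \<otimes>\<^bsub>Suc (Suc 0)\<^esub> id) (etensor xs)) + tscale (- 1) (d 0 (R (Suc 0) (etensor xs)))"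
      unfolding dS total_linear_add[OF totals(5)] total_linear_scale[OF totals(5)] by simp
    then show ?case unfolding equivariant[OF x] by (simp add: d0)
  next
    case (Suc n)
    have x: "etensor xs \<in> tensor_space (bar_word (Suc (Suc (Suc n))))" using Suc.prems by (rule etensor_in_tensor_space)
    from Suc.prems obtain ys a where xs: "xs = ys @ [Inr a]" and ys: "map factor_of ys = bar_word (Suc (Suc n))"
      by (subst (asm) bar_word_Suc) (auto simp: shape_conv)
    have len: "length ys = Suc (Suc (Suc n))" using arg_cong[OF ys, where f = length] by simp
    let ?z = "juxt (d (Suc n) (etensor ys)) (etensor [Inr a])"
    have z: "(d (Suc n) \<otimes>\<^bsub>Suc (Suc (Suc n))\<^esub> id) (etensor xs) = ?z"
      by (simp add: xs len tensor_map_total totals)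
    have "(d n \<otimes>\<^bsub>Suc (Suc n)\<^esub> id) ?z = juxt (d n (d (Suc n) (etensor ys))) (etensor [Inr a])"
      using tensor_map_juxt[OF totals(5) total_linear_id d_mem[OF etensor_in_tensor_space[OF ys]]] by simp
    also have "\<dots> = 0" by (simp add: Suc.IH[OF ys])
    finally have "d (Suc n) ?z = tscale ((- 1) ^ Suc n) (R (Suc n) ?z)"
      using dS[of n ?z] by simp
    moreover have "d (Suc n) (R (Suc (Suc n)) (etensor xs)) = R (Suc n) ?z"
      using equivariant[OF x] z by simp
    ultimately show ?case
      unfolding dS[of "Suc n"] z total_linear_add[OF totals(5)] total_linear_scale[OF totals(5)] by simp
  qed
qed

end

context tensor_words
begin

interpretation vT: vector_space "tscale :: 'k \<Rightarrow> ('k, 'm, 'h) tensor \<Rightarrow> ('k, 'm, 'h) tensor"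
  by (rule vector_space_tscale)

lemma same_hom_bar_right:
  assumes "same_hom [FH, FH] [FH] \<mu> \<mu>'" "same_hom [FM, FH] [FM] \<rho> \<rho>'" "total_linear \<mu>'" "total_linear \<rho>'"
  shows "same_hom (bar_word n @ [FH]) (bar_word n) (bar_rho \<mu> \<rho> n) (bar_right \<mu>' \<rho>' n)"
proof (rule same_hom_trans_total)
  show "bar_rho \<mu>' \<rho>' n (etensor xs) = bar_right \<mu>' \<rho>' n (etensor xs)"
    if "map factor_of xs = bar_word n @ [FH]" for xs
    using assms(3) that by (rule bar_rho_eq)
  show "same_hom (bar_word n @ [FH]) (bar_word n) (bar_rho \<mu> \<rho> n) (bar_rho \<mu>' \<rho>' n)"
  proof (cases n)
    case 0
    then show ?thesis using assms(2) by (simp add: bar_rho_def bar_word_def)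
  next
    case (Suc k)
    have "same_hom (bar_word n @ [FH]) (bar_word n) (at_pos (n + 1) 2 \<mu>) (at_pos (n + 1) 2 \<mu>')"
      by (rule same_hom_at_pos[OF assms(1), of "bar_word k" _ _ "[]"]) (simp_all add: Suc bar_word_Suc)
    then show ?thesis by (simp add: bar_rho_def Suc)
  qed
qed (simp_all add: assms total_bar)

lemma same_hom_bar_left:
  assumes "same_hom [FH, FM] [FM] lam lam'" "total_linear lam'"
  shows "same_hom (FH # bar_word n) (bar_word n) (bar_lambda lam) (bar_left lam' n)"
proof (rule same_hom_trans_total)
  show "bar_lambda lam' (etensor xs) = bar_left lam' n (etensor xs)"
    if "map factor_of xs = FH # bar_word n" for xs
    using assms(2) that by (rule bar_lambda_eq)
  show "same_hom (FH # bar_word n) (bar_word n) (bar_lambda lam) (bar_lambda lam')"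
    unfolding bar_lambda_def
    by (rule same_hom_at_pos[OF assms(1), of "[]" _ _ "replicate n FH"]) (simp_all add: bar_word_def)
qed (simp_all add: assms total_bar)

lemma same_hom_bar_diff:
  assumes "same_hom [FH, FH] [FH] \<mu> \<mu>'" "same_hom [FM, FH] [FM] \<rho> \<rho>'" "total_linear \<mu>'" "total_linear \<rho>'"
  shows "same_hom (bar_word (Suc n)) (bar_word n) (bar_d \<mu> \<rho> (Suc n)) (bar_diff \<mu>' \<rho>' n)"
  by (rule same_hom_trans_total[OF same_hom_bar_d[OF assms(1,2)] _ bar_d_eq]) (simp_all add: assms total_bar)

end

context sweedler_bialgebra
begin

text \<open>
  In degree 0 nothing is multiplied, and unshuffling a word of length 2 does nothing.
\<close>

lemma bar_delta_eq:
  assumes \<delta>: "total_linear \<delta>" "\<delta> \<in> tensor_hom [FM] [FM, FH]"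
  shows "map factor_of xs = bar_word n \<Longrightarrow> bar_delta \<mu> \<Delta> \<delta> n (etensor xs) = bar_coright \<mu> \<Delta> \<delta> n (etensor xs)"
proof (induction n arbitrary: xs)
  case 0
  then obtain m where xs: "xs = [Inl m]" by (auto simp: bar_word_def shape_conv)
  have "\<delta> (etensor xs) \<in> tensor_space [FM, FH]"
    by (rule tensor_homD(1)[OF \<delta>(2) etensor_in_tensor_space]) (simp add: xs)
  from tensor_space_sum[OF this] obtain k l
    where kl: "\<delta> (etensor xs) = (\<Sum>i<(k::nat). etensor (l i))" "\<And>i. map factor_of (l i) = [FM, FH]" by auto
  have l: "odds (l i) @ evens (l i) = l i" "length (l i) = 2" for i
    using kl(2)[of i] by (auto simp: shape_conv)
  have "permute (inv (omega 1)) (etensor (l i)) = etensor (l i)" for i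
    using permute_etensor[of "l i" 1] l by simp
  then show ?case
    using \<delta> by (simp add: bar_delta_def tensor_map_total xs[symmetric] total_linear_tensors)
       (simp add: xs kl[unfolded xs] permute_sum)
next
  case (Suc n)
  from Suc.prems obtain ys a where xs: "xs = ys @ [Inr a]" and ys: "map factor_of ys = bar_word n"
    by (subst (asm) bar_word_Suc) (auto simp: shape_conv)
  have len: "length ys = Suc n" using arg_cong[OF ys, where f = length] by simp
  show ?case
    unfolding xs bar_delta_snoc[OF \<delta> ys]
    by (simp add: Suc.IH[OF ys] diag_right_def tensor_map_total total_bar \<delta> len)
qed

lemma bar_gamma_eq:
  assumes \<gamma>: "total_linear \<gamma>" "\<gamma> \<in> tensor_hom [FM] [FH, FM]"
  shows "map factor_of xs = bar_word n \<Longrightarrow> bar_gamma \<mu> \<Delta> \<gamma> n (etensor xs) = bar_coleft \<mu> \<Delta> \<gamma> n (etensor xs)"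
proof (induction n arbitrary: xs)
  case 0
  then obtain m where xs: "xs = [Inl m]" by (auto simp: bar_word_def shape_conv)
  have "\<gamma> (etensor xs) \<in> tensor_space [FH, FM]"
    by (rule tensor_homD(1)[OF \<gamma>(2) etensor_in_tensor_space]) (simp add: xs)
  from tensor_space_sum[OF this] obtain k l
    where kl: "\<gamma> (etensor xs) = (\<Sum>i<(k::nat). etensor (l i))" "\<And>i. map factor_of (l i) = [FH, FM]" by auto
  have l: "odds (l i) @ evens (l i) = l i" "length (l i) = 2" for i
    using kl(2)[of i] by (auto simp: shape_conv)
  have "permute (inv (omega 1)) (etensor (l i)) = etensor (l i)" for i
    using permute_etensor[of "l i" 1] l by simp
  then show ?case
    using \<gamma> by (simp add: bar_gamma_def tensor_map_total xs[symmetric] total_linear_tensors)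
       (simp add: xs kl[unfolded xs] permute_sum)
next
  case (Suc n)
  from Suc.prems obtain ys a where xs: "xs = ys @ [Inr a]" and ys: "map factor_of ys = bar_word n"
    by (subst (asm) bar_word_Suc) (auto simp: shape_conv)
  have len: "length ys = Suc n" using arg_cong[OF ys, where f = length] by simp
  show ?case
    unfolding xs bar_gamma_snoc[OF \<gamma> ys]
    by (simp add: Suc.IH[OF ys] diag_left_def tensor_map_total total_bar \<gamma> len)
qed

end

context tensor_words
begin

interpretation vT: vector_space "tscale :: 'k \<Rightarrow> ('k, 'm, 'h) tensor \<Rightarrow> ('k, 'm, 'h) tensor"
  by (rule vector_space_tscale)

text \<open>
  Transfer of the recursive description, formed from the extended structure maps, to the explicit
  formulas in the given ones.
\<close>

lemma bar_complex:
  assumes H: "bialgebra \<mu> \<nu> \<Delta> \<epsilon>" and M: "hopf_bimodule \<mu> \<nu> \<Delta> \<epsilon> [FM] \<rho> lam \<delta> \<gamma>"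
  shows "hopf_bimodule \<mu> \<nu> \<Delta> \<epsilon> (bar_word n) (bar_rho \<mu> \<rho> n) (bar_lambda lam) (bar_delta \<mu> \<Delta> \<delta> n) (bar_gamma \<mu> \<Delta> \<gamma> n)"
    and "hopf_bimodule_hom (bar_word (Suc n))
      (bar_rho \<mu> \<rho> (Suc n)) (bar_lambda lam) (bar_delta \<mu> \<Delta> \<delta> (Suc n)) (bar_gamma \<mu> \<Delta> \<gamma> (Suc n))
      (bar_word n) (bar_rho \<mu> \<rho> n) (bar_lambda lam) (bar_delta \<mu> \<Delta> \<delta> n) (bar_gamma \<mu> \<Delta> \<gamma> n) (bar_d \<mu> \<rho> (Suc n))"
    and "t \<in> tensor_space (bar_word (Suc (Suc n))) \<Longrightarrow> bar_d \<mu> \<rho> (Suc n) (bar_d \<mu> \<rho> (Suc (Suc n)) t) = 0"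
proof -
  define \<mu>' \<nu>' \<Delta>' \<epsilon>' where H'_def: "\<mu>' = totalize [FH, FH] \<mu>" "\<nu>' = totalize [] \<nu>" "\<Delta>' = totalize [FH] \<Delta>" "\<epsilon>' = totalize [FH] \<epsilon>"
  define \<rho>' lam' \<delta>' \<gamma>' where M'_def: "\<rho>' = totalize [FM, FH] \<rho>" "lam' = totalize [FH, FM] lam"
    "\<delta>' = totalize [FM] \<delta>" "\<gamma>' = totalize [FM] \<gamma>"
  have homs: "\<mu> \<in> tensor_hom [FH, FH] [FH]" "\<nu> \<in> tensor_hom [] [FH]" "\<Delta> \<in> tensor_hom [FH] [FH, FH]" "\<epsilon> \<in> tensor_hom [FH] []"
    "\<rho> \<in> tensor_hom [FM, FH] [FM]" "lam \<in> tensor_hom [FH, FM] [FM]" "\<delta> \<in> tensor_hom [FM] [FM, FH]" "\<gamma> \<in> tensor_hom [FM] [FH, FM]"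
    using H M by (simp_all add: bialgebra_def hopf_bimodule_def bimodule_def bicomodule_def)
  note total = homs[THEN total_linear_totalize, folded H'_def M'_def]
  note same = homs[THEN same_hom_totalize, folded H'_def M'_def]
  have H': "bialgebra \<mu>' \<nu>' \<Delta>' \<epsilon>'" by (rule bialgebra_cong[OF H same(1-4)])
  have M': "hopf_bimodule \<mu>' \<nu>' \<Delta>' \<epsilon>' [FM] \<rho>' lam' \<delta>' \<gamma>'"
    by (rule hopf_bimodule_cong[OF M same(1-4)]) (use same in simp_all)
  from ex_sweedler_bialgebra[OF H' total(1-4)] obtain mul one eps cop hl hr
    where "sweedler_bialgebra sM sH \<mu>' \<nu>' \<Delta>' \<epsilon>' mul one eps cop hl hr" by blast
  then interpret H: sweedler_bialgebra sM sH \<mu>' \<nu>' \<Delta>' \<epsilon>' mul one eps cop hl hr .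
  have co: "\<delta>' \<in> tensor_hom [FM] [FM, FH]" "\<gamma>' \<in> tensor_hom [FM] [FH, FM]"
    using same by (simp_all add: same_hom_def)
  have r: "same_hom (bar_word n @ [FH]) (bar_word n) (bar_right \<mu>' \<rho>' n) (bar_rho \<mu> \<rho> n)" for n
    by (rule same_hom_sym[OF same_hom_bar_right[OF same(1,5) total(1,5)]])
  have l: "same_hom (FH # bar_word n) (bar_word n) (bar_left lam' n) (bar_lambda lam)" for n
    by (rule same_hom_sym[OF same_hom_bar_left[OF same(6) total(6)]])
  have dr: "same_hom (bar_word n) (bar_word n @ [FH]) (bar_coright \<mu>' \<Delta>' \<delta>' n) (bar_delta \<mu> \<Delta> \<delta> n)" for n
    by (rule same_hom_sym[OF same_hom_trans_total[OF same_hom_bar_delta[OF same(1,3,7)]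
          total_bar(3)[OF total(1,3,7)] H.bar_delta_eq[OF total(7) co(1)]]])
  have dl: "same_hom (bar_word n) (FH # bar_word n) (bar_coleft \<mu>' \<Delta>' \<gamma>' n) (bar_gamma \<mu> \<Delta> \<gamma> n)" for n
    by (rule same_hom_sym[OF same_hom_trans_total[OF same_hom_bar_gamma[OF same(1,3,8)]
          total_bar(4)[OF total(1,3,8)] H.bar_gamma_eq[OF total(8) co(2)]]])
  have d: "same_hom (bar_word (Suc n)) (bar_word n) (bar_d \<mu> \<rho> (Suc n)) (bar_diff \<mu>' \<rho>' n)" for n
    by (rule same_hom_bar_diff[OF same(1,5) total(1,5)])
  note bar = H.bar_hopf[OF M' total(5-8)] H.bar_hom[OF M' total(5-8)] H.bar_square[OF M' total(5-8)]
  show "hopf_bimodule \<mu> \<nu> \<Delta> \<epsilon> (bar_word n) (bar_rho \<mu> \<rho> n) (bar_lambda lam) (bar_delta \<mu> \<Delta> \<delta> n) (bar_gamma \<mu> \<Delta> \<gamma> n)"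
    by (rule hopf_bimodule_cong[OF bar(1) same(1-4)[THEN same_hom_sym] r l dr dl])
  show "hopf_bimodule_hom (bar_word (Suc n))
      (bar_rho \<mu> \<rho> (Suc n)) (bar_lambda lam) (bar_delta \<mu> \<Delta> \<delta> (Suc n)) (bar_gamma \<mu> \<Delta> \<gamma> (Suc n))
      (bar_word n) (bar_rho \<mu> \<rho> n) (bar_lambda lam) (bar_delta \<mu> \<Delta> \<delta> n) (bar_gamma \<mu> \<Delta> \<gamma> n) (bar_d \<mu> \<rho> (Suc n))"
    by (rule hopf_bimodule_hom_cong[OF bar(2) d[THEN same_hom_sym] r l dr dl r l dr dl])
  show "bar_d \<mu> \<rho> (Suc n) (bar_d \<mu> \<rho> (Suc (Suc n)) t) = 0" if t: "t \<in> tensor_space (bar_word (Suc (Suc n)))" for t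
  proof -
    let ?d = "bar_diff \<mu>' \<rho>'"
    have total_d: "total_linear (?d n)" for n by (rule total_bar(5)[OF total(1,5)])
    have "?d (Suc n) \<in> tensor_hom (bar_word (Suc (Suc n))) (bar_word (Suc n))"
      using d[of "Suc n"] by (simp add: same_hom_def)
    from tensor_homD(1)[OF this t] have "?d (Suc n) t \<in> tensor_space (bar_word (Suc n))" .
    moreover have "bar_d \<mu> \<rho> (Suc (Suc n)) t = ?d (Suc n) t"
      using d[of "Suc n"] t by (simp add: same_hom_def map_eq_def del: bar_diff.simps)
    ultimately have "bar_d \<mu> \<rho> (Suc n) (bar_d \<mu> \<rho> (Suc (Suc n)) t) = ?d n (?d (Suc n) t)"
      using d[of n] by (simp add: same_hom_def map_eq_def del: bar_diff.simps)
    also have "\<dots> = 0"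
      using t
    proof (induction rule: tensor_space_induct)
      case zero
      show ?case unfolding total_linear_zero[OF total_d] ..
    next
      case (step c xs t)
      show ?case
        unfolding total_linear_add[OF total_d] total_linear_scale[OF total_d] bar(3)[OF step(1)] step(3)
        by simp
    qed
    finally show ?thesis .
  qed
qed

end

theorem proposition7p3:
  fixes sM :: "'k::field \<Rightarrow> 'm::ab_group_add \<Rightarrow> 'm"
    and sH :: "'k \<Rightarrow> 'h::ab_group_add \<Rightarrow> 'h"
    and \<mu> \<nu> \<Delta> \<epsilon> \<rho> lam \<delta> \<gamma> :: "('k, 'm, 'h) tensor \<Rightarrow> ('k, 'm, 'h) tensor"
  assumes fd_M: "\<exists>B. finite_dimensional_vector_space sM B"
    and fd_H: "\<exists>B. finite_dimensional_vector_space sH B"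
    and H: "tensor_words.bialgebra sM sH \<mu> \<nu> \<Delta> \<epsilon>"
    and M: "tensor_words.hopf_bimodule sM sH \<mu> \<nu> \<Delta> \<epsilon> [FM] \<rho> lam \<delta> \<gamma>"
  shows "(\<forall>n. tensor_words.hopf_bimodule sM sH \<mu> \<nu> \<Delta> \<epsilon> (bar_word n)
        (tensor_words.bar_rho sM sH \<mu> \<rho> n) (tensor_words.bar_lambda sM sH lam)
        (tensor_words.bar_delta sM sH \<mu> \<Delta> \<delta> n) (tensor_words.bar_gamma sM sH \<mu> \<Delta> \<gamma> n)) \<and>
    (\<forall>n\<ge>1. tensor_words.hopf_bimodule_hom sM sH
        (bar_word n)
        (tensor_words.bar_rho sM sH \<mu> \<rho> n) (tensor_words.bar_lambda sM sH lam)
        (tensor_words.bar_delta sM sH \<mu> \<Delta> \<delta> n) (tensor_words.bar_gamma sM sH \<mu> \<Delta> \<gamma> n)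
        (bar_word (n - 1))
        (tensor_words.bar_rho sM sH \<mu> \<rho> (n - 1)) (tensor_words.bar_lambda sM sH lam)
        (tensor_words.bar_delta sM sH \<mu> \<Delta> \<delta> (n - 1)) (tensor_words.bar_gamma sM sH \<mu> \<Delta> \<gamma> (n - 1))
        (tensor_words.bar_d sM sH \<mu> \<rho> n)) \<and>
    (\<forall>n\<ge>2. \<forall>t \<in> tensor_words.tensor_space sM sH (bar_word n).
        tensor_words.bar_d sM sH \<mu> \<rho> (n - 1) (tensor_words.bar_d sM sH \<mu> \<rho> n t) = 0)"
proof -
  have "vector_space sM" "vector_space sH"
    using fd_M fd_H by (blast intro: finite_dimensional_vector_space.axioms(1))+
  then interpret tensor_words sM sH
    by (rule tensor_words.intro)
  show ?thesis
  proof (intro conjI allI impI ballI)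
    fix n
    show "hopf_bimodule \<mu> \<nu> \<Delta> \<epsilon> (bar_word n) (bar_rho \<mu> \<rho> n) (bar_lambda lam) (bar_delta \<mu> \<Delta> \<delta> n) (bar_gamma \<mu> \<Delta> \<gamma> n)"
      by (rule bar_complex(1)[OF H M])
  next
    fix n :: nat assume "1 \<le> n"
    then obtain k where n: "n = Suc k" by (cases n) auto
    show "hopf_bimodule_hom (bar_word n)
      (bar_rho \<mu> \<rho> n) (bar_lambda lam) (bar_delta \<mu> \<Delta> \<delta> n) (bar_gamma \<mu> \<Delta> \<gamma> n)
      (bar_word (n - 1)) (bar_rho \<mu> \<rho> (n - 1)) (bar_lambda lam) (bar_delta \<mu> \<Delta> \<delta> (n - 1)) (bar_gamma \<mu> \<Delta> \<gamma> (n - 1)) (bar_d \<mu> \<rho> n)"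
      using bar_complex(2)[OF H M, of k] by (simp add: n)
  next
    fix n :: nat and t assume "2 \<le> n" and t: "t \<in> tensor_space (bar_word n)"
    from le_Suc_ex[OF this(1)] obtain k where n: "n = Suc (Suc k)" by auto
    show "bar_d \<mu> \<rho> (n - 1) (bar_d \<mu> \<rho> n t) = 0"
      using bar_complex(3)[OF H M, of t k] t by (simp add: n)
  qed
qed

end
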